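(* Let $c$ be a positive integer and let $\mu,\nu$ be non-zero real numbers. Let $D^\infty$ be the smooth subalgebra of the quantum Heisenberg manifold $D^c_{\mu\nu}$, $\Xi^\infty$ the right $D^\infty$-module of Schwartz functions on $\mathbb{R}\times\mathbb{T}$ with its $D^\infty$-valued inner product, and $\mathfrak{g}$ the Heisenberg Lie algebra with basis $X,Y,Z$, all as described in the context. Let $\nabla^0:\Xi^\infty\to\Xi^\infty\otimes\mathfrak{g}^*$ be the compatible connection determined by $$(\nabla^0_X f)(x,y)=-\frac{\partial f}{\partial x}(x,y),\qquad (\nabla^0_Y f)(x,y)=-\frac{\partial f}{\partial y}(x,y)+\frac{\pi c i}{2\mu}x^2 f(x,y),\qquad (\nabla^0_Z f)(x,y)=\frac{\pi i x}{\mu}f(x,y)$$ for $f\in\Xi^\infty$. Then $\nabla^0$ is a minimum of the Yang-Mills functional, i.e. $\mathrm{YM}(\nabla)\ge\mathrm{YM}(\nabla^0)$ for every compatible connection $\nabla$ on $\Xi^\infty$.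
   Context: Notation: $e(t)=\exp(2\pi i t)$, $\mathbb{T}=\mathbb{R}/\mathbb{Z}$, and $\overline{e}$ denotes the complex conjugate of $e$. Quantum Heisenberg manifold. Let $D_0$ be the set of continuous functions $\phi$ on $\mathbb{R}\times\mathbb{T}\times\mathbb{Z}$ with compact support in the $\mathbb{Z}$ variable satisfying $\phi(x+k,y,p)=e(ckp(y-p\nu))\phi(x,y,p)$ for all $k,p\in\mathbb{Z}$, $(x,y)\in\mathbb{R}\times\mathbb{T}$. It is a $*$-algebra with $(\phi\psi)(x,y,p)=\sum_q\phi(x,y,q)\psi(x-2q\mu,y-2q\nu,p-q)$ and $\phi^*(x,y,p)=\overline{\phi(x-2p\mu,y-2p\nu,-p)}$. The quantum Heisenberg manifold $D^c_{\mu\nu}$ is the closure of $D_0$ in the multiplier algebra of the crossed product $C_0(\mathbb{R}\times\mathbb{T})\times_\lambda\mathbb{Z}$, where $\lambda(x,y)=(x+2\mu,y+2\nu)$. Group action. $G$ is the Heisenberg group $\mathbb{R}^3$ with product $(r,s,t)(r',s',t')=(r+r',s+s',t+t'+csr')$, identified with the matrices $\begin{pmatrix}1&s&t/c\\0&1&r\\0&0&1\end{pmatrix}$. It acts on $D^c_{\mu\nu}$ by $\alpha_{(r,s,t)}(\phi)(x,y,p)=e(p(t+cs(x-p\mu-r)))\phi(x-r,y-s,p)$. Let $D^\infty$ be the dense $*$-subalgebra of $C^\infty$-vectors for $\alpha$; its elements are the smooth functions $\phi$ on $\mathbb{R}\times\mathbb{T}\times\mathbb{Z}$ satisfying the displayed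 quasi-periodicity condition and such that, for all $k,m,n\in\mathbb{N}$ and compact $K\subset\mathbb{R}\times\mathbb{T}$, $\sup_{(x,y)\in K,\,p\in\mathbb{Z}}|p^k\partial_x^m\partial_y^n\phi(x,y,p)|<\infty$. The Lie algebra $\mathfrak{g}$ of $G$ has basis $X=E_{23}$, $Y=E_{12}$, $Z=\frac1c E_{13}$ ($E_{ij}$ the $3\times3$ matrix units), so $[X,Y]=-cZ$, $[Y,Z]=[Z,X]=0$; $\mathfrak{g}$ is given the inner product for which $Z_1=X,Z_2=Y,Z_3=Z$ is an orthonormal basis. The infinitesimal action $\delta$ of $\mathfrak{g}$ on $D^\infty$ by derivations is $\delta_X(\phi)=-\partial_x\phi$, $\delta_Y(\phi)(x,y,p)=-\partial_y\phi(x,y,p)+2\pi i c p(x-p\mu)\phi(x,y,p)$, $\delta_Z(\phi)(x,y,p)=2\pi i p\,\phi(x,y,p)$, extended linearly to $\mathfrak{g}$. The faithful, $\delta$-invariant trace on $D^\infty$ is $\tau(\phi)=\int_{\mathbb{T}^2}\phi(x,y,0)\,dx\,dy$. Module. $\Xi^\infty$ is the space of complex-valued Schwartz functions on $\mathbb{R}\times\mathbb{T}$ (smooth, with all derivatives rapidly decreasing in the $\mathbb{R}$ direction), regarded as a vector space with the conjugate complex structure (the scalar $\lambda$ acts by $f\mapsto\overline{\lambda}f$), so that it is a right $D^\infty$-module (finitely generated projective) under $$(f\cdot\phi)(x,y)=\sum_p\overline{\phi(x+2p\mu,y+2p\nu,p)}\,f(x+2p\mu,y+2p\nu),$$ with $D^\infty$-valued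 inner product $$\langle f,g\rangle(x,y,p)=\sum_{k\in\mathbb{Z}}\overline{e}(ckp(y-p\nu))\,f(x+k,y)\,\overline{g(x-2p\mu+k,y-2p\nu)}.$$ Let $E=\mathrm{End}_{D^\infty}(\Xi^\infty)$, with the adjoint taken with respect to $\langle\cdot,\cdot\rangle$. Every element of $E$ is a finite linear combination of the operators $\langle\xi,\eta\rangle_E$, $\xi,\eta\in\Xi^\infty$, defined by $\langle\xi,\eta\rangle_E(\zeta)=\xi\cdot\langle\eta,\zeta\rangle$; $\tau_E$ is the faithful trace on $E$ with $\tau_E(\langle\xi,\eta\rangle_E)=\tau(\langle\eta,\xi\rangle)$. Connections. A connection on $\Xi^\infty$ is a linear map $\nabla:\Xi^\infty\to\Xi^\infty\otimes\mathfrak{g}^*$ (write $\nabla_W$ for its contraction with $W\in\mathfrak{g}$; it depends linearly on $W$) such that $\nabla_W(\xi\cdot a)=\nabla_W(\xi)\cdot a+\xi\cdot\delta_W(a)$ for all $W\in\mathfrak{g}$, $\xi\in\Xi^\infty$, $a\in D^\infty$. It is compatible if moreover $\langle\nabla_W\xi,\eta\rangle+\langle\xi,\nabla_W\eta\rangle=\delta_W(\langle\xi,\eta\rangle)$ for all $\xi,\eta\in\Xi^\infty$, $W\in\mathfrak{g}$. Yang-Mills functional. The curvature of $\nabla$ is $\Theta_\nabla(V,W)=\nabla_V\nabla_W-\nabla_W\nabla_V-\nabla_{[V,W]}\in E$ for $V,W\in\mathfrak{g}$. For alternating $E$-valued $2$-forms $\Phi,\Psi$ on $\mathfrak{g}$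 put $\{\Phi,\Psi\}_E=\sum_{i<j}\Phi(Z_i,Z_j)\Psi(Z_i,Z_j)$. For a compatible connection $\nabla$, $\mathrm{YM}(\nabla)=-\tau_E(\{\Theta_\nabla,\Theta_\nabla\}_E)$. *)

theory Defs
  imports "HOL-Analysis.Analysis" "HOL-Library.Function_Algebras"
begin

text \<open>
  Functions on \<open>\<real> \<times> \<T>\<close> are functions of two real variables that are 1-periodic in the second one,
  and functions on \<open>\<real> \<times> \<T> \<times> \<int>\<close> carry a further integer argument.
  Sums of functions are pointwise (from \<open>Function_Algebras\<close>).
\<close>

type_synonym xi = "real \<Rightarrow> real \<Rightarrow> complex"
type_synonym dfun = "real \<Rightarrow> real \<Rightarrow> int \<Rightarrow> complex"
type_synonym xop = "xi \<Rightarrow> xi"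
type_synonym mat3 = "real^3^3"

definition ee :: "real \<Rightarrow> complex" where
  "ee t = exp (2 * of_real pi * \<i> * of_real t)"


subsection \<open>Smooth functions of two real variables\<close>

definition pdx :: "xi \<Rightarrow> xi" where
  "pdx f = (\<lambda>x y. vector_derivative (\<lambda>t. f t y) (at x))"

definition pdy :: "xi \<Rightarrow> xi" where
  "pdy f = (\<lambda>x y. vector_derivative (\<lambda>t. f x t) (at y))"

fun C_k :: "nat \<Rightarrow> xi \<Rightarrow> bool" where
  "C_k 0 f \<longleftrightarrow> continuous_on UNIV (\<lambda>(x, y). f x y)"
| "C_k (Suc k) f \<longleftrightarrow>
     continuous_on UNIV (\<lambda>(x, y). f x y) \<and>
     (\<forall>x y. (\<lambda>t. f t y) differentiable (at x) \<and> (\<lambda>t. f x t) differentiable (at y)) \<and>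
     C_k k (pdx f) \<and> C_k k (pdy f)"

definition smooth :: "xi \<Rightarrow> bool" where
  "smooth f \<longleftrightarrow> (\<forall>k. C_k k f)"


subsection \<open>The smooth algebra and the module\<close>

definition D_inf :: "nat \<Rightarrow> real \<Rightarrow> dfun set" where
  "D_inf c \<nu> = {\<phi>.
     (\<forall>p. smooth (\<lambda>x y. \<phi> x y p)) \<and>
     (\<forall>x y p. \<phi> x (y + 1) p = \<phi> x y p) \<and>
     (\<forall>x y p k. \<phi> (x + of_int k) y p
        = ee (of_nat c * of_int k * of_int p * (y - of_int p * \<nu>)) * \<phi> x y p) \<and>
     (\<forall>(k::nat) (m::nat) (n::nat) (K::(real \<times> real) set). compact K \<longrightarrow>
        (\<exists>C. \<forall>(x, y)\<in>K. \<forall>p.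
           norm (of_int p ^ k * (pdx ^^ m) ((pdy ^^ n) (\<lambda>x y. \<phi> x y p)) x y) \<le> C))}"

definition Xi_inf :: "xi set" where
  "Xi_inf = {f. smooth f \<and> (\<forall>x y. f x (y + 1) = f x y) \<and>
     (\<forall>(k::nat) (m::nat) (n::nat). \<exists>C. \<forall>x y.
        norm (of_real x ^ k * (pdx ^^ m) ((pdy ^^ n) f) x y) \<le> C)}"

text \<open>The module carries the conjugate complex structure.\<close>

definition xi_scale :: "complex \<Rightarrow> xi \<Rightarrow> xi" where
  "xi_scale l f = (\<lambda>x y. cnj l * f x y)"

definition xi_act :: "real \<Rightarrow> real \<Rightarrow> xi \<Rightarrow> dfun \<Rightarrow> xi" where
  "xi_act \<mu> \<nu> f \<phi> = (\<lambda>x y. \<Sum>\<^sub>\<infinity>p.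
     cnj (\<phi> (x + 2 * of_int p * \<mu>) (y + 2 * of_int p * \<nu>) p)
       * f (x + 2 * of_int p * \<mu>) (y + 2 * of_int p * \<nu>))"

definition xi_inner :: "nat \<Rightarrow> real \<Rightarrow> real \<Rightarrow> xi \<Rightarrow> xi \<Rightarrow> dfun" where
  "xi_inner c \<mu> \<nu> f g = (\<lambda>x y p. \<Sum>\<^sub>\<infinity>k.
     cnj (ee (of_nat c * of_int k * of_int p * (y - of_int p * \<nu>)))
       * f (x + of_int k) y
       * cnj (g (x - 2 * of_int p * \<mu> + of_int k) (y - 2 * of_int p * \<nu>)))"

definition trace_D :: "dfun \<Rightarrow> complex" where
  "trace_D \<phi> = set_lebesgue_integral lborel (cbox (0, 0) (1, 1)) (\<lambda>(x, y). \<phi> x y 0)"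


subsection \<open>The Heisenberg Lie algebra and its infinitesimal action\<close>

definition mat_unit :: "3 \<Rightarrow> 3 \<Rightarrow> mat3" where
  "mat_unit i j = (\<chi> k l. if k = i \<and> l = j then 1 else 0)"

definition X_heis :: mat3 where "X_heis = mat_unit 2 3"

definition Y_heis :: mat3 where "Y_heis = mat_unit 1 2"

definition Z_heis :: "nat \<Rightarrow> mat3" where "Z_heis c = (1 / of_nat c) *\<^sub>R mat_unit 1 3"

definition heis :: "nat \<Rightarrow> mat3 set" where
  "heis c = span {X_heis, Y_heis, Z_heis c}"

definition lie_bracket :: "mat3 \<Rightarrow> mat3 \<Rightarrow> mat3" where
  "lie_bracket V W = V ** W - W ** V"

text \<open>
  The coordinates of \<open>W\<close> in the basis \<open>X, Y, Z\<close> are \<open>W $ 2 $ 3\<close>, \<open>W $ 1 $ 2\<close> and \<open>c * W $ 1 $ 3\<close>.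
\<close>

definition delta :: "nat \<Rightarrow> real \<Rightarrow> mat3 \<Rightarrow> dfun \<Rightarrow> dfun" where
  "delta c \<mu> W \<phi> = (\<lambda>x y p.
      of_real (W $ 2 $ 3) * (- pdx (\<lambda>x y. \<phi> x y p) x y)
    + of_real (W $ 1 $ 2) * (- pdy (\<lambda>x y. \<phi> x y p) x y
        + 2 * of_real pi * \<i> * of_nat c * of_int p * of_real (x - of_int p * \<mu>) * \<phi> x y p)
    + of_real (of_nat c * W $ 1 $ 3) * (2 * of_real pi * \<i> * of_int p * \<phi> x y p))"


subsection \<open>The endomorphism algebra and its trace\<close>

text \<open>
  Endomorphisms are represented by functions that are \<open>undefined\<close> outside the module, so that
  equality in \<open>E_alg\<close> is equality of operators on the module; their product is \<open>compose Xi_inf\<close>.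
\<close>

definition E_alg :: "nat \<Rightarrow> real \<Rightarrow> real \<Rightarrow> xop set" where
  "E_alg c \<mu> \<nu> = {T \<in> Xi_inf \<rightarrow>\<^sub>E Xi_inf.
     (\<forall>\<xi>\<in>Xi_inf. \<forall>\<eta>\<in>Xi_inf. T (\<xi> + \<eta>) = T \<xi> + T \<eta>) \<and>
     (\<forall>\<xi>\<in>Xi_inf. \<forall>l. T (xi_scale l \<xi>) = xi_scale l (T \<xi>)) \<and>
     (\<forall>\<xi>\<in>Xi_inf. \<forall>a\<in>D_inf c \<nu>. T (xi_act \<mu> \<nu> \<xi> a) = xi_act \<mu> \<nu> (T \<xi>) a)}"

definition E_add :: "xop \<Rightarrow> xop \<Rightarrow> xop" where
  "E_add S T = (\<lambda>\<xi>\<in>Xi_inf. S \<xi> + T \<xi>)"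

definition E_scale :: "complex \<Rightarrow> xop \<Rightarrow> xop" where
  "E_scale l T = (\<lambda>\<xi>\<in>Xi_inf. xi_scale l (T \<xi>))"

definition E_zero :: xop where
  "E_zero = (\<lambda>\<xi>\<in>Xi_inf. 0)"

definition E_is_adjoint :: "nat \<Rightarrow> real \<Rightarrow> real \<Rightarrow> xop \<Rightarrow> xop \<Rightarrow> bool" where
  "E_is_adjoint c \<mu> \<nu> S T \<longleftrightarrow>
     (\<forall>\<xi>\<in>Xi_inf. \<forall>\<eta>\<in>Xi_inf. xi_inner c \<mu> \<nu> (T \<xi>) \<eta> = xi_inner c \<mu> \<nu> \<xi> (S \<eta>))"

definition E_inner :: "nat \<Rightarrow> real \<Rightarrow> real \<Rightarrow> xi \<Rightarrow> xi \<Rightarrow> xop" where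
  "E_inner c \<mu> \<nu> \<xi> \<eta> = (\<lambda>\<zeta>\<in>Xi_inf. xi_act \<mu> \<nu> \<xi> (xi_inner c \<mu> \<nu> \<eta> \<zeta>))"

definition faithful_trace_E :: "nat \<Rightarrow> real \<Rightarrow> real \<Rightarrow> (xop \<Rightarrow> complex) \<Rightarrow> bool" where
  "faithful_trace_E c \<mu> \<nu> t \<longleftrightarrow>
     (\<forall>S\<in>E_alg c \<mu> \<nu>. \<forall>T\<in>E_alg c \<mu> \<nu>. t (E_add S T) = t S + t T) \<and>
     (\<forall>T\<in>E_alg c \<mu> \<nu>. \<forall>l. t (E_scale l T) = l * t T) \<and>
     (\<forall>S\<in>E_alg c \<mu> \<nu>. \<forall>T\<in>E_alg c \<mu> \<nu>. t (compose Xi_inf S T) = t (compose Xi_inf T S)) \<and>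
     (\<forall>S\<in>E_alg c \<mu> \<nu>. \<forall>T\<in>E_alg c \<mu> \<nu>. E_is_adjoint c \<mu> \<nu> S T \<longrightarrow>
        t (compose Xi_inf S T) \<in> \<real>\<^sub>\<ge>\<^sub>0 \<and> (t (compose Xi_inf S T) = 0 \<longrightarrow> T = E_zero))"

text \<open>
  Since the operators \<open>E_inner \<xi> \<eta>\<close> span \<open>E_alg\<close>, the trace is determined on \<open>E_alg\<close> by its values
  on them; extensionality makes it unique as a function on the whole type.
\<close>

definition trace_E :: "nat \<Rightarrow> real \<Rightarrow> real \<Rightarrow> xop \<Rightarrow> complex" where
  "trace_E c \<mu> \<nu> = (THE t. t \<in> extensional (E_alg c \<mu> \<nu>) \<and> faithful_trace_E c \<mu> \<nu> t \<and>
     (\<forall>\<xi>\<in>Xi_inf. \<forall>\<eta>\<in>Xi_inf.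
        t (E_inner c \<mu> \<nu> \<xi> \<eta>) = trace_D (xi_inner c \<mu> \<nu> \<eta> \<xi>)))"


subsection \<open>Connections\<close>

text \<open>
  A linear map from the module to its tensor product with the dual of the Lie algebra is given by
  its contractions \<open>nabla W\<close>; these depend real-linearly on \<open>W\<close>. Values of \<open>nabla\<close> at arguments outside
  \<open>heis c\<close> and \<open>Xi_inf\<close> are irrelevant.
\<close>

definition connection :: "nat \<Rightarrow> real \<Rightarrow> real \<Rightarrow> (mat3 \<Rightarrow> xop) \<Rightarrow> bool" where
  "connection c \<mu> \<nu> nabla \<longleftrightarrow>
     (\<forall>W\<in>heis c. \<forall>\<xi>\<in>Xi_inf. nabla W \<xi> \<in> Xi_inf) \<and>
     (\<forall>W\<in>heis c. \<forall>\<xi>\<in>Xi_inf. \<forall>\<eta>\<in>Xi_inf. nabla W (\<xi> + \<eta>) = nabla W \<xi> + nabla W \<eta>) \<and>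
     (\<forall>W\<in>heis c. \<forall>\<xi>\<in>Xi_inf. \<forall>l. nabla W (xi_scale l \<xi>) = xi_scale l (nabla W \<xi>)) \<and>
     (\<forall>V\<in>heis c. \<forall>W\<in>heis c. \<forall>\<xi>\<in>Xi_inf. nabla (V + W) \<xi> = nabla V \<xi> + nabla W \<xi>) \<and>
     (\<forall>W\<in>heis c. \<forall>\<xi>\<in>Xi_inf. \<forall>r. nabla (r *\<^sub>R W) \<xi> = xi_scale (of_real r) (nabla W \<xi>)) \<and>
     (\<forall>W\<in>heis c. \<forall>\<xi>\<in>Xi_inf. \<forall>a\<in>D_inf c \<nu>.
        nabla W (xi_act \<mu> \<nu> \<xi> a) = xi_act \<mu> \<nu> (nabla W \<xi>) a + xi_act \<mu> \<nu> \<xi> (delta c \<mu> W a))"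

definition compatible_connection :: "nat \<Rightarrow> real \<Rightarrow> real \<Rightarrow> (mat3 \<Rightarrow> xop) \<Rightarrow> bool" where
  "compatible_connection c \<mu> \<nu> nabla \<longleftrightarrow> connection c \<mu> \<nu> nabla \<and>
     (\<forall>W\<in>heis c. \<forall>\<xi>\<in>Xi_inf. \<forall>\<eta>\<in>Xi_inf.
        xi_inner c \<mu> \<nu> (nabla W \<xi>) \<eta> + xi_inner c \<mu> \<nu> \<xi> (nabla W \<eta>)
          = delta c \<mu> W (xi_inner c \<mu> \<nu> \<xi> \<eta>))"

definition nabla0 :: "nat \<Rightarrow> real \<Rightarrow> mat3 \<Rightarrow> xop" where
  "nabla0 c \<mu> W f = (\<lambda>x y.
      of_real (W $ 2 $ 3) * (- pdx f x y)
    + of_real (W $ 1 $ 2) * (- pdy f x y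
        + of_real pi * of_nat c * \<i> / (2 * of_real \<mu>) * of_real x ^ 2 * f x y)
    + of_real (of_nat c * W $ 1 $ 3) * (of_real pi * \<i> * of_real x / of_real \<mu> * f x y))"


subsection \<open>The Yang-Mills functional\<close>

definition curvature :: "(mat3 \<Rightarrow> xop) \<Rightarrow> mat3 \<Rightarrow> mat3 \<Rightarrow> xop" where
  "curvature nabla V W =
     (\<lambda>\<xi>\<in>Xi_inf. nabla V (nabla W \<xi>) - nabla W (nabla V \<xi>) - nabla (lie_bracket V W) \<xi>)"

definition form_pairing ::
  "nat \<Rightarrow> (mat3 \<Rightarrow> mat3 \<Rightarrow> xop) \<Rightarrow> (mat3 \<Rightarrow> mat3 \<Rightarrow> xop) \<Rightarrow> xop" where
  "form_pairing c \<Phi> \<Psi> =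
     (let P = (\<lambda>V W. compose Xi_inf (\<Phi> V W) (\<Psi> V W))
      in E_add (E_add (P X_heis Y_heis) (P X_heis (Z_heis c))) (P Y_heis (Z_heis c)))"

definition YM :: "nat \<Rightarrow> real \<Rightarrow> real \<Rightarrow> (mat3 \<Rightarrow> xop) \<Rightarrow> complex" where
  "YM c \<mu> \<nu> nabla = - trace_E c \<mu> \<nu> (form_pairing c (curvature nabla) (curvature nabla))"

end

theory Submission
  imports Defs
begin

text \<open>
  An endomorphism acts on the module by a kernel in the first variable,
  \<open>(T \<zeta>)(x, y) = \<Sum>\<^sub>k K(x, y, k) \<zeta>(x + k, y)\<close>. Bump functions \<open>e\<^sub>i\<close> of \<open>x\<close> alone, supported on intervals of
  length less than 1 and with \<open>\<Sum>\<^sub>i \<Sum>\<^sub>p e\<^sub>i(x + 2p\<mu>)\<^sup>2 = 1\<close>, form a frame: \<open>\<zeta> = \<Sum>\<^sub>i e\<^sub>i \<cdot> \<langle>e\<^sub>i, \<zeta>\<rangle>\<close>. Hence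
  \<open>T = \<Sum>\<^sub>i \<langle>T e\<^sub>i, e\<^sub>i\<rangle>\<^sub>E\<close>, and the trace must be \<open>\<Sum>\<^sub>i \<tau>\<langle>e\<^sub>i, T e\<^sub>i\<rangle>\<close>; that this has the prescribed values on
  rank-one operators is an unfolding of an integral over the strip.

  The curvature of \<open>nabla0\<close> vanishes except for \<open>\<Theta>\<^sub>0(X, Z)\<close>, which is multiplication by \<open>-\<pi>\<i>/\<mu>\<close>. If
  \<open>\<Theta>(X, Z) = \<Theta>\<^sub>0(X, Z) + B\<close> for another compatible connection, then \<open>B\<close> is a sum of commutators of
  endomorphisms and commutators of \<open>nabla0\<close> with endomorphisms, so it has trace zero. Therefore
  \<open>-\<tau>(\<Theta>(X, Z)\<^sup>2) = -\<tau>(\<Theta>\<^sub>0(X, Z)\<^sup>2) - \<tau>(B\<^sup>2)\<close>, and \<open>-\<tau>(B\<^sup>2)\<close>, as well as the contributions of the other two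
  components of the curvature, is nonnegative by skew-adjointness.
\<close>


subsection \<open>Partial derivatives along words\<close>

text \<open>\<open>trace_E\<close> is a definite description, so no value of \<open>YM\<close> is
  accessible until a trace has been constructed and shown to be the only one; this is why most of
  the work is analysis. Actions, inner products and kernels are infinite sums whose derivatives of
  every order must decay, hence a calculus of weighted families in place of separate estimates.
  Supports shorter than 1 make \<open>e i x y * e i (x + k) y\<close> vanish for integers k \<noteq>
  0, so only the diagonal of a kernel survives against the frame. Finitely many bumps suffice
  because they only have to fill one period 2|\<mu>| of the translation. The potentials of
  \<open>nabla0\<close>, quadratic and linear in x, are the ones whose increments under x \<mapsto>
  x + 2p\<mu> are the potentials of \<open>delta\<close>. The component (X, Z) is favourable because
  [X, Z] = 0: writing a connection as \<open>nabla0\<close> plus A, no term A([X, Z]) is left over,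
  and only commutators remain. Their traces vanish because the trace on the algebra annihilates
  derivatives: for X by periodicity in x at p = 0, for Z because \<open>delta\<close> multiplies by
  p there.\<close>

lemma ee_add: "ee (a + b) = ee a * ee b"
  by (simp add: ee_def exp_add [symmetric] algebra_simps)

lemma norm_ee [simp]: "norm (ee t) = 1"
proof -
  have "ee t = exp (\<i> * of_real (2 * pi * t))"
    by (simp add: ee_def algebra_simps)
  then show ?thesis
    by (metis norm_exp_i_times)
qed

lemma cnj_ee: "cnj (ee t) = ee (- t)"
  by (simp add: ee_def exp_cnj)

lemma ee_0 [simp]: "ee 0 = 1"
  by (simp add: ee_def)

lemma ee_int [simp]: "ee (of_int n) = 1"
proof -
  have "ee (of_int n) = exp (of_int (2 * n) * (of_real pi * \<i>))"
    by (simp add: ee_def algebra_simps)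
  then show ?thesis
    using exp_integer_2pi [of "of_int n"] by (simp add: ee_def algebra_simps)
qed

lemma ee_has_vector_derivative:
  "((\<lambda>t. ee (a * t + b)) has_vector_derivative (2 * of_real pi * \<i> * of_real a * ee (a * t + b))) (at t)"
proof -
  have "((\<lambda>z. exp (2 * of_real pi * \<i> * (of_real a * z + of_real b))) has_field_derivative
      2 * of_real pi * \<i> * of_real a * ee (a * t + b)) (at (of_real t))"
    unfolding ee_def by (auto intro!: derivative_eq_intros)
  from has_vector_derivative_real_field [OF this] show ?thesis
    by (simp add: ee_def)
qed

text \<open>What a single unfolding of \<open>C_k\<close> demands of the function itself. Separating
  it from the recursion lets smoothness be handled through \<open>smooth_iff\<close>, without an
  order k.\<close>

definition diff2 :: "xi \<Rightarrow> bool" where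
  "diff2 f \<longleftrightarrow> continuous_on UNIV (\<lambda>(x, y). f x y) \<and>
     (\<forall>x y. (\<lambda>t. f t y) differentiable (at x) \<and> (\<lambda>t. f x t) differentiable (at y))"

text \<open>Words allow derivatives in any order, so that inductions with the Leibniz rule never
  have to commute partial derivatives. \<open>True\<close> stands for x, and the head of the word is
  applied first.\<close>

fun dd :: "bool list \<Rightarrow> xi \<Rightarrow> xi" where
  "dd [] f = f"
| "dd (b # w) f = dd w (if b then pdx f else pdy f)"

lemma dd_append: "dd (v @ w) f = dd w (dd v f)"
  by (induction v arbitrary: f) auto

lemma C_k_Suc: "C_k (Suc k) f \<longleftrightarrow> diff2 f \<and> C_k k (pdx f) \<and> C_k k (pdy f)"
  by (auto simp: diff2_def)

declare C_k.simps(2) [simp del]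

lemma C_k_SucD: "C_k (Suc k) f \<Longrightarrow> C_k k f"
proof (induction k arbitrary: f)
  case 0
  then show ?case by (simp add: C_k_Suc diff2_def)
next
  case (Suc k)
  then show ?case by (metis C_k_Suc)
qed

lemma smooth_iff: "smooth f \<longleftrightarrow> diff2 f \<and> smooth (pdx f) \<and> smooth (pdy f)"
proof
  assume "smooth f"
  then have "C_k (Suc k) f" for k by (simp add: smooth_def)
  then show "diff2 f \<and> smooth (pdx f) \<and> smooth (pdy f)"
    unfolding smooth_def C_k_Suc by auto
next
  assume *: "diff2 f \<and> smooth (pdx f) \<and> smooth (pdy f)"
  then have "C_k (Suc k) f" for k by (simp add: smooth_def C_k_Suc)
  then show "smooth f"
    unfolding smooth_def by (metis C_k_SucD)
qed

lemma smooth_diff2: "smooth f \<Longrightarrow> diff2 f"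
  and smooth_pdx: "smooth f \<Longrightarrow> smooth (pdx f)"
  and smooth_pdy: "smooth f \<Longrightarrow> smooth (pdy f)"
  using smooth_iff by blast+

lemma smooth_dd: "smooth f \<Longrightarrow> smooth (dd w f)"
  by (induction w arbitrary: f) (auto simp: smooth_pdx smooth_pdy)

lemma smooth_continuous: "smooth f \<Longrightarrow> continuous_on A (\<lambda>(x, y). f x y)"
  using smooth_diff2 [of f] continuous_on_subset unfolding diff2_def by blast

lemma has_pdx: "diff2 f \<Longrightarrow> ((\<lambda>t. f t y) has_vector_derivative pdx f x y) (at x)"
  and has_pdy: "diff2 f \<Longrightarrow> ((\<lambda>t. f x t) has_vector_derivative pdy f x y) (at y)"
  by (auto simp: diff2_def pdx_def pdy_def vector_derivative_works [symmetric])

text \<open>Explicit candidates for both partial derivatives yield regularity and the values of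
  \<open>pdx\<close> and \<open>pdy\<close> at once; the calculus rules that follow are
  instances.\<close>

lemma diff2I:
  assumes "continuous_on UNIV (\<lambda>(x, y). f x y)"
    and dx: "\<And>x y. ((\<lambda>t. f t y) has_vector_derivative g x y) (at x)"
    and dy: "\<And>x y. ((\<lambda>t. f x t) has_vector_derivative h x y) (at y)"
  shows "diff2 f" "pdx f = g" "pdy f = h"
proof -
  show "diff2 f"
    using assms(1) differentiableI_vector [OF dx] differentiableI_vector [OF dy]
    by (simp add: diff2_def)
  show "pdx f = g" "pdy f = h"
    using dx dy by (auto simp: pdx_def pdy_def fun_eq_iff intro: vector_derivative_at)
qed

lemma diff2_add:
  assumes "diff2 f" "diff2 g"
  shows "diff2 (\<lambda>x y. f x y + g x y)"
    and "pdx (\<lambda>x y. f x y + g x y) = (\<lambda>x y. pdx f x y + pdx g x y)"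
    and "pdy (\<lambda>x y. f x y + g x y) = (\<lambda>x y. pdy f x y + pdy g x y)"
proof -
  have c: "continuous_on UNIV (\<lambda>(x, y). f x y + g x y)"
    using assms by (auto simp: diff2_def case_prod_unfold intro!: continuous_intros)
  note * = diff2I [OF c, of "\<lambda>x y. pdx f x y + pdx g x y" "\<lambda>x y. pdy f x y + pdy g x y"]
  show "diff2 (\<lambda>x y. f x y + g x y)"
    and "pdx (\<lambda>x y. f x y + g x y) = (\<lambda>x y. pdx f x y + pdx g x y)"
    and "pdy (\<lambda>x y. f x y + g x y) = (\<lambda>x y. pdy f x y + pdy g x y)"
    by (rule *; intro has_vector_derivative_add has_pdx has_pdy assms)+
qed

lemma diff2_mult:
  assumes "diff2 f" "diff2 g"
  shows "diff2 (\<lambda>x y. f x y * g x y)"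
    and "pdx (\<lambda>x y. f x y * g x y) = (\<lambda>x y. pdx f x y * g x y + f x y * pdx g x y)"
    and "pdy (\<lambda>x y. f x y * g x y) = (\<lambda>x y. pdy f x y * g x y + f x y * pdy g x y)"
proof -
  have c: "continuous_on UNIV (\<lambda>(x, y). f x y * g x y)"
    using assms by (auto simp: diff2_def case_prod_unfold intro!: continuous_intros)
  have dx: "((\<lambda>t. f t y * g t y) has_vector_derivative pdx f x y * g x y + f x y * pdx g x y) (at x)"
    for x y
    using has_vector_derivative_mult [OF has_pdx has_pdx, OF assms] by (simp add: add.commute)
  have dy: "((\<lambda>t. f x t * g x t) has_vector_derivative pdy f x y * g x y + f x y * pdy g x y) (at y)"
    for x y
    using has_vector_derivative_mult [OF has_pdy has_pdy, OF assms] by (simp add: add.commute)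
  show "diff2 (\<lambda>x y. f x y * g x y)"
    and "pdx (\<lambda>x y. f x y * g x y) = (\<lambda>x y. pdx f x y * g x y + f x y * pdx g x y)"
    and "pdy (\<lambda>x y. f x y * g x y) = (\<lambda>x y. pdy f x y * g x y + f x y * pdy g x y)"
    by (rule diff2I [OF c dx dy])+
qed

lemma diff2_cnj:
  assumes "diff2 f"
  shows "diff2 (\<lambda>x y. cnj (f x y))"
    and "pdx (\<lambda>x y. cnj (f x y)) = (\<lambda>x y. cnj (pdx f x y))"
    and "pdy (\<lambda>x y. cnj (f x y)) = (\<lambda>x y. cnj (pdy f x y))"
proof -
  have c: "continuous_on UNIV (\<lambda>(x, y). cnj (f x y))"
    using assms by (auto simp: diff2_def case_prod_unfold intro!: continuous_intros)
  note * = diff2I [OF c, of "\<lambda>x y. cnj (pdx f x y)" "\<lambda>x y. cnj (pdy f x y)"]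
  show "diff2 (\<lambda>x y. cnj (f x y))"
    and "pdx (\<lambda>x y. cnj (f x y)) = (\<lambda>x y. cnj (pdx f x y))"
    and "pdy (\<lambda>x y. cnj (f x y)) = (\<lambda>x y. cnj (pdy f x y))"
    by (rule *; intro has_vector_derivative_cnj has_pdx has_pdy assms)+
qed

lemma continuous_on_shift2:
  fixes f :: xi
  assumes "continuous_on UNIV (\<lambda>(x, y). f x y)"
  shows "continuous_on UNIV (\<lambda>(x, y). f (x + a) (y + b))"
proof -
  have "continuous_on UNIV (\<lambda>z::real \<times> real. (fst z + a, snd z + b))"
    by (intro continuous_intros)
  from continuous_on_compose2 [OF assms this] show ?thesis
    by (simp add: case_prod_unfold)
qed

lemma diff2_shift:
  assumes "diff2 f"
  shows "diff2 (\<lambda>x y. f (x + a) (y + b))"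
    and "pdx (\<lambda>x y. f (x + a) (y + b)) = (\<lambda>x y. pdx f (x + a) (y + b))"
    and "pdy (\<lambda>x y. f (x + a) (y + b)) = (\<lambda>x y. pdy f (x + a) (y + b))"
proof -
  have c: "continuous_on UNIV (\<lambda>(x, y). f (x + a) (y + b))"
    using assms unfolding diff2_def by (intro continuous_on_shift2) simp
  have sh: "((\<lambda>t. t + r) has_vector_derivative 1) (at s)" for r s :: real
    by (auto intro!: derivative_eq_intros)
  have dx: "((\<lambda>t. f (t + a) (y + b)) has_vector_derivative pdx f (x + a) (y + b)) (at x)" for x y
    using vector_diff_chain_at [OF sh [of a x] has_pdx [OF assms, of "y + b" "x + a"]]
    by (simp add: o_def)
  have dy: "((\<lambda>t. f (x + a) (t + b)) has_vector_derivative pdy f (x + a) (y + b)) (at y)" for x y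
    using vector_diff_chain_at [OF sh [of b y] has_pdy [OF assms, of "x + a" "y + b"]]
    by (simp add: o_def)
  show "diff2 (\<lambda>x y. f (x + a) (y + b))"
    and "pdx (\<lambda>x y. f (x + a) (y + b)) = (\<lambda>x y. pdx f (x + a) (y + b))"
    and "pdy (\<lambda>x y. f (x + a) (y + b)) = (\<lambda>x y. pdy f (x + a) (y + b))"
    by (rule diff2I [OF c dx dy])+
qed

lemma diff2_const:
  shows "diff2 (\<lambda>x y. a)" "pdx (\<lambda>x y. a) = (\<lambda>x y. 0)" "pdy (\<lambda>x y. a) = (\<lambda>x y. 0)"
proof -
  have c: "continuous_on UNIV (\<lambda>(x::real, y::real). a)"
    by (simp add: case_prod_unfold)
  show "diff2 (\<lambda>x y. a)" "pdx (\<lambda>x y. a) = (\<lambda>x y. 0)" "pdy (\<lambda>x y. a) = (\<lambda>x y. 0)"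
    using diff2I [OF c, of "\<lambda>x y. 0" "\<lambda>x y. 0"] by simp_all
qed

lemma diff2_fst:
  shows "diff2 (\<lambda>x y. of_real x)" "pdx (\<lambda>x y. of_real x) = (\<lambda>x y. 1)"
    "pdy (\<lambda>x y. of_real x) = (\<lambda>x y. 0)"
proof -
  have c: "continuous_on UNIV (\<lambda>(x::real, y::real). complex_of_real x)"
    by (auto intro!: continuous_intros simp: case_prod_unfold)
  have dx: "(complex_of_real has_vector_derivative 1) (at x)" for x
    using has_vector_derivative_of_real [OF DERIV_ident] by simp
  have dy: "((\<lambda>t. complex_of_real x) has_vector_derivative 0) (at y)" for x y :: real
    by simp
  show "diff2 (\<lambda>x y. of_real x)" "pdx (\<lambda>x y. of_real x) = (\<lambda>x y. 1)"
    "pdy (\<lambda>x y. of_real x) = (\<lambda>x y. 0)"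
    by (rule diff2I [OF c dx dy])+
qed

lemma diff2_ee:
  shows "diff2 (\<lambda>x y. ee (a * y + b))" "pdx (\<lambda>x y. ee (a * y + b)) = (\<lambda>x y. 0)"
    "pdy (\<lambda>x y. ee (a * y + b)) = (\<lambda>x y. 2 * of_real pi * \<i> * of_real a * ee (a * y + b))"
proof -
  have c: "continuous_on UNIV (\<lambda>(x::real, y::real). ee (a * y + b))"
    unfolding ee_def by (auto intro!: continuous_intros simp: case_prod_unfold)
  note * = diff2I [OF c, of "\<lambda>x y. 0" "\<lambda>x y. 2 * of_real pi * \<i> * of_real a * ee (a * y + b)"]
  show "diff2 (\<lambda>x y. ee (a * y + b))" "pdx (\<lambda>x y. ee (a * y + b)) = (\<lambda>x y. 0)"
    "pdy (\<lambda>x y. ee (a * y + b)) = (\<lambda>x y. 2 * of_real pi * \<i> * of_real a * ee (a * y + b))"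
    by (rule *; simp add: ee_has_vector_derivative)+
qed

section \<open>Closure of smoothness under algebraic operations, and derivatives of the
  results\<close>

lemma C_k_const: "C_k k (\<lambda>x y. a)"
  by (induction k arbitrary: a) (auto simp: C_k_Suc diff2_const case_prod_unfold)

lemma C_k_add: "C_k k f \<Longrightarrow> C_k k g \<Longrightarrow> C_k k (\<lambda>x y. f x y + g x y)"
  by (induction k arbitrary: f g)
    (auto simp: C_k_Suc diff2_add case_prod_unfold intro!: continuous_intros)

lemma C_k_mult: "C_k k f \<Longrightarrow> C_k k g \<Longrightarrow> C_k k (\<lambda>x y. f x y * g x y)"
proof (induction k arbitrary: f g)
  case (Suc k)
  then have "C_k k f" "C_k k g" by (auto dest: C_k_SucD)
  with Suc show ?case
    by (auto simp: C_k_Suc diff2_mult intro!: C_k_add)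
qed (auto simp: case_prod_unfold intro!: continuous_intros)

lemma C_k_cnj: "C_k k f \<Longrightarrow> C_k k (\<lambda>x y. cnj (f x y))"
  by (induction k arbitrary: f)
    (auto simp: C_k_Suc diff2_cnj case_prod_unfold intro!: continuous_intros)

lemma C_k_shift: "C_k k f \<Longrightarrow> C_k k (\<lambda>x y. f (x + a) (y + b))"
  by (induction k arbitrary: f) (auto simp: C_k_Suc diff2_shift continuous_on_shift2)

lemma smooth_const: "smooth (\<lambda>x y. a)"
  by (simp add: smooth_def C_k_const)

lemma smooth_add: "smooth f \<Longrightarrow> smooth g \<Longrightarrow> smooth (\<lambda>x y. f x y + g x y)"
  by (simp add: smooth_def C_k_add)

lemma smooth_mult: "smooth f \<Longrightarrow> smooth g \<Longrightarrow> smooth (\<lambda>x y. f x y * g x y)"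
  by (simp add: smooth_def C_k_mult)

lemma smooth_cnj: "smooth f \<Longrightarrow> smooth (\<lambda>x y. cnj (f x y))"
  by (simp add: smooth_def C_k_cnj)

lemma smooth_shift: "smooth f \<Longrightarrow> smooth (\<lambda>x y. f (x + a) (y + b))"
  by (simp add: smooth_def C_k_shift)

lemma smooth_fst: "smooth (\<lambda>x y. of_real x)"
  using smooth_iff diff2_fst smooth_const by metis

lemma smooth_ee: "smooth (\<lambda>x y. ee (a * y + b))"
proof -
  have "C_k k (\<lambda>x y. ee (a * y + b))" for k
  proof (induction k)
    case 0
    show ?case using diff2_ee(1) [of a b] by (simp add: diff2_def)
  next
    case (Suc k)
    then show ?case
      by (auto simp: C_k_Suc diff2_ee intro!: C_k_mult C_k_const)
  qed
  then show ?thesis by (simp add: smooth_def)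
qed

lemma dd_const: "dd w (\<lambda>x y. a) = (\<lambda>x y. if w = [] then a else 0)"
  by (induction w arbitrary: a) (auto simp: diff2_const)

lemma dd_add:
  "smooth f \<Longrightarrow> smooth g \<Longrightarrow> dd w (\<lambda>x y. f x y + g x y) = (\<lambda>x y. dd w f x y + dd w g x y)"
  by (induction w arbitrary: f g) (auto simp: diff2_add smooth_diff2 smooth_pdx smooth_pdy)

lemma dd_cmult: "smooth f \<Longrightarrow> dd w (\<lambda>x y. a * f x y) = (\<lambda>x y. a * dd w f x y)"
  by (induction w arbitrary: f)
    (auto simp: diff2_mult [OF diff2_const(1)] diff2_const smooth_diff2 smooth_pdx smooth_pdy)

lemma dd_cnj: "smooth f \<Longrightarrow> dd w (\<lambda>x y. cnj (f x y)) = (\<lambda>x y. cnj (dd w f x y))"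
  by (induction w arbitrary: f) (auto simp: diff2_cnj smooth_diff2 smooth_pdx smooth_pdy)

lemma dd_shift: "smooth f \<Longrightarrow> dd w (\<lambda>x y. f (x + a) (y + b)) = (\<lambda>x y. dd w f (x + a) (y + b))"
  by (induction w arbitrary: f) (auto simp: diff2_shift smooth_diff2 smooth_pdx smooth_pdy)

lemma dd_ee:
  "dd w (\<lambda>x y. ee (a * y + b)) =
    (\<lambda>x y. if True \<in> set w then 0 else (2 * of_real pi * \<i> * of_real a) ^ length w * ee (a * y + b))"
proof (induction w)
  case (Cons d w)
  then show ?case
    by (cases d) (auto simp: diff2_ee dd_const dd_cmult smooth_ee fun_eq_iff)
qed simp

text \<open>Schwarz' theorem: write \<open>f x y - f x a\<close> as the integral of \<open>pdy f x\<close> over \<open>[a, y]\<close>,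
  differentiate in \<open>x\<close> under the integral, and then in \<open>y\<close>.\<close>

lemma pdx_pdy_commute:
  assumes f: "smooth f"
  shows "pdx (pdy f) = pdy (pdx f)"
proof (intro ext)
  fix x y0 :: real
  \<comment> \<open>Any base point below \<open>y0\<close> would do; this one makes
    \<open>y0\<close> interior to the interval of integration, so that a derivative within the
    interval is a derivative.\<close>
  define a where "a = y0 - 1"
  let ?h = "pdx (pdy f)"
  have cg: "continuous_on A (\<lambda>(x, y). pdy f x y)" and ch: "continuous_on A (\<lambda>(x, y). ?h x y)"
    for A
    by (intro smooth_continuous smooth_pdx smooth_pdy f)+
  have cg1: "continuous_on A (\<lambda>y. pdy f x y)" and ch1: "continuous_on A (\<lambda>y. ?h x y)" for A x
  proof -
    have p: "continuous_on A (\<lambda>y. (x, y))" by (intro continuous_intros)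
    show "continuous_on A (\<lambda>y. pdy f x y)" "continuous_on A (\<lambda>y. ?h x y)"
      using continuous_on_compose2 [OF cg [of UNIV] p] continuous_on_compose2 [OF ch [of UNIV] p]
      by simp_all
  qed
  have eq: "f x y = f x a + integral (cbox a y) (pdy f x)" if "a \<le> y" for x y
  proof -
    have "(pdy f x has_integral f x y - f x a) {a..y}"
      by (rule fundamental_theorem_of_calculus [OF that])
        (rule has_vector_derivative_at_within [OF has_pdy [OF smooth_diff2 [OF f]]])
    from integral_unique [OF this] show ?thesis by simp
  qed
  have px: "pdx f x y = pdx f x a + integral (cbox a y) (?h x)" if "a \<le> y" for y
  proof -
    have "((\<lambda>x. integral (cbox a y) (pdy f x)) has_vector_derivative
        integral (cbox a y) (?h x)) (at x within UNIV)"
      by (rule leibniz_rule_vector_derivative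
            [OF has_vector_derivative_at_within [OF has_pdx [OF smooth_diff2 [OF smooth_pdy [OF f]]]]
              integrable_continuous [OF cg1] ch]) simp_all
    then have "((\<lambda>x. f x a + integral (cbox a y) (pdy f x)) has_vector_derivative
        pdx f x a + integral (cbox a y) (?h x)) (at x)"
      by (intro has_vector_derivative_add has_pdx smooth_diff2 f) auto
    then have "((\<lambda>x. f x y) has_vector_derivative pdx f x a + integral (cbox a y) (?h x)) (at x)"
      using eq [OF that] by simp
    then show ?thesis
      using vector_derivative_at [of "\<lambda>x. f x y"] by (simp add: pdx_def [of f])
  qed
  have "((\<lambda>y. integral {a..y} (?h x)) has_vector_derivative ?h x y0) (at y0 within {a..y0+1})"
    by (rule integral_has_vector_derivative) (auto simp: ch1 a_def)
  from has_vector_derivative_add [OF has_vector_derivative_const this]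
  have "((\<lambda>y. pdx f x a + integral {a..y} (?h x)) has_vector_derivative ?h x y0)
      (at y0 within {a..y0+1})"
    by simp
  then have "(pdx f x has_vector_derivative ?h x y0) (at y0 within {a..y0+1})"
    by (rule has_vector_derivative_transform [rotated 2]) (simp add: a_def, subst px, auto)
  then have "(pdx f x has_vector_derivative ?h x y0) (at y0)"
    by (subst (asm) at_within_interior) (auto simp: a_def)
  then show "?h x y0 = pdy (pdx f) x y0"
    unfolding pdy_def [of "pdx f"] by (simp add: vector_derivative_at)
qed

lemma pdy_funpow_pdx: "smooth f \<Longrightarrow> (pdy ^^ n) (pdx f) = pdx ((pdy ^^ n) f)"
proof (induction n arbitrary: f)
  case (Suc n)
  then show ?case
    using Suc.IH [of "pdy f"] pdx_pdy_commute [OF Suc.prems] smooth_pdy [OF Suc.prems]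
    by (simp only: funpow_Suc_right o_apply)
qed simp

lemma dd_replicate: "dd (replicate n False @ replicate m True) f = (pdx ^^ m) ((pdy ^^ n) f)"
proof -
  have "dd (replicate n False) f = (pdy ^^ n) f" for f
    by (induction n arbitrary: f) (auto simp: funpow_swap1)
  moreover have "dd (replicate m True) f = (pdx ^^ m) f" for f
    by (induction m arbitrary: f) (auto simp: funpow_swap1)
  ultimately show ?thesis by (simp add: dd_append)
qed

text \<open>Each letter is moved to its place by the symmetry of mixed partials. The exponents
  depend on the word alone, so for a family of functions one pair (m, n) serves all members, as is
  needed to get bounds uniform in p.\<close>

lemma dd_sorted:
  "\<exists>m n. \<forall>f. smooth f \<longrightarrow> dd w f = (pdx ^^ m) ((pdy ^^ n) f)"
proof (induction w)
  case Nil
  show ?case by (rule exI [of _ 0], rule exI [of _ 0]) simp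
next
  case (Cons b w)
  then obtain m n where mn: "\<And>f. smooth f \<Longrightarrow> dd w f = (pdx ^^ m) ((pdy ^^ n) f)"
    by blast
  have *: "dd (b # w) f = (if b then (pdx ^^ Suc m) ((pdy ^^ n) f) else (pdx ^^ m) ((pdy ^^ Suc n) f))"
    if "smooth f" for f
    using mn [OF smooth_pdx [OF that]] mn [OF smooth_pdy [OF that]] pdy_funpow_pdx [OF that]
    by (simp add: funpow_swap1)
  then show ?case
  proof (cases b)
    case True
    then have "\<forall>f. smooth f \<longrightarrow> dd (b # w) f = (pdx ^^ Suc m) ((pdy ^^ n) f)"
      using * by simp
    then show ?thesis by blast
  next
    case False
    then have "\<forall>f. smooth f \<longrightarrow> dd (b # w) f = (pdx ^^ m) ((pdy ^^ Suc n) f)"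
      using * by simp
    then show ?thesis by blast
  qed
qed

subsection \<open>Families with rapidly decreasing derivatives\<close>

text \<open>The exponent \<open>M\<close> of \<open>u\<close> does not depend on \<open>j\<close>, so that \<open>u\<close> can be absorbed into \<open>v\<close>.\<close>

definition controlled ::
  "('i \<Rightarrow> real \<Rightarrow> bool) \<Rightarrow> ('i \<Rightarrow> real \<Rightarrow> real) \<Rightarrow> ('i \<Rightarrow> real \<Rightarrow> real) \<Rightarrow> ('i \<Rightarrow> xi) \<Rightarrow> bool" where
  "controlled \<Omega> v u F \<longleftrightarrow>
     (\<exists>M. \<forall>j. \<exists>C. \<forall>i x y. \<Omega> i x \<longrightarrow> v i x ^ j * norm (F i x y) \<le> C * u i x ^ M)"

text \<open>Decay is faster than any power of \<open>v\<close>, at the price of a growth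
  \<open>u\<close>. Index-dependent weights let one calculus cover module elements (\<open>v\<close>
  = 1 + |x|), algebra elements (\<open>v\<close> = 1 + |p|, \<open>u\<close> = 1 + |x|) and the
  terms of infinite sums. The weights ignore y because periodicity makes all bounds uniform in
  y.\<close>

definition tame ::
  "('i \<Rightarrow> real \<Rightarrow> bool) \<Rightarrow> ('i \<Rightarrow> real \<Rightarrow> real) \<Rightarrow> ('i \<Rightarrow> real \<Rightarrow> real) \<Rightarrow> ('i \<Rightarrow> xi) \<Rightarrow> bool" where
  "tame \<Omega> v u F \<longleftrightarrow> (\<forall>i. smooth (F i)) \<and> (\<forall>w. controlled \<Omega> v u (\<lambda>i. dd w (F i)))"

definition weight :: "('i \<Rightarrow> real \<Rightarrow> real) \<Rightarrow> bool" where
  "weight u \<longleftrightarrow> (\<forall>i x. 1 \<le> u i x)"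

lemma weight_1: "weight (\<lambda>i x. 1)"
  by (simp add: weight_def)

lemma weight_abs: "weight (\<lambda>i x. 1 + \<bar>f i x\<bar>)"
  by (simp add: weight_def)

lemma weight_mult: "weight u \<Longrightarrow> weight v \<Longrightarrow> weight (\<lambda>i x. u i x * v i x)"
  unfolding weight_def using mult_mono [of 1 "u i x" 1 "v i x" for i x] by (smt (verit) mult_1)

lemma weightD:
  assumes "weight u"
  shows "1 \<le> u i x" "0 \<le> u i x" "0 < u i x"
proof -
  show "1 \<le> u i x" using assms by (simp add: weight_def)
  then show "0 \<le> u i x" "0 < u i x" by linarith+
qed

lemma controlled_add:
  assumes F: "controlled \<Omega> v u F" and G: "controlled \<Omega> v u G" and w: "weight u" "weight v"
  shows "controlled \<Omega> v u (\<lambda>i x y. F i x y + G i x y)"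
proof -
  note wt = w [THEN weightD(1)] w [THEN weightD(2)]
  obtain M where M: "\<And>j. \<exists>C. \<forall>i x y. \<Omega> i x \<longrightarrow> v i x ^ j * norm (F i x y) \<le> C * u i x ^ M"
    using F unfolding controlled_def by blast
  obtain N where N: "\<And>j. \<exists>C. \<forall>i x y. \<Omega> i x \<longrightarrow> v i x ^ j * norm (G i x y) \<le> C * u i x ^ N"
    using G unfolding controlled_def by blast
  show ?thesis
    unfolding controlled_def
  proof (intro exI [of _ "max M N"] allI)
    fix j
    obtain C where C: "\<And>i x y. \<Omega> i x \<Longrightarrow> v i x ^ j * norm (F i x y) \<le> C * u i x ^ M"
      using M by blast
    obtain D where D: "\<And>i x y. \<Omega> i x \<Longrightarrow> v i x ^ j * norm (G i x y) \<le> D * u i x ^ N"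
      using N by blast
    have "v i x ^ j * norm (F i x y + G i x y) \<le> (\<bar>C\<bar> + \<bar>D\<bar>) * u i x ^ max M N" if "\<Omega> i x" for i x y
    proof -
      have "v i x ^ j * norm (F i x y + G i x y) \<le> v i x ^ j * (norm (F i x y) + norm (G i x y))"
        by (intro mult_left_mono norm_triangle_ineq zero_le_power wt)
      also have "\<dots> \<le> C * u i x ^ M + D * u i x ^ N"
        using C [OF that, of y] D [OF that, of y] by (simp add: distrib_left)
      also have "\<dots> \<le> \<bar>C\<bar> * u i x ^ max M N + \<bar>D\<bar> * u i x ^ max M N"
        by (intro add_mono mult_mono power_increasing zero_le_power wt) auto
      finally show ?thesis by (simp add: distrib_right)
    qed
    then show "\<exists>C. \<forall>i x y. \<Omega> i x \<longrightarrow> v i x ^ j * norm (F i x y + G i x y) \<le> C * u i x ^ max M N"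
      by blast
  qed
qed

lemma controlled_mult:
  assumes F: "controlled \<Omega> v u F" and G: "controlled \<Omega> v' u' G"
    and w: "weight u" "weight v" "weight u'" "weight v'"
  shows "controlled \<Omega> (\<lambda>i x. v i x * v' i x) (\<lambda>i x. u i x * u' i x) (\<lambda>i x y. F i x y * G i x y)"
proof -
  note wt = w [THEN weightD(1)] w [THEN weightD(2)]
  obtain M where M: "\<And>j. \<exists>C. \<forall>i x y. \<Omega> i x \<longrightarrow> v i x ^ j * norm (F i x y) \<le> C * u i x ^ M"
    using F unfolding controlled_def by blast
  obtain N where N: "\<And>j. \<exists>C. \<forall>i x y. \<Omega> i x \<longrightarrow> v' i x ^ j * norm (G i x y) \<le> C * u' i x ^ N"
    using G unfolding controlled_def by blast
  show ?thesis
    unfolding controlled_def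
  proof (intro exI [of _ "max M N"] allI)
    fix j
    obtain C where C: "\<And>i x y. \<Omega> i x \<Longrightarrow> v i x ^ j * norm (F i x y) \<le> C * u i x ^ M"
      using M by blast
    obtain D where D: "\<And>i x y. \<Omega> i x \<Longrightarrow> v' i x ^ j * norm (G i x y) \<le> D * u' i x ^ N"
      using N by blast
    have "(v i x * v' i x) ^ j * norm (F i x y * G i x y) \<le> (\<bar>C\<bar> * \<bar>D\<bar>) * (u i x * u' i x) ^ max M N"
      if "\<Omega> i x" for i x y
    proof -
      have 1: "v i x ^ j * norm (F i x y) \<le> \<bar>C\<bar> * u i x ^ max M N"
        by (rule order_trans [OF C [OF that]])
          (intro mult_mono power_increasing zero_le_power wt; auto)
      have 2: "v' i x ^ j * norm (G i x y) \<le> \<bar>D\<bar> * u' i x ^ max M N"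
        by (rule order_trans [OF D [OF that]])
          (intro mult_mono power_increasing zero_le_power wt; auto)
      have "(v i x * v' i x) ^ j * norm (F i x y * G i x y)
          = (v i x ^ j * norm (F i x y)) * (v' i x ^ j * norm (G i x y))"
        by (simp add: norm_mult power_mult_distrib mult_ac)
      also have "\<dots> \<le> (\<bar>C\<bar> * u i x ^ max M N) * (\<bar>D\<bar> * u' i x ^ max M N)"
        by (intro mult_mono 1 2 mult_nonneg_nonneg zero_le_power wt) auto
      finally show ?thesis by (simp add: power_mult_distrib mult_ac)
    qed
    then show "\<exists>C. \<forall>i x y. \<Omega> i x \<longrightarrow>
        (v i x * v' i x) ^ j * norm (F i x y * G i x y) \<le> C * (u i x * u' i x) ^ max M N"
      by blast
  qed
qed

text \<open>Decay of order \<open>a * j + a * M\<close> in the old weight pays both for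
  \<open>v' ^ j\<close> and for the factor \<open>v ^ (a * M)\<close> hidden in
  \<open>u ^ M\<close>. That this order can be chosen in advance is due to M being independent of
  j.\<close>

lemma controlled_weights:
  assumes F: "controlled \<Omega> v u F" and w: "weight v" "weight u" "weight v'" "weight u'"
    and \<Omega>: "\<And>i x. \<Omega>' i x \<Longrightarrow> \<Omega> i x"
    and v: "\<And>i x. \<Omega>' i x \<Longrightarrow> v' i x \<le> B * v i x ^ a"
    and u: "\<And>i x. \<Omega>' i x \<Longrightarrow> u i x \<le> B * v i x ^ a * u' i x ^ b"
  shows "controlled \<Omega>' v' u' F"
proof -
  note wt = w [THEN weightD(1)] w [THEN weightD(2)] w [THEN weightD(3)]
  obtain M where M: "\<And>j. \<exists>C. \<forall>i x y. \<Omega> i x \<longrightarrow> v i x ^ j * norm (F i x y) \<le> C * u i x ^ M"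
    using F unfolding controlled_def by blast
  show ?thesis
    unfolding controlled_def
  proof (intro exI [of _ "b * M"] allI)
    fix j
    obtain C where C: "\<And>i x y. \<Omega> i x \<Longrightarrow> v i x ^ (a * j + a * M) * norm (F i x y) \<le> C * u i x ^ M"
      using M by blast
    have "v' i x ^ j * norm (F i x y) \<le> (\<bar>B\<bar> ^ j * \<bar>C\<bar> * \<bar>B\<bar> ^ M) * u' i x ^ (b * M)"
      if "\<Omega>' i x" for i x y
    proof -
      have "v i x ^ (a * M) * (v i x ^ (a * j) * norm (F i x y)) \<le> C * u i x ^ M"
        using C [OF \<Omega> [OF that]] by (simp add: power_add mult_ac)
      also have "\<dots> \<le> \<bar>C\<bar> * (\<bar>B\<bar> * v i x ^ a * u' i x ^ b) ^ M"
      proof (intro mult_mono power_mono zero_le_power wt)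
        show "u i x \<le> \<bar>B\<bar> * v i x ^ a * u' i x ^ b"
          by (rule order_trans [OF u [OF that]])
            (intro mult_right_mono zero_le_power wt; simp)
      qed auto
      also have "\<dots> = v i x ^ (a * M) * (\<bar>C\<bar> * \<bar>B\<bar> ^ M * u' i x ^ (b * M))"
        by (simp add: power_mult_distrib power_mult [symmetric] mult_ac)
      finally have 1: "v i x ^ (a * j) * norm (F i x y) \<le> \<bar>C\<bar> * \<bar>B\<bar> ^ M * u' i x ^ (b * M)"
        by (simp add: wt)
      have "v' i x ^ j \<le> (\<bar>B\<bar> * v i x ^ a) ^ j"
      proof (intro power_mono wt)
        show "v' i x \<le> \<bar>B\<bar> * v i x ^ a"
          by (rule order_trans [OF v [OF that]])
            (intro mult_right_mono zero_le_power wt; simp)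
      qed
      then have "v' i x ^ j * norm (F i x y) \<le> (\<bar>B\<bar> * v i x ^ a) ^ j * norm (F i x y)"
        by (rule mult_right_mono) simp
      also have "\<dots> = \<bar>B\<bar> ^ j * (v i x ^ (a * j) * norm (F i x y))"
        by (simp add: power_mult_distrib power_mult mult_ac)
      also have "\<dots> \<le> \<bar>B\<bar> ^ j * (\<bar>C\<bar> * \<bar>B\<bar> ^ M * u' i x ^ (b * M))"
        by (intro mult_left_mono 1) simp
      finally show ?thesis by (simp add: mult_ac)
    qed
    then show "\<exists>C. \<forall>i x y. \<Omega>' i x \<longrightarrow> v' i x ^ j * norm (F i x y) \<le> C * u' i x ^ (b * M)"
      by blast
  qed
qed

lemma tame_smooth: "tame \<Omega> v u F \<Longrightarrow> smooth (F i)"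
  by (simp add: tame_def)

lemma tame_pdx: "tame \<Omega> v u F \<Longrightarrow> tame \<Omega> v u (\<lambda>i. pdx (F i))"
proof -
  assume F: "tame \<Omega> v u F"
  then have "controlled \<Omega> v u (\<lambda>i. dd (True # w) (F i))" for w
    unfolding tame_def by blast
  with F show ?thesis by (simp add: tame_def smooth_pdx)
qed

lemma tame_pdy: "tame \<Omega> v u F \<Longrightarrow> tame \<Omega> v u (\<lambda>i. pdy (F i))"
proof -
  assume F: "tame \<Omega> v u F"
  then have "controlled \<Omega> v u (\<lambda>i. dd (False # w) (F i))" for w
    unfolding tame_def by blast
  with F show ?thesis by (simp add: tame_def smooth_pdy)
qed

lemma tame_controlled: "tame \<Omega> v u F \<Longrightarrow> controlled \<Omega> v u F"
  unfolding tame_def by (drule conjunct2, drule spec [of _ "[]"]) simp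

lemma tame_weights:
  assumes "tame \<Omega> v u F" "weight v" "weight u" "weight v'" "weight u'"
    and "\<And>i x. \<Omega>' i x \<Longrightarrow> \<Omega> i x"
    and "\<And>i x. \<Omega>' i x \<Longrightarrow> v' i x \<le> B * v i x ^ a"
    and "\<And>i x. \<Omega>' i x \<Longrightarrow> u i x \<le> B * v i x ^ a * u' i x ^ b"
  shows "tame \<Omega>' v' u' F"
  using assms controlled_weights [of \<Omega> v u _ v' u' \<Omega>' B a b] unfolding tame_def by blast

lemma tame_subdomain:
  assumes "tame \<Omega> v u F" "\<And>i x. \<Omega>' i x \<Longrightarrow> \<Omega> i x"
  shows "tame \<Omega>' v u F"
  using assms unfolding tame_def controlled_def by meson

lemma tame_add:
  assumes "tame \<Omega> v u F" "tame \<Omega> v u G" "weight u" "weight v"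
  shows "tame \<Omega> v u (\<lambda>i x y. F i x y + G i x y)"
  using assms controlled_add [of \<Omega> v u "\<lambda>i. dd w (F i)" "\<lambda>i. dd w (G i)" for w]
  by (simp add: tame_def smooth_add dd_add)

text \<open>Induction on the word: the Leibniz rule applied to its first letter gives two products
  of tame families, to each of which the induction hypothesis applies.\<close>

lemma tame_mult:
  assumes F: "tame \<Omega> v u F" and G: "tame \<Omega> v' u' G"
    and w: "weight u" "weight v" "weight u'" "weight v'"
  shows "tame \<Omega> (\<lambda>i x. v i x * v' i x) (\<lambda>i x. u i x * u' i x) (\<lambda>i x y. F i x y * G i x y)"
proof -
  have "controlled \<Omega> (\<lambda>i x. v i x * v' i x) (\<lambda>i x. u i x * u' i x)
      (\<lambda>i. dd l (\<lambda>x y. F i x y * G i x y))" for l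
    using F G
  proof (induction l arbitrary: F G)
    case Nil
    then show ?case
      using controlled_mult [OF tame_controlled tame_controlled] w by force
  next
    case (Cons b l)
    let ?p = "\<lambda>f. if b then pdx f else pdy f"
    have s: "smooth (F i)" "smooth (G i)" for i
      using Cons.prems by (auto intro: tame_smooth)
    have sp: "smooth (?p (F i))" "smooth (?p (G i))" for i
      by (simp_all add: s smooth_pdx smooth_pdy)
    have eq: "dd (b # l) (\<lambda>x y. F i x y * G i x y)
        = (\<lambda>x y. dd l (\<lambda>x y. ?p (F i) x y * G i x y) x y + dd l (\<lambda>x y. F i x y * ?p (G i) x y) x y)" for i
      using dd_add [OF smooth_mult [OF sp(1) s(2)] smooth_mult [OF s(1) sp(2)]]
      by (cases b) (simp_all add: diff2_mult smooth_diff2 s)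
    have "tame \<Omega> v u (\<lambda>i. ?p (F i))" "tame \<Omega> v' u' (\<lambda>i. ?p (G i))"
      using Cons.prems by (cases b; simp add: tame_pdx tame_pdy)+
    with Cons show ?case
      unfolding eq by (intro controlled_add weight_mult w) auto
  qed
  with F G show ?thesis
    unfolding tame_def by (simp add: smooth_mult)
qed

lemma tame_cnj: "tame \<Omega> v u F \<Longrightarrow> tame \<Omega> v u (\<lambda>i x y. cnj (F i x y))"
  by (simp add: tame_def dd_cnj smooth_cnj controlled_def)

lemma tame_reindex:
  "tame \<Omega> v u F \<Longrightarrow> tame (\<lambda>i. \<Omega> (r i)) (\<lambda>i. v (r i)) (\<lambda>i. u (r i)) (\<lambda>i. F (r i))"
  unfolding tame_def controlled_def by meson

lemma tame_shift:
  "tame \<Omega> v u F \<Longrightarrow> tame (\<lambda>i x. \<Omega> i (x + a i)) (\<lambda>i x. v i (x + a i)) (\<lambda>i x. u i (x + a i))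
     (\<lambda>i x y. F i (x + a i) (y + b i))"
  unfolding tame_def controlled_def by (simp add: smooth_shift dd_shift) meson

lemma tame_const:
  assumes "\<And>i x. \<Omega> i x \<Longrightarrow> norm (c i) \<le> B * u i x ^ M" "weight u"
  shows "tame \<Omega> (\<lambda>i x. 1) u (\<lambda>i x y. c i)"
proof -
  have "0 \<le> B * u i x ^ M" if "\<Omega> i x" for i x
    using assms(1) [OF that] norm_ge_zero order_trans by blast
  then show ?thesis
    using assms(1) unfolding tame_def controlled_def dd_const
    by (auto simp: smooth_const intro!: exI [of _ M] exI [of _ B])
qed

lemma tame_fst: "tame \<Omega> (\<lambda>i x. 1) (\<lambda>i x. 1 + \<bar>x\<bar>) (\<lambda>i x y. of_real x)"
proof -
  have "\<exists>c. (\<forall>x y. dd w (\<lambda>x y. of_real x) x y = c) \<and> norm c \<le> 1" if "w \<noteq> []" for w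
  proof -
    obtain b l where "w = b # l" using \<open>w \<noteq> []\<close> by (cases w) auto
    then show ?thesis by (auto simp: diff2_fst dd_const)
  qed
  then have "norm (dd w (\<lambda>x y. of_real x) x y) \<le> 1 + \<bar>x\<bar>" for w x y
  proof (cases "w = []")
    case False
    with \<open>\<And>w. w \<noteq> [] \<Longrightarrow> _\<close> have "norm (dd w (\<lambda>x y. of_real x) x y) \<le> 1" by metis
    then show ?thesis by (rule order_trans) simp
  qed simp
  then show ?thesis
    unfolding tame_def controlled_def
    by (auto simp: smooth_fst intro!: exI [of _ 1])
qed

text \<open>Every derivative in y brings down a factor proportional to \<open>a i\<close>, so the
  growth exponent is \<open>M * length w\<close>. This is allowed, since the exponent has to be
  uniform in the order of decay but not in the word.\<close>

lemma tame_ee: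
  assumes "\<And>i x. \<Omega> i x \<Longrightarrow> \<bar>a i\<bar> \<le> B * u i x ^ M" "weight u"
  shows "tame \<Omega> (\<lambda>i x. 1) u (\<lambda>i x y. ee (a i * y + b i))"
proof -
  have "norm (dd w (\<lambda>x y. ee (a i * y + b i)) x y) \<le> (2 * pi * B) ^ length w * u i x ^ (M * length w)"
    if "\<Omega> i x" for w i x y
  proof -
    have "norm (dd w (\<lambda>x y. ee (a i * y + b i)) x y) \<le> (2 * pi * \<bar>a i\<bar>) ^ length w"
      by (auto simp: dd_ee norm_mult norm_power)
    also have "\<dots> \<le> (2 * pi * (B * u i x ^ M)) ^ length w"
      by (intro power_mono mult_left_mono assms that) auto
    finally show ?thesis by (simp add: power_mult_distrib power_mult mult_ac)
  qed
  then show ?thesis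
    unfolding tame_def controlled_def by (simp add: smooth_ee) blast
qed

subsection \<open>Termwise differentiation of sums over the integers\<close>

lemma summable_on_int_inverse_square: "(\<lambda>p::int. 1 / (1 + \<bar>of_int p\<bar>)\<^sup>2 :: real) summable_on UNIV"
proof -
  let ?f = "\<lambda>p::int. 1 / (1 + \<bar>of_int p\<bar>)\<^sup>2 :: real"
  have "summable (\<lambda>n. inverse (real (Suc n) ^ 2))"
    using inverse_power_summable [of 2, where 'a = real] by (subst summable_Suc_iff) simp
  then have "(\<lambda>n. inverse (real (Suc n) ^ 2)) summable_on UNIV"
    by (subst summable_on_UNIV_nonneg_real_iff) auto
  then have 1: "(\<lambda>n. 1 / (1 + real n)\<^sup>2) summable_on UNIV"
    by (simp add: divide_inverse)
  have "?f summable_on range int"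
    using 1 by (subst summable_on_reindex) (auto simp: o_def)
  moreover have "?f summable_on range (\<lambda>n. - int n)"
    using 1 by (subst summable_on_reindex) (auto simp: o_def inj_on_def)
  ultimately have "?f summable_on (range int \<union> range (\<lambda>n. - int n))"
    by (rule summable_on_union)
  moreover have "range int \<union> range (\<lambda>n. - int n) = UNIV"
    using int_cases2 by (auto simp: image_def) metis
  ultimately show ?thesis by simp
qed

text \<open>Enumerating the integers by \<open>int_decode\<close> gives access to the theorems on
  series indexed by natural numbers.\<close>

lemma infsum_int_eq_suminf:
  fixes f :: "int \<Rightarrow> complex"
  assumes "f summable_on UNIV"
  shows "(\<lambda>n. f (int_decode n)) sums (\<Sum>\<^sub>\<infinity>p. f p)"
proof (rule has_sum_imp_sums)
  have "(f has_sum (\<Sum>\<^sub>\<infinity>p. f p)) UNIV"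
    using assms by simp
  then show "((\<lambda>n. f (int_decode n)) has_sum (\<Sum>\<^sub>\<infinity>p. f p)) UNIV"
    using has_sum_reindex_bij_betw [OF bij_int_decode, of f] by simp
qed

lemma summable_int_decode:
  fixes M :: "int \<Rightarrow> real"
  assumes "M summable_on UNIV"
  shows "summable (\<lambda>n. M (int_decode n))"
  using assms summable_on_reindex_bij_betw [OF bij_int_decode, of M] summable_on_imp_summable by blast

lemma summable_on_dominated:
  fixes f :: "'a \<Rightarrow> complex" and M :: "'a \<Rightarrow> real"
  assumes "M summable_on A" "\<And>x. x \<in> A \<Longrightarrow> norm (f x) \<le> M x"
  shows "f summable_on A"
  by (rule abs_summable_summable, rule summable_on_comparison_test [OF assms(1)]) (use assms in auto)

text \<open>On the unit interval around x the M-test makes the differentiated series converge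
  uniformly, and \<open>has_derivative_series\<close> applies there. Since differentiability is
  local, a majorant valid near x is enough.\<close>

lemma has_vector_derivative_infsum:
  fixes f :: "int \<Rightarrow> real \<Rightarrow> complex"
  assumes df: "\<And>p t. (f p has_vector_derivative f' p t) (at t)"
    and le: "\<And>p t. \<bar>t - x\<bar> < 1 \<Longrightarrow> norm (f p t) \<le> M p"
    and le': "\<And>p t. \<bar>t - x\<bar> < 1 \<Longrightarrow> norm (f' p t) \<le> M p"
    and M: "M summable_on UNIV"
  shows "((\<lambda>t. \<Sum>\<^sub>\<infinity>p. f p t) has_vector_derivative (\<Sum>\<^sub>\<infinity>p. f' p x)) (at x)"
proof -
  let ?d = int_decode
  define S where "S = {x - 1<..<x + 1}"
  have S: "\<bar>t - x\<bar> < 1 \<longleftrightarrow> t \<in> S" for t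
    by (auto simp: S_def)
  have s1: "(\<lambda>p. f p t) summable_on UNIV" and s2: "(\<lambda>p. f' p t) summable_on UNIV" if "t \<in> S" for t
    using that le le' S by (auto intro!: summable_on_dominated [OF M])
  note u1 = infsum_int_eq_suminf [OF s1] and u2 = infsum_int_eq_suminf [OF s2]
  have "uniform_limit S (\<lambda>n t. \<Sum>i<n. f' (?d i) t) (\<lambda>t. \<Sum>i. f' (?d i) t) sequentially"
    by (rule Weierstrass_m_test [OF _ summable_int_decode [OF M]]) (use le' S in auto)
  then have u: "uniform_limit S (\<lambda>n t. \<Sum>i<n. f' (?d i) t) (\<lambda>t. \<Sum>\<^sub>\<infinity>p. f' p t) sequentially"
    by (rule uniform_limit_cong' [THEN iffD1, rotated 2]) (auto dest: u2 simp: sums_iff)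
  have "\<exists>g. \<forall>t\<in>S. (\<lambda>n. f (?d n) t) sums g t \<and>
      (g has_derivative (\<lambda>h. h *\<^sub>R (\<Sum>\<^sub>\<infinity>p. f' p t))) (at t within S)"
  proof (rule has_derivative_series)
    show "convex S" by (simp add: S_def)
    show "(f (?d n) has_derivative (\<lambda>h. h *\<^sub>R f' (?d n) t)) (at t within S)" for n t
      using df [of "?d n" t] by (simp add: has_vector_derivative_def has_derivative_at_withinI)
    show "x \<in> S" by (simp add: S_def)
    then show "(\<lambda>n. f (?d n) x) sums (\<Sum>\<^sub>\<infinity>p. f p x)" by (rule u1)
    show "\<forall>\<^sub>F n in sequentially. \<forall>t\<in>S. \<forall>h. norm ((\<Sum>i<n. h *\<^sub>R f' (?d i) t)
        - h *\<^sub>R (\<Sum>\<^sub>\<infinity>p. f' p t)) \<le> e * norm h" if "e > 0" for e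
    proof -
      have "\<forall>\<^sub>F n in sequentially. \<forall>t\<in>S. dist (\<Sum>i<n. f' (?d i) t) (\<Sum>\<^sub>\<infinity>p. f' p t) < e"
        using u that by (simp add: uniform_limit_iff)
      then show ?thesis
      proof (rule eventually_mono, intro ballI allI)
        fix n t h
        assume "\<forall>t\<in>S. dist (\<Sum>i<n. f' (?d i) t) (\<Sum>\<^sub>\<infinity>p. f' p t) < e" and "t \<in> S"
        then have "norm ((\<Sum>i<n. f' (?d i) t) - (\<Sum>\<^sub>\<infinity>p. f' p t)) \<le> e"
          by (auto simp: dist_norm intro: less_imp_le)
        then have "\<bar>h\<bar> * norm ((\<Sum>i<n. f' (?d i) t) - (\<Sum>\<^sub>\<infinity>p. f' p t)) \<le> \<bar>h\<bar> * e"
          by (intro mult_left_mono) auto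
        then show "norm ((\<Sum>i<n. h *\<^sub>R f' (?d i) t) - h *\<^sub>R (\<Sum>\<^sub>\<infinity>p. f' p t)) \<le> e * norm h"
          by (simp add: scaleR_sum_right [symmetric] scaleR_diff_right [symmetric] mult.commute)
      qed
    qed
  qed
  then obtain g where g: "\<And>t. t \<in> S \<Longrightarrow> (\<lambda>n. f (?d n) t) sums g t"
    "\<And>t. t \<in> S \<Longrightarrow> (g has_derivative (\<lambda>h. h *\<^sub>R (\<Sum>\<^sub>\<infinity>p. f' p t))) (at t within S)"
    by blast
  have x: "x \<in> S" and op: "open S" by (auto simp: S_def)
  have "(g has_vector_derivative (\<Sum>\<^sub>\<infinity>p. f' p x)) (at x)"
    using g(2) [OF x] unfolding has_vector_derivative_def at_within_open [OF x op] .
  moreover have "g t = (\<Sum>\<^sub>\<infinity>p. f p t)" if "t \<in> S" for t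
    by (rule sums_unique2 [OF g(1) [OF that] u1 [OF that]])
  ultimately show ?thesis
    by (rule has_vector_derivative_transform_within_open [OF _ op x])
qed

text \<open>Serves two purposes: it is the condition for summing over p and differentiating term by
  term, and it is also the analytic half of membership in \<open>D_inf\<close>, see
  \<open>D_inf_iff\<close>.\<close>

definition decaying :: "(int \<Rightarrow> xi) \<Rightarrow> bool" where
  "decaying F \<longleftrightarrow> (\<forall>R. tame (\<lambda>p x. \<bar>x\<bar> \<le> R) (\<lambda>p x. 1 + \<bar>of_int p\<bar>) (\<lambda>p x. 1) F)"

lemma decaying_smooth: "decaying F \<Longrightarrow> smooth (F p)"
  unfolding decaying_def by (drule spec) (rule tame_smooth)

lemma decaying_pdx: "decaying F \<Longrightarrow> decaying (\<lambda>p. pdx (F p))"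
  and decaying_pdy: "decaying F \<Longrightarrow> decaying (\<lambda>p. pdy (F p))"
  unfolding decaying_def by (blast intro: tame_pdx tame_pdy)+

lemma decaying_bound:
  assumes "decaying F"
  obtains C where "\<And>p x y. \<bar>x\<bar> \<le> R \<Longrightarrow> norm (F p x y) \<le> C * (1 / (1 + \<bar>of_int p\<bar>)\<^sup>2)"
proof -
  have "controlled (\<lambda>p x. \<bar>x\<bar> \<le> R) (\<lambda>p x. 1 + \<bar>of_int p\<bar>) (\<lambda>p x. 1) F"
    using assms tame_controlled unfolding decaying_def by blast
  then obtain C where C: "\<And>p x y. \<bar>x\<bar> \<le> R \<Longrightarrow> (1 + \<bar>of_int p\<bar>) ^ 2 * norm (F p x y) \<le> C"
    unfolding controlled_def by fastforce
  have "norm (F p x y) \<le> C * (1 / (1 + \<bar>of_int p\<bar>)\<^sup>2)" if "\<bar>x\<bar> \<le> R" for p x y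
  proof -
    have "(1 + \<bar>real_of_int p\<bar>)\<^sup>2 > 0" by (simp add: add_pos_nonneg)
    then show ?thesis using C [OF that, of p y] by (simp add: field_simps)
  qed
  then show ?thesis using that by blast
qed

lemma decaying_summable:
  assumes "decaying F"
  shows "(\<lambda>p. F p x y) summable_on UNIV"
proof -
  obtain C where C: "\<And>p x' y. \<bar>x'\<bar> \<le> \<bar>x\<bar> \<Longrightarrow> norm (F p x' y) \<le> C * (1 / (1 + \<bar>of_int p\<bar>)\<^sup>2)"
    using decaying_bound [OF assms] by blast
  have "(\<lambda>p::int. C * (1 / (1 + \<bar>of_int p\<bar>)\<^sup>2)) summable_on UNIV"
    by (intro summable_on_cmult_right summable_on_int_inverse_square)
  then show ?thesis
    by (rule summable_on_dominated) (use C in simp)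
qed

text \<open>Convergence is uniform on each open strip |x| < R, and the strips cover the
  plane.\<close>

lemma continuous_on_infsum:
  assumes "decaying F"
  shows "continuous_on UNIV (\<lambda>(x, y). \<Sum>\<^sub>\<infinity>p. F p x y)"
proof -
  have "continuous_on ({-R<..<R} \<times> UNIV) (\<lambda>(x, y). \<Sum>\<^sub>\<infinity>p. F p x y)" for R
  proof -
    obtain C where C: "\<And>p x y. \<bar>x\<bar> \<le> R \<Longrightarrow> norm (F p x y) \<le> C * (1 / (1 + \<bar>of_int p\<bar>)\<^sup>2)"
      using decaying_bound [OF assms] by blast
    have "(\<lambda>p::int. C * (1 / (1 + \<bar>of_int p\<bar>)\<^sup>2)) summable_on UNIV"
      by (intro summable_on_cmult_right summable_on_int_inverse_square)
    then have "uniform_limit ({-R<..<R} \<times> UNIV) (\<lambda>X z. \<Sum>p\<in>X. (\<lambda>(x, y). F p x y) z)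
        (\<lambda>z. \<Sum>\<^sub>\<infinity>p. (\<lambda>(x, y). F p x y) z) (finite_subsets_at_top UNIV)"
      by (rule Weierstrass_m_test_general [rotated]) (use C in auto)
    moreover have "\<forall>\<^sub>F X in finite_subsets_at_top UNIV.
        continuous_on ({-R<..<R} \<times> UNIV) (\<lambda>z. \<Sum>p\<in>X. (\<lambda>(x, y). F p x y) z)"
      by (intro always_eventually allI continuous_on_sum smooth_continuous decaying_smooth assms)
    ultimately have "continuous_on ({-R<..<R} \<times> UNIV) (\<lambda>z. \<Sum>\<^sub>\<infinity>p. (\<lambda>(x, y). F p x y) z)"
      by (intro uniform_limit_theorem [where F = "finite_subsets_at_top UNIV"]) simp_all
    then show ?thesis by (simp add: case_prod_unfold)
  qed
  then have "continuous_on (\<Union>R. {-R<..<R} \<times> UNIV) (\<lambda>(x, y). \<Sum>\<^sub>\<infinity>p. F p x y)"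
    by (intro continuous_on_open_UN open_Times) auto
  moreover have "(\<Union>R. {-R<..<R} \<times> UNIV) = (UNIV :: (real \<times> real) set)"
  proof (intro set_eqI iffI)
    fix z :: "real \<times> real"
    have "z \<in> {-(\<bar>fst z\<bar> + 1)<..<\<bar>fst z\<bar> + 1} \<times> UNIV"
      by (auto simp: mem_Times_iff)
    then show "z \<in> (\<Union>R. {-R<..<R} \<times> UNIV)" by blast
  qed simp
  ultimately show ?thesis by simp
qed

lemma diff2_infsum:
  assumes F: "decaying F"
  shows "diff2 (\<lambda>x y. \<Sum>\<^sub>\<infinity>p. F p x y)"
    and "pdx (\<lambda>x y. \<Sum>\<^sub>\<infinity>p. F p x y) = (\<lambda>x y. \<Sum>\<^sub>\<infinity>p. pdx (F p) x y)"
    and "pdy (\<lambda>x y. \<Sum>\<^sub>\<infinity>p. F p x y) = (\<lambda>x y. \<Sum>\<^sub>\<infinity>p. pdy (F p) x y)"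
proof -
  have s: "(\<lambda>p::int. C * (1 / (1 + \<bar>of_int p\<bar>)\<^sup>2)) summable_on UNIV" for C :: real
    by (intro summable_on_cmult_right summable_on_int_inverse_square)
  have d: "diff2 (F p)" for p
    by (intro smooth_diff2 decaying_smooth F)
  have le: "C * r \<le> max C D * r" "D * r \<le> max C D * r" if "0 \<le> r" for C D r :: real
    using that by (auto intro: mult_right_mono)
  have dx: "((\<lambda>t. \<Sum>\<^sub>\<infinity>p. F p t y) has_vector_derivative (\<Sum>\<^sub>\<infinity>p. pdx (F p) x y)) (at x)" for x y
  proof -
    obtain C where C: "\<And>p t y. \<bar>t\<bar> \<le> \<bar>x\<bar> + 1 \<Longrightarrow> norm (F p t y) \<le> C * (1 / (1 + \<bar>of_int p\<bar>)\<^sup>2)"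
      using decaying_bound [OF F] by blast
    obtain D where D: "\<And>p t y. \<bar>t\<bar> \<le> \<bar>x\<bar> + 1 \<Longrightarrow> norm (pdx (F p) t y) \<le> D * (1 / (1 + \<bar>of_int p\<bar>)\<^sup>2)"
      using decaying_bound [OF decaying_pdx [OF F]] by blast
    show ?thesis
    proof (rule has_vector_derivative_infsum [OF has_pdx [OF d] _ _ s [of "max C D"]])
      fix p t
      assume "\<bar>t - x\<bar> < 1"
      then have t: "\<bar>t\<bar> \<le> \<bar>x\<bar> + 1" by arith
      show "norm (F p t y) \<le> max C D * (1 / (1 + \<bar>of_int p\<bar>)\<^sup>2)"
        by (rule order_trans [OF C le(1)]) (use t in auto)
      show "norm (pdx (F p) t y) \<le> max C D * (1 / (1 + \<bar>of_int p\<bar>)\<^sup>2)"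
        by (rule order_trans [OF D le(2)]) (use t in auto)
    qed
  qed
  have dy: "((\<lambda>t. \<Sum>\<^sub>\<infinity>p. F p x t) has_vector_derivative (\<Sum>\<^sub>\<infinity>p. pdy (F p) x y)) (at y)" for x y
  proof -
    obtain C where C: "\<And>p t y. \<bar>t\<bar> \<le> \<bar>x\<bar> \<Longrightarrow> norm (F p t y) \<le> C * (1 / (1 + \<bar>of_int p\<bar>)\<^sup>2)"
      using decaying_bound [OF F] by blast
    obtain D where D: "\<And>p t y. \<bar>t\<bar> \<le> \<bar>x\<bar> \<Longrightarrow> norm (pdy (F p) t y) \<le> D * (1 / (1 + \<bar>of_int p\<bar>)\<^sup>2)"
      using decaying_bound [OF decaying_pdy [OF F]] by blast
    show ?thesis
    proof (rule has_vector_derivative_infsum [OF has_pdy [OF d] _ _ s [of "max C D"]])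
      fix p t
      assume "\<bar>t - y\<bar> < 1"
      then have t: "\<bar>x\<bar> \<le> \<bar>x\<bar>" by arith
      show "norm (F p x t) \<le> max C D * (1 / (1 + \<bar>of_int p\<bar>)\<^sup>2)"
        by (rule order_trans [OF C le(1)]) (use t in auto)
      show "norm (pdy (F p) x t) \<le> max C D * (1 / (1 + \<bar>of_int p\<bar>)\<^sup>2)"
        by (rule order_trans [OF D le(2)]) (use t in auto)
    qed
  qed
  show "diff2 (\<lambda>x y. \<Sum>\<^sub>\<infinity>p. F p x y)"
    and "pdx (\<lambda>x y. \<Sum>\<^sub>\<infinity>p. F p x y) = (\<lambda>x y. \<Sum>\<^sub>\<infinity>p. pdx (F p) x y)"
    and "pdy (\<lambda>x y. \<Sum>\<^sub>\<infinity>p. F p x y) = (\<lambda>x y. \<Sum>\<^sub>\<infinity>p. pdy (F p) x y)"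
    by (rule diff2I [OF continuous_on_infsum [OF F] dx dy])+
qed

lemma smooth_infsum: "decaying F \<Longrightarrow> smooth (\<lambda>x y. \<Sum>\<^sub>\<infinity>p. F p x y)"
proof -
  assume F: "decaying F"
  have "C_k k (\<lambda>x y. \<Sum>\<^sub>\<infinity>p. F p x y)" for k
    using F
  proof (induction k arbitrary: F)
    case 0
    then show ?case by (simp add: continuous_on_infsum)
  next
    case (Suc k)
    then show ?case by (simp add: C_k_Suc diff2_infsum decaying_pdx decaying_pdy)
  qed
  then show ?thesis by (simp add: smooth_def)
qed

lemma dd_infsum: "decaying F \<Longrightarrow> dd w (\<lambda>x y. \<Sum>\<^sub>\<infinity>p. F p x y) = (\<lambda>x y. \<Sum>\<^sub>\<infinity>p. dd w (F p) x y)"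
  by (induction w arbitrary: F) (simp_all add: diff2_infsum decaying_pdx decaying_pdy)

subsection \<open>The module and the algebra in terms of tame families\<close>

text \<open>The index type \<open>unit\<close> turns a single function into a family, so that the
  rules for \<open>tame\<close> apply.\<close>

definition schwartz :: "xi \<Rightarrow> bool" where
  "schwartz f \<longleftrightarrow> tame (\<lambda>i x. True) (\<lambda>i x. 1 + \<bar>x\<bar>) (\<lambda>i x. 1) (\<lambda>i::unit. f)"

lemma one_plus_power_le: "(1 + \<bar>t\<bar>) ^ j \<le> 2 ^ j * (1 + \<bar>t\<bar> ^ j)" for t :: real
proof (cases "\<bar>t\<bar> \<le> 1")
  case True
  then have "(1 + \<bar>t\<bar>) ^ j \<le> 2 ^ j" by (intro power_mono) auto
  also have "\<dots> \<le> 2 ^ j * (1 + \<bar>t\<bar> ^ j)" by simp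
  finally show ?thesis .
next
  case False
  then have "(1 + \<bar>t\<bar>) ^ j \<le> (2 * \<bar>t\<bar>) ^ j" by (intro power_mono) auto
  also have "\<dots> \<le> 2 ^ j * (1 + \<bar>t\<bar> ^ j)" by (simp add: power_mult_distrib)
  finally show ?thesis .
qed

text \<open>The definitions of the module and the algebra use powers of |t|, which may vanish; the
  calculus needs 1 + |t|, which is at least 1. Bounds of order 0 and j together give the weighted
  bound of order j.\<close>

lemma weighted_bound:
  fixes z :: "'a::real_normed_vector"
  assumes "norm z \<le> C" "\<bar>t\<bar> ^ j * norm z \<le> D"
  shows "(1 + \<bar>t\<bar>) ^ j * norm z \<le> 2 ^ j * (C + D)"
proof -
  have "(1 + \<bar>t\<bar>) ^ j * norm z \<le> 2 ^ j * (1 + \<bar>t\<bar> ^ j) * norm z"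
    by (intro mult_right_mono one_plus_power_le) simp
  also have "\<dots> = 2 ^ j * (norm z + \<bar>t\<bar> ^ j * norm z)"
    by (simp add: algebra_simps)
  also have "\<dots> \<le> 2 ^ j * (C + D)"
    using assms by (intro mult_left_mono add_mono) auto
  finally show ?thesis .
qed

lemma power_bound:
  fixes z :: "'a::real_normed_vector"
  assumes "(1 + \<bar>t\<bar>) ^ j * norm z \<le> C"
  shows "\<bar>t\<bar> ^ j * norm z \<le> C"
  by (rule order_trans [OF _ assms]) (intro mult_right_mono power_mono; simp)

lemma schwartz_bound:
  assumes "schwartz f"
  obtains C where "\<And>x y. (1 + \<bar>x\<bar>) ^ j * norm (dd w f x y) \<le> C"
  using assms unfolding schwartz_def tame_def controlled_def by fastforce

lemma schwartzI:
  assumes "smooth f" "\<And>w j. \<exists>C. \<forall>x y. (1 + \<bar>x\<bar>) ^ j * norm (dd w f x y) \<le> C"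
  shows "schwartz f"
  using assms unfolding schwartz_def tame_def controlled_def by auto

lemma schwartz_smooth: "schwartz f \<Longrightarrow> smooth f"
  unfolding schwartz_def by (rule tame_smooth)

text \<open>From left to right a word is sorted by \<open>dd_sorted\<close>; from right to left the
  derivatives in the definition are themselves words, by \<open>dd_replicate\<close>.\<close>

lemma Xi_inf_iff: "f \<in> Xi_inf \<longleftrightarrow> schwartz f \<and> (\<forall>x y. f x (y + 1) = f x y)"
proof
  assume f: "f \<in> Xi_inf"
  then have sm: "smooth f" by (simp add: Xi_inf_def)
  have b: "\<exists>C. \<forall>x y. \<bar>x\<bar> ^ k * norm ((pdx ^^ m) ((pdy ^^ n) f) x y) \<le> C" for k m n
    using f by (auto simp: Xi_inf_def norm_mult norm_power)
  have "schwartz f"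
  proof (rule schwartzI [OF sm])
    fix w j
    obtain m n where w: "dd w f = (pdx ^^ m) ((pdy ^^ n) f)"
      using dd_sorted [of w] sm by blast
    obtain C where C: "\<And>x y. norm (dd w f x y) \<le> C"
      using b [of 0 m n] w by auto
    obtain D where D: "\<And>x y. \<bar>x\<bar> ^ j * norm (dd w f x y) \<le> D"
      using b [of j m n] w by auto
    show "\<exists>C. \<forall>x y. (1 + \<bar>x\<bar>) ^ j * norm (dd w f x y) \<le> C"
      using weighted_bound [OF C D] by blast
  qed
  with f show "schwartz f \<and> (\<forall>x y. f x (y + 1) = f x y)"
    by (simp add: Xi_inf_def)
next
  assume f: "schwartz f \<and> (\<forall>x y. f x (y + 1) = f x y)"
  have "\<exists>C. \<forall>x y. norm (of_real x ^ k * (pdx ^^ m) ((pdy ^^ n) f) x y) \<le> C" for k m n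
  proof -
    obtain C where "\<And>x y. (1 + \<bar>x\<bar>) ^ k * norm (dd (replicate n False @ replicate m True) f x y) \<le> C"
      using schwartz_bound f by blast
    from power_bound [OF this] show ?thesis
      unfolding dd_replicate norm_mult norm_power norm_of_real by blast
  qed
  with f show "f \<in> Xi_inf"
    by (simp add: Xi_inf_def schwartz_smooth)
qed

lemma periodic_int:
  fixes g :: "real \<Rightarrow> 'a"
  assumes "\<And>y. g (y + 1) = g y"
  shows "g (y + of_int n) = g y"
proof -
  have *: "g (y + of_nat m) = g y" for m y
  proof (induction m)
    case (Suc m)
    then show ?case using assms [of "y + of_nat m"] by (simp add: add_ac)
  qed simp
  show ?thesis
  proof (cases n)
    case (nonneg m)
    then show ?thesis using * by simp
  next
    case (neg m)
    then show ?thesis using * [of "y + of_int n" "Suc m"] by simp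
  qed
qed

lemma dd_periodic:
  assumes "smooth f" "\<And>x y. f x (y + 1) = f x y"
  shows "dd w f x (y + 1) = dd w f x y"
  using dd_shift [OF assms(1), of w 0 1] assms(2) by (simp add: fun_eq_iff)

definition quasi_periodic :: "nat \<Rightarrow> real \<Rightarrow> dfun \<Rightarrow> bool" where
  "quasi_periodic c \<nu> a \<longleftrightarrow> (\<forall>x y p. a x (y + 1) p = a x y p) \<and>
     (\<forall>x y p k. a (x + of_int k) y p
        = ee (of_nat c * of_int k * of_int p * (y - of_int p * \<nu>)) * a x y p)"

lemma decayingI:
  assumes "\<And>p. smooth (F p)"
    and "\<And>w R j. \<exists>C. \<forall>p x y. \<bar>x\<bar> \<le> R \<longrightarrow> (1 + \<bar>of_int p\<bar>) ^ j * norm (dd w (F p) x y) \<le> C"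
  shows "decaying F"
  using assms unfolding decaying_def tame_def controlled_def by auto

lemma decaying_weighted_bound:
  assumes "decaying F"
  obtains C where "\<And>p x y. \<bar>x\<bar> \<le> R \<Longrightarrow> (1 + \<bar>of_int p\<bar>) ^ j * norm (dd w (F p) x y) \<le> C"
  using assms unfolding decaying_def tame_def controlled_def by fastforce

text \<open>The bounds on compact sets are used for [-R, R] \<times> [0, 1] only; replacing y by its
  fractional part, which periodicity permits for every derivative, extends them to all y.\<close>

lemma D_inf_iff: "a \<in> D_inf c \<nu> \<longleftrightarrow> decaying (\<lambda>p x y. a x y p) \<and> quasi_periodic c \<nu> a"
proof
  assume a: "a \<in> D_inf c \<nu>"
  then have q: "quasi_periodic c \<nu> a" and sm: "smooth (\<lambda>x y. a x y p)" for p
    by (auto simp: D_inf_def quasi_periodic_def)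
  let ?a = "\<lambda>p x y. a x y p"
  have b: "\<exists>C. \<forall>p x y. \<bar>x\<bar> \<le> R \<longrightarrow> \<bar>of_int p\<bar> ^ k * norm ((pdx ^^ m) ((pdy ^^ n) (?a p)) x (frac y)) \<le> C"
    for R k m n
  proof -
    have "compact ({-R..R} \<times> {0..1::real})" by (intro compact_Times) auto
    moreover have "\<forall>k m n K. compact K \<longrightarrow> (\<exists>C. \<forall>(x, y)\<in>K. \<forall>p.
        norm (of_int p ^ k * (pdx ^^ m) ((pdy ^^ n) (?a p)) x y) \<le> C)"
      using a by (simp add: D_inf_def)
    ultimately obtain C where C: "\<forall>(x, y) \<in> {-R..R} \<times> {0..1}. \<forall>p.
        norm (of_int p ^ k * (pdx ^^ m) ((pdy ^^ n) (?a p)) x y) \<le> C"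
      by meson
    have "\<bar>of_int p\<bar> ^ k * norm ((pdx ^^ m) ((pdy ^^ n) (?a p)) x (frac y)) \<le> C" if "\<bar>x\<bar> \<le> R" for p x y
      using C [THEN bspec, of "(x, frac y)"] that frac_lt_1 [of y]
      by (auto simp: norm_mult norm_power frac_ge_0 less_imp_le abs_le_iff minus_le_iff)
    then show ?thesis by blast
  qed
  have "decaying ?a"
  proof (rule decayingI [OF sm])
    fix w R j
    have per: "dd w (?a p) x y = dd w (?a p) x (frac y)" for p x y
      using periodic_int [of "dd w (?a p) x" "frac y" "\<lfloor>y\<rfloor>"] dd_periodic [OF sm] q
      by (simp add: quasi_periodic_def frac_def)
    obtain m n where w: "\<And>p. dd w (?a p) = (pdx ^^ m) ((pdy ^^ n) (?a p))"
      using dd_sorted [of w] sm by blast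
    obtain C where C: "\<And>p x y. \<bar>x\<bar> \<le> R \<Longrightarrow> norm (dd w (?a p) x (frac y)) \<le> C"
      using b [of R 0 m n] unfolding w by auto
    obtain D where D: "\<And>p x y. \<bar>x\<bar> \<le> R \<Longrightarrow> \<bar>of_int p\<bar> ^ j * norm (dd w (?a p) x (frac y)) \<le> D"
      using b [of R j m n] unfolding w by auto
    have "(1 + \<bar>of_int p\<bar>) ^ j * norm (dd w (?a p) x y) \<le> 2 ^ j * (C + D)" if "\<bar>x\<bar> \<le> R" for p x y
      by (subst per) (rule weighted_bound [OF C [OF that] D [OF that]])
    then show "\<exists>C. \<forall>p x y. \<bar>x\<bar> \<le> R \<longrightarrow> (1 + \<bar>of_int p\<bar>) ^ j * norm (dd w (?a p) x y) \<le> C"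
      by blast
  qed
  with q show "decaying ?a \<and> quasi_periodic c \<nu> a" by simp
next
  let ?a = "\<lambda>p x y. a x y p"
  assume a: "decaying ?a \<and> quasi_periodic c \<nu> a"
  have "\<exists>C. \<forall>(x, y)\<in>K. \<forall>p. norm (of_int p ^ k * (pdx ^^ m) ((pdy ^^ n) (?a p)) x y) \<le> C"
    if K: "compact K" for k m n K
  proof -
    obtain R where R: "\<And>z. z \<in> K \<Longrightarrow> norm z \<le> R"
      using compact_imp_bounded [OF K] unfolding bounded_iff by blast
    have R': "\<bar>x\<bar> \<le> R" if "(x, y) \<in> K" for x y
      using R [OF that] norm_fst_le [of x y] by simp
    obtain C where "\<And>p x y. \<bar>x\<bar> \<le> R \<Longrightarrow>
        (1 + \<bar>of_int p\<bar>) ^ k * norm (dd (replicate n False @ replicate m True) (?a p) x y) \<le> C"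
      using decaying_weighted_bound a by blast
    from power_bound [OF this] show ?thesis
      using R' unfolding dd_replicate norm_mult norm_power norm_of_int by blast
  qed
  moreover have "smooth (?a p)" for p
    using a decaying_smooth [of ?a p] by simp
  ultimately show "a \<in> D_inf c \<nu>"
    using a by (auto simp: D_inf_def quasi_periodic_def)
qed

text \<open>Quasi-periodicity turns the bounds on \<open>[0, 1]\<close> into polynomial growth in \<open>x\<close>.\<close>

lemma D_inf_tame:
  assumes a: "a \<in> D_inf c \<nu>"
  shows "tame (\<lambda>p x. True) (\<lambda>p x. 1 + \<bar>of_int p\<bar>) (\<lambda>p x. 1 + \<bar>x\<bar>) (\<lambda>p x y. a x y p)"
proof -
  let ?a = "\<lambda>p x y. a x y p"
  define E :: "int \<times> int \<Rightarrow> xi" where "E = (\<lambda>(k, p) x y.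
    ee (of_nat c * of_int k * of_int p * y + (- of_nat c * of_int k * of_int p * of_int p * \<nu>)))"
  define G where "G = (\<lambda>i x y. E i x y * a x y (snd i))"
  have D: "decaying ?a" and q: "quasi_periodic c \<nu> a"
    using a by (simp_all add: D_inf_iff)
  have G: "a (x + of_int k) y p = G (k, p) x y" for x k y p
    using q by (simp add: quasi_periodic_def G_def E_def algebra_simps)
  have sm: "smooth (?a p)" for p
    using D by (rule decaying_smooth)
  have "tame (\<lambda>i x. \<bar>x\<bar> \<le> 1) (\<lambda>i x. 1)
      (\<lambda>i x. (1 + \<bar>of_int (fst i)\<bar>) * (1 + \<bar>of_int (snd i)\<bar>)) E"
    unfolding E_def case_prod_unfold
  proof (rule tame_ee [where B = "real c" and M = 1])
    fix i :: "int \<times> int" and x :: real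
    show "\<bar>of_nat c * of_int (fst i) * of_int (snd i)\<bar>
        \<le> real c * ((1 + \<bar>of_int (fst i)\<bar>) * (1 + \<bar>of_int (snd i)\<bar>)) ^ 1"
      by (auto simp: abs_mult mult.assoc intro!: mult_mono)
  qed (intro weight_mult weight_abs)
  moreover have "tame (\<lambda>i x. \<bar>x\<bar> \<le> 1) (\<lambda>i x. 1 + \<bar>of_int (snd i)\<bar>) (\<lambda>i x. 1) (\<lambda>i::int \<times> int. ?a (snd i))"
    using tame_reindex [of _ _ _ ?a snd] D unfolding decaying_def by fast
  ultimately have "tame (\<lambda>i x. \<bar>x\<bar> \<le> 1) (\<lambda>i x. 1 * (1 + \<bar>of_int (snd i)\<bar>))
      (\<lambda>i x. (1 + \<bar>of_int (fst i)\<bar>) * (1 + \<bar>of_int (snd i)\<bar>) * 1) G"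
    unfolding G_def by (intro tame_mult weight_mult weight_abs weight_1)
  \<comment> \<open>Growth in p coming from the phase is absorbed by the decay in p. Growth in k
    stays, and turns into growth in x when k is the integer part of x.\<close>
  then have tG: "tame (\<lambda>i x. \<bar>x\<bar> \<le> 1) (\<lambda>i x. 1 + \<bar>of_int (snd i)\<bar>) (\<lambda>i x. 1 + \<bar>of_int (fst i)\<bar>) G"
    by (rule tame_weights [where B = 1 and a = 1 and b = 1])
      ((intro weight_mult weight_abs weight_1)+, simp_all add: algebra_simps)
  have "controlled (\<lambda>p x. True) (\<lambda>p x. 1 + \<bar>of_int p\<bar>) (\<lambda>p x. 1 + \<bar>x\<bar>) (\<lambda>p. dd w (?a p))" for w
  proof -
    have eq: "dd w (?a p) x y = dd w (G (\<lfloor>x\<rfloor>, p)) (frac x) y" for p x y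
    proof -
      have "dd w (?a p) (frac x + of_int \<lfloor>x\<rfloor>) (y + 0)
          = dd w (\<lambda>x' y. ?a p (x' + of_int \<lfloor>x\<rfloor>) (y + 0)) (frac x) y"
        using dd_shift [OF sm, of w "of_int \<lfloor>x\<rfloor>" 0 p] by simp
      also have "(\<lambda>x' y. ?a p (x' + of_int \<lfloor>x\<rfloor>) (y + 0)) = G (\<lfloor>x\<rfloor>, p)"
        by (simp add: G fun_eq_iff)
      finally show ?thesis by (simp add: frac_def)
    qed
    obtain M where M: "\<And>j. \<exists>C. \<forall>i x y. \<bar>x\<bar> \<le> 1 \<longrightarrow>
        (1 + \<bar>of_int (snd i)\<bar>) ^ j * norm (dd w (G i) x y) \<le> C * (1 + \<bar>of_int (fst i)\<bar>) ^ M"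
      using tG unfolding tame_def controlled_def by blast
    show ?thesis
      unfolding controlled_def
    proof (intro exI [of _ M] allI)
      fix j
      obtain C where C: "\<And>i x y. \<bar>x\<bar> \<le> 1 \<Longrightarrow>
        (1 + \<bar>of_int (snd i)\<bar>) ^ j * norm (dd w (G i) x y) \<le> C * (1 + \<bar>of_int (fst i)\<bar>) ^ M"
        using M by blast
      have "(1 + \<bar>of_int p\<bar>) ^ j * norm (dd w (?a p) x y) \<le> (\<bar>C\<bar> * 2 ^ M) * (1 + \<bar>x\<bar>) ^ M" for p x y
      proof -
        have "\<bar>frac x\<bar> \<le> 1" using frac_lt_1 [of x] frac_ge_0 [of x] by linarith
        then have "(1 + \<bar>of_int p\<bar>) ^ j * norm (dd w (?a p) x y) \<le> C * (1 + \<bar>of_int \<lfloor>x\<rfloor>\<bar>) ^ M"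
          using C [of "frac x" "(\<lfloor>x\<rfloor>, p)" y] by (simp add: eq)
        also have "\<dots> \<le> \<bar>C\<bar> * (2 * (1 + \<bar>x\<bar>)) ^ M"
        proof (intro mult_mono power_mono)
          show "1 + \<bar>real_of_int \<lfloor>x\<rfloor>\<bar> \<le> 2 * (1 + \<bar>x\<bar>)"
          proof -
            have "\<bar>real_of_int \<lfloor>x\<rfloor>\<bar> \<le> \<bar>x\<bar> + 1"
              using floor_correct [of x] by (intro abs_leI) (simp_all, linarith+)
            then show ?thesis by simp
          qed
        qed auto
        finally show ?thesis by (simp only: power_mult_distrib mult.assoc)
      qed
      then show "\<exists>C. \<forall>p x y. True \<longrightarrow>
          (1 + \<bar>of_int p\<bar>) ^ j * norm (dd w (?a p) x y) \<le> C * (1 + \<bar>x\<bar>) ^ M"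
        by blast
    qed
  qed
  with sm show ?thesis by (simp add: tame_def)
qed

lemma tame_bound:
  assumes "tame \<Omega> v (\<lambda>i x. 1) F"
  obtains C where "\<And>i x y. \<Omega> i x \<Longrightarrow> v i x ^ j * norm (dd w (F i) x y) \<le> C"
proof -
  have "controlled \<Omega> v (\<lambda>i x. 1) (\<lambda>i. dd w (F i))"
    using assms by (simp add: tame_def)
  then have "\<exists>C. \<forall>i x y. \<Omega> i x \<longrightarrow> v i x ^ j * norm (dd w (F i) x y) \<le> C"
    by (auto simp: controlled_def)
  then show ?thesis using that by blast
qed

lemma tame_infsum:
  assumes S: "tame (\<lambda>i x. P x) (\<lambda>i x. (1 + \<bar>of_int (fst i)\<bar>) * v (snd i) x) (\<lambda>i x. 1) S"
    and d: "\<And>i. decaying (\<lambda>k. S (k, i))" and v: "weight v"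
  shows "tame (\<lambda>i x. P x) v (\<lambda>i x. 1) (\<lambda>i x y. \<Sum>\<^sub>\<infinity>k. S (k, i) x y)"
proof -
  define I where "I = (\<Sum>\<^sub>\<infinity>k::int. 1 / (1 + \<bar>of_int k\<bar>)\<^sup>2 :: real)"
  have "\<exists>C. \<forall>i x y. P x \<longrightarrow> v i x ^ j * norm (\<Sum>\<^sub>\<infinity>k. dd w (S (k, i)) x y) \<le> C" for w j
  proof -
    \<comment> \<open>Order \<open>j + 2\<close>: j for the decay claimed for the sum, and 2 for a
      summable majorant in k.\<close>
    obtain C where C: "\<And>i x y. P x \<Longrightarrow>
        ((1 + \<bar>of_int (fst i)\<bar>) * v (snd i) x) ^ (j + 2) * norm (dd w (S i) x y) \<le> C"
      using tame_bound [OF S] by blast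
    have "v i x ^ j * norm (\<Sum>\<^sub>\<infinity>k. dd w (S (k, i)) x y) \<le> C * I" if "P x" for i x y
    proof -
      have v0: "0 < v i x" "1 \<le> v i x" using v by (auto simp: weightD)
      have le: "norm (of_real (v i x ^ j) * dd w (S (k, i)) x y) \<le> C * (1 / (1 + \<bar>of_int k\<bar>)\<^sup>2)" for k
      proof -
        let ?t = "1 + \<bar>real_of_int k\<bar>"
        have "?t\<^sup>2 * (v i x ^ j * norm (dd w (S (k, i)) x y))
            \<le> (?t ^ (j + 2) * v i x ^ (j + 2)) * norm (dd w (S (k, i)) x y)"
          unfolding mult.assoc [symmetric] using v0
          by (intro mult_right_mono mult_mono power_increasing) auto
        also have "\<dots> \<le> C"
          using C [OF that, of "(k, i)" y] by (simp only: fst_conv snd_conv power_mult_distrib)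
        finally show ?thesis
          using v0 by (simp add: norm_mult norm_power field_simps add_pos_nonneg)
      qed
      have s: "(\<lambda>k::int. C * (1 / (1 + \<bar>of_int k\<bar>)\<^sup>2)) summable_on UNIV"
        by (intro summable_on_cmult_right summable_on_int_inverse_square)
      have "v i x ^ j * norm (\<Sum>\<^sub>\<infinity>k. dd w (S (k, i)) x y)
          = norm (\<Sum>\<^sub>\<infinity>k. of_real (v i x ^ j) * dd w (S (k, i)) x y)"
        using v0 by (subst infsum_cmult_right') (simp add: norm_mult norm_power)
      also have "\<dots> \<le> (\<Sum>\<^sub>\<infinity>k. C * (1 / (1 + \<bar>of_int k\<bar>)\<^sup>2))"
        by (rule norm_infsum_le [OF has_sum_infsum has_sum_infsum])
          (use le s summable_on_dominated [OF s] in auto)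
      also have "\<dots> = C * I"
        unfolding I_def by (rule infsum_cmult_right')
      finally show ?thesis .
    qed
    then show ?thesis by blast
  qed
  then show ?thesis
    unfolding tame_def controlled_def by (simp add: smooth_infsum dd_infsum d)
qed

section \<open>The action and the inner product as sums of tame families\<close>

definition act_term :: "real \<Rightarrow> real \<Rightarrow> xi \<Rightarrow> dfun \<Rightarrow> int \<Rightarrow> xi" where
  "act_term \<mu> \<nu> f a p = (\<lambda>x y. cnj (a (x + 2 * of_int p * \<mu>) (y + 2 * of_int p * \<nu>) p)
     * f (x + 2 * of_int p * \<mu>) (y + 2 * of_int p * \<nu>))"

lemma xi_act_eq: "xi_act \<mu> \<nu> f a = (\<lambda>x y. \<Sum>\<^sub>\<infinity>p. act_term \<mu> \<nu> f a p x y)"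
  by (simp add: xi_act_def act_term_def)

text \<open>Decay is known in p and in the translated variable x + 2p\<mu>. As 1 + |x| is at most a
  constant times (1 + |p|)(1 + |x + 2p\<mu>|), this amounts to joint decay in p and x, which also
  absorbs the polynomial growth of the algebra element.\<close>

lemma tame_act_term:
  assumes f: "schwartz f" and a: "a \<in> D_inf c \<nu>"
  shows "tame (\<lambda>p x. True) (\<lambda>p x. (1 + \<bar>of_int p\<bar>) * (1 + \<bar>x\<bar>)) (\<lambda>p x. 1) (act_term \<mu> \<nu> f a)"
proof -
  have "tame (\<lambda>p x. True) (\<lambda>p x. 1 + \<bar>x\<bar>) (\<lambda>p x. 1) (\<lambda>p::int. f)"
    using tame_reindex [of _ _ _ "\<lambda>i::unit. f" "\<lambda>p. ()"] f unfolding schwartz_def by fast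
  from tame_mult [OF tame_cnj [OF D_inf_tame [OF a]] this]
  have "tame (\<lambda>p x. True) (\<lambda>p x. (1 + \<bar>of_int p\<bar>) * (1 + \<bar>x\<bar>)) (\<lambda>p x. (1 + \<bar>x\<bar>) * 1)
      (\<lambda>p x y. cnj (a x y p) * f x y)"
    by (simp add: weight_1 weight_abs)
  from tame_shift [OF this, of "\<lambda>p. 2 * of_int p * \<mu>" "\<lambda>p. 2 * of_int p * \<nu>"]
  have "tame (\<lambda>p x. True) (\<lambda>p x. (1 + \<bar>of_int p\<bar>) * (1 + \<bar>x + 2 * of_int p * \<mu>\<bar>))
      (\<lambda>p x. (1 + \<bar>x + 2 * of_int p * \<mu>\<bar>)) (act_term \<mu> \<nu> f a)"
    by (simp add: act_term_def [abs_def])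
  then show ?thesis
  proof (rule tame_weights [where B = "1 + 2 * \<bar>\<mu>\<bar>" and a = 2 and b = 1])
    fix p :: int and x :: real
    let ?P = "1 + \<bar>real_of_int p\<bar>" and ?X = "1 + \<bar>x + 2 * of_int p * \<mu>\<bar>"
    have 1: "1 \<le> ?P * ?X" using mult_mono [of 1 ?P 1 ?X] by simp
    have "1 + \<bar>x\<bar> \<le> ?X + \<bar>2 * of_int p * \<mu>\<bar>" by linarith
    also have "\<dots> \<le> ?X * (1 + 2 * \<bar>\<mu>\<bar>) * ?P"
      by (simp add: abs_mult algebra_simps)
    finally have "1 + \<bar>x\<bar> \<le> ?X * (1 + 2 * \<bar>\<mu>\<bar>) * ?P" .
    then have "?P * (1 + \<bar>x\<bar>) \<le> ?P * (?X * (1 + 2 * \<bar>\<mu>\<bar>) * ?P)"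
      by (intro mult_left_mono) auto
    also have "\<dots> \<le> ?P * (?X * (1 + 2 * \<bar>\<mu>\<bar>) * ?P) * ?X"
      using mult_left_mono [of 1 ?X "?P * (?X * (1 + 2 * \<bar>\<mu>\<bar>) * ?P)"] by simp
    finally show "?P * (1 + \<bar>x\<bar>) \<le> (1 + 2 * \<bar>\<mu>\<bar>) * (?P * ?X)\<^sup>2"
      by (simp add: power2_eq_square mult_ac)
    have "?X \<le> ?P * ?X" using mult_right_mono [of 1 ?P ?X] by simp
    also have "\<dots> \<le> (?P * ?X)\<^sup>2" using 1 mult_right_mono [OF 1, of "?P * ?X"]
      unfolding power2_eq_square by linarith
    also have "\<dots> \<le> (1 + 2 * \<bar>\<mu>\<bar>) * (?P * ?X)\<^sup>2" by (simp add: algebra_simps)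
    finally show "?X \<le> (1 + 2 * \<bar>\<mu>\<bar>) * (?P * ?X)\<^sup>2 * 1 ^ 1" by simp
  qed (intro weight_mult weight_abs weight_1)+
qed

lemma decaying_act_term:
  assumes f: "schwartz f" and a: "a \<in> D_inf c \<nu>"
  shows "decaying (act_term \<mu> \<nu> f a)"
  unfolding decaying_def
proof
  fix R
  show "tame (\<lambda>p x. \<bar>x\<bar> \<le> R) (\<lambda>p x. 1 + \<bar>of_int p\<bar>) (\<lambda>p x. 1) (act_term \<mu> \<nu> f a)"
    by (rule tame_weights [OF tame_act_term [OF assms], where B = 1 and a = 1 and b = 1])
      ((intro weight_mult weight_abs weight_1)+, simp_all add: algebra_simps)
qed

lemma xi_act_in:
  assumes f: "f \<in> Xi_inf" and a: "a \<in> D_inf c \<nu>"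
  shows "xi_act \<mu> \<nu> f a \<in> Xi_inf"
proof -
  have s: "schwartz f" using f by (simp add: Xi_inf_iff)
  let ?S = "\<lambda>(k, i::unit). act_term \<mu> \<nu> f a k"
  have "tame (\<lambda>i x. True) (\<lambda>i x. 1 + \<bar>x\<bar>) (\<lambda>i x. 1) (\<lambda>i x y. \<Sum>\<^sub>\<infinity>k. ?S (k, i) x y)"
  proof (rule tame_infsum)
    show "tame (\<lambda>i x. True) (\<lambda>i x. (1 + \<bar>of_int (fst i)\<bar>) * (1 + \<bar>x\<bar>)) (\<lambda>i x. 1) ?S"
      using tame_reindex [OF tame_act_term [OF s a], of fst] by (simp add: case_prod_unfold)
  qed (simp_all add: decaying_act_term [OF s a] weight_abs)
  then have "schwartz (xi_act \<mu> \<nu> f a)"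
    by (simp add: schwartz_def xi_act_eq)
  moreover have "xi_act \<mu> \<nu> f a x (y + 1) = xi_act \<mu> \<nu> f a x y" for x y
  proof -
    have "f x (y + 1 + b) = f x (y + b)" "a x (y + 1 + b) p = a x (y + b) p" for x b p
      using f a by (simp_all add: Xi_inf_iff D_inf_iff quasi_periodic_def add.assoc add.commute [of 1 b])
        (simp_all add: add.assoc [symmetric])
    then show ?thesis by (simp add: xi_act_def)
  qed
  ultimately show ?thesis by (simp add: Xi_inf_iff)
qed

definition inner_term :: "nat \<Rightarrow> real \<Rightarrow> real \<Rightarrow> xi \<Rightarrow> xi \<Rightarrow> int \<Rightarrow> int \<Rightarrow> xi" where
  "inner_term c \<mu> \<nu> f g p k = (\<lambda>x y. cnj (ee (of_nat c * of_int k * of_int p * (y - of_int p * \<nu>)))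
     * f (x + of_int k) y * cnj (g (x - 2 * of_int p * \<mu> + of_int k) (y - 2 * of_int p * \<nu>)))"

lemma xi_inner_eq: "xi_inner c \<mu> \<nu> f g = (\<lambda>x y p. \<Sum>\<^sub>\<infinity>k. inner_term c \<mu> \<nu> f g p k x y)"
  by (simp add: xi_inner_def inner_term_def)

text \<open>The arguments x + k and x - 2p\<mu> + k of the two functions differ by 2p\<mu>. For |x|
  \<le> R the decay of \<open>f\<close> therefore controls k, and because \<mu> \<noteq> 0 the decay
  of \<open>f\<close> and \<open>g\<close> together controls p. Both also outweigh the growth of the
  phase under differentiation in y.\<close>

lemma tame_inner_term:
  assumes f: "schwartz f" and g: "schwartz g" and "\<mu> \<noteq> 0"
  shows "tame (\<lambda>i x. \<bar>x\<bar> \<le> R) (\<lambda>i x. (1 + \<bar>of_int (fst i)\<bar>) * (1 + \<bar>of_int (snd i)\<bar>)) (\<lambda>i x. 1)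
    (\<lambda>i. inner_term c \<mu> \<nu> f g (snd i) (fst i))"
proof -
  define E where "E = (\<lambda>(i::int\<times>int) (x::real) y. ee (- of_nat c * of_int (fst i) * of_int (snd i) * y
    + of_nat c * of_int (fst i) * of_int (snd i) * of_int (snd i) * \<nu>))"
  define F where "F = (\<lambda>(i::int\<times>int) x y. f (x + of_int (fst i)) (y + 0))"
  define G where "G = (\<lambda>(i::int\<times>int) x y. cnj (g (x + (of_int (fst i) - 2 * of_int (snd i) * \<mu>))
    (y + (- 2 * of_int (snd i) * \<nu>))))"
  let ?k = "\<lambda>i::int\<times>int. 1 + \<bar>real_of_int (fst i)\<bar>" and ?p = "\<lambda>i::int\<times>int. 1 + \<bar>real_of_int (snd i)\<bar>"
  let ?u = "\<lambda>i x. \<bar>x + real_of_int (fst i)\<bar>"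
  let ?v = "\<lambda>i x. \<bar>x + (real_of_int (fst i) - 2 * real_of_int (snd i) * \<mu>)\<bar>"
  have eq: "inner_term c \<mu> \<nu> f g (snd i) (fst i) = (\<lambda>x y. E i x y * (F i x y * G i x y))" for i
    by (simp add: inner_term_def E_def F_def G_def cnj_ee algebra_simps fun_eq_iff)
  have r: "tame (\<lambda>i x. True) (\<lambda>i x. 1 + \<bar>x\<bar>) (\<lambda>i x. 1) (\<lambda>i::int\<times>int. h)" if "schwartz h" for h
    using tame_reindex [of _ _ _ "\<lambda>i::unit. h" "\<lambda>p. ()"] that unfolding schwartz_def by fast
  have "tame (\<lambda>i x. True) (\<lambda>i x. 1 + ?u i x) (\<lambda>i x. 1) F"
    unfolding F_def using tame_shift [OF r [OF f]] by fast
  moreover have "tame (\<lambda>i x. True) (\<lambda>i x. 1 + ?v i x) (\<lambda>i x. 1) G"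
    unfolding G_def using tame_cnj [OF tame_shift [OF r [OF g]]] by fast
  moreover have "tame (\<lambda>i x. True) (\<lambda>i x. 1) (\<lambda>i x. ?k i * ?p i) E"
    unfolding E_def
  proof (rule tame_ee [where B = "real c" and M = 1])
    fix i :: "int \<times> int" and x :: real
    show "\<bar>- of_nat c * of_int (fst i) * of_int (snd i)\<bar> \<le> real c * (?k i * ?p i) ^ 1"
      by (auto simp: abs_mult mult.assoc intro!: mult_mono)
  qed (intro weight_mult weight_abs)
  ultimately have "tame (\<lambda>i x. True) (\<lambda>i x. 1 * ((1 + ?u i x) * (1 + ?v i x)))
      (\<lambda>i x. ?k i * ?p i * (1 * 1)) (\<lambda>i x y. E i x y * (F i x y * G i x y))"
    by (intro tame_mult weight_mult weight_abs weight_1)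
  then show ?thesis
    unfolding eq
  proof (rule tame_weights [where b = 0 and a = 2])
    fix i :: "int \<times> int" and x :: real
    assume x: "\<bar>x\<bar> \<le> R"
    let ?U = "1 + ?u i x" and ?V = "1 + ?v i x"
    let ?m = "1 / (2 * \<bar>\<mu>\<bar>)"
    have "?k i \<le> ?U + R" using x by linarith
    also have "\<dots> \<le> (1 + R) * ?U" using x by (simp add: algebra_simps)
    finally have k: "?k i \<le> (1 + R) * ?U" .
    have "2 * \<bar>\<mu>\<bar> * \<bar>of_int (snd i)\<bar> = \<bar>2 * real_of_int (snd i) * \<mu>\<bar>"
      by (simp add: abs_mult)
    also have "\<dots> \<le> ?U * ?V"
    proof -
      have "\<bar>2 * real_of_int (snd i) * \<mu>\<bar> \<le> ?u i x + ?v i x" by linarith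
      also have "\<dots> \<le> ?U * ?V" by (simp add: algebra_simps)
      finally show ?thesis .
    qed
    finally have "\<bar>of_int (snd i)\<bar> \<le> ?m * (?U * ?V)"
      using \<open>\<mu> \<noteq> 0\<close> by (simp add: field_simps)
    moreover have "1 \<le> ?U * ?V" using mult_mono [of 1 ?U 1 ?V] by simp
    moreover have "1 + q \<le> (1 + m) * t" if "q \<le> m * t" "1 \<le> t" for q m t :: real
      using that by (simp add: distrib_right)
    ultimately have p: "?p i \<le> (1 + ?m) * (?U * ?V)"
      by blast
    have "?k i * ?p i \<le> ((1 + R) * ?U) * ((1 + ?m) * (?U * ?V))"
      using x by (intro mult_mono k p) auto
    also have "\<dots> = (1 + R) * (1 + ?m) * ((?U * ?V) * (?U * 1))" by simp
    also have "\<dots> \<le> (1 + R) * (1 + ?m) * ((?U * ?V) * (?U * ?V))"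
      using x by (intro mult_left_mono) auto
    finally show "?k i * ?p i \<le> ((1 + R) * (1 + ?m)) * (1 * (?U * ?V))\<^sup>2"
      by (simp add: power2_eq_square)
    then show "?k i * ?p i * (1 * 1) \<le> ((1 + R) * (1 + ?m)) * (1 * (?U * ?V))\<^sup>2 * 1 ^ 0"
      by simp
  qed (simp_all add: weight_mult weight_abs weight_1)
qed

lemma decaying_inner_term:
  assumes "schwartz f" "schwartz g" "\<mu> \<noteq> 0"
  shows "decaying (inner_term c \<mu> \<nu> f g p)"
  unfolding decaying_def
proof
  fix R
  have "tame (\<lambda>k x. \<bar>x\<bar> \<le> R) (\<lambda>k x. (1 + \<bar>of_int k\<bar>) * (1 + \<bar>of_int p\<bar>)) (\<lambda>k x. 1)
      (inner_term c \<mu> \<nu> f g p)"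
    using tame_reindex [where r = "\<lambda>k. (k, p)", OF tame_inner_term [OF assms]] by simp
  then show "tame (\<lambda>k x. \<bar>x\<bar> \<le> R) (\<lambda>k x. 1 + \<bar>of_int k\<bar>) (\<lambda>k x. 1) (inner_term c \<mu> \<nu> f g p)"
    by (rule tame_weights [where B = 1 and a = 1 and b = 1])
      ((intro weight_mult weight_abs weight_1)+, simp_all add: algebra_simps)
qed

lemma infsum_int_shift: "(\<Sum>\<^sub>\<infinity>k::int. h (k + m)) = (\<Sum>\<^sub>\<infinity>k. h k)"
  by (rule infsum_reindex_bij_betw) (rule bij_betw_byWitness [where f' = "\<lambda>k. k - m"]; auto)

text \<open>Decay is \<open>tame_inner_term\<close> summed over k. Periodicity in y holds because c
  k p is an integer, and quasi-periodicity in x is a shift of the summation index by m.\<close>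

lemma xi_inner_in:
  assumes f: "f \<in> Xi_inf" and g: "g \<in> Xi_inf" and \<mu>: "\<mu> \<noteq> 0"
  shows "xi_inner c \<mu> \<nu> f g \<in> D_inf c \<nu>"
proof -
  have s: "schwartz f" "schwartz g" using f g by (simp_all add: Xi_inf_iff)
  have "decaying (\<lambda>p x y. xi_inner c \<mu> \<nu> f g x y p)"
    unfolding decaying_def
  proof
    fix R
    let ?S = "\<lambda>i. inner_term c \<mu> \<nu> f g (snd i) (fst i)"
    have "tame (\<lambda>p x. \<bar>x\<bar> \<le> R) (\<lambda>p x. 1 + \<bar>of_int p\<bar>) (\<lambda>p x. 1) (\<lambda>p x y. \<Sum>\<^sub>\<infinity>k. ?S (k, p) x y)"
      by (rule tame_infsum [OF tame_inner_term [OF s \<mu>]])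
        (simp_all add: decaying_inner_term [OF s \<mu>] weight_abs)
    then show "tame (\<lambda>p x. \<bar>x\<bar> \<le> R) (\<lambda>p x. 1 + \<bar>of_int p\<bar>) (\<lambda>p x. 1)
        (\<lambda>p x y. xi_inner c \<mu> \<nu> f g x y p)"
      by (simp add: xi_inner_eq)
  qed
  moreover have "xi_inner c \<mu> \<nu> f g x (y + 1) p = xi_inner c \<mu> \<nu> f g x y p" for x y p
  proof -
    have "f x (y + 1) = f x y" "g x (y + 1 - b) = g x (y - b)" for x b
      using f g by (simp_all add: Xi_inf_iff diff_add_eq [symmetric])
    moreover have "ee (of_nat c * of_int k * of_int p * (y + 1 - of_int p * \<nu>))
        = ee (of_nat c * of_int k * of_int p * (y - of_int p * \<nu>))" for k
    proof -
      have "of_nat c * of_int k * of_int p * (y + 1 - of_int p * \<nu>)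
          = of_nat c * of_int k * of_int p * (y - of_int p * \<nu>) + of_int (of_nat c * k * p)"
        by (simp add: algebra_simps)
      then show ?thesis by (simp only: ee_add ee_int mult_1_right)
    qed
    ultimately show ?thesis by (simp add: xi_inner_def)
  qed
  moreover have "xi_inner c \<mu> \<nu> f g (x + of_int m) y p
      = ee (of_nat c * of_int m * of_int p * (y - of_int p * \<nu>)) * xi_inner c \<mu> \<nu> f g x y p"
    for x y p m
  proof -
    have "ee (of_nat c * of_int m * of_int p * (y - of_int p * \<nu>)) * xi_inner c \<mu> \<nu> f g x y p
        = (\<Sum>\<^sub>\<infinity>k. ee (of_nat c * of_int m * of_int p * (y - of_int p * \<nu>)) * inner_term c \<mu> \<nu> f g p k x y)"
      by (simp add: xi_inner_eq infsum_cmult_right')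
    also have "\<dots> = (\<Sum>\<^sub>\<infinity>k. ee (of_nat c * of_int m * of_int p * (y - of_int p * \<nu>))
        * inner_term c \<mu> \<nu> f g p (k + m) x y)"
      by (rule infsum_int_shift [symmetric])
    also have "\<dots> = (\<Sum>\<^sub>\<infinity>k. inner_term c \<mu> \<nu> f g p k (x + of_int m) y)"
    proof (rule infsum_cong)
      fix k
      let ?r = "\<lambda>k. of_nat c * of_int k * of_int p * (y - of_int p * \<nu>)"
      have "ee (?r m) * cnj (ee (?r (k + m))) = cnj (ee (?r k))"
        by (simp add: cnj_ee ee_add [symmetric] algebra_simps)
      then show "ee (?r m) * inner_term c \<mu> \<nu> f g p (k + m) x y
          = inner_term c \<mu> \<nu> f g p k (x + of_int m) y"
        by (simp add: inner_term_def mult.assoc [symmetric]) (simp add: algebra_simps)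
    qed
    finally show ?thesis by (simp add: xi_inner_eq)
  qed
  ultimately show ?thesis by (simp add: D_inf_iff quasi_periodic_def)
qed

subsection \<open>Closure properties of the module and the algebra\<close>

lemma schwartz_add:
  "schwartz f \<Longrightarrow> schwartz g \<Longrightarrow> schwartz (\<lambda>x y. f x y + g x y)"
  unfolding schwartz_def by (intro tame_add weight_1 weight_abs)

lemma schwartz_cmult: "schwartz f \<Longrightarrow> schwartz (\<lambda>x y. a * f x y)"
  unfolding schwartz_def
  using tame_mult [OF tame_const [where c = "\<lambda>i. a" and B = "norm a" and M = 0] _ weight_1 weight_1 weight_1 weight_abs]
  by (simp add: weight_1)

lemma schwartz_fst:
  assumes "schwartz f" shows "schwartz (\<lambda>x y. of_real x * f x y)"
proof -
  have "tame (\<lambda>i x. True) (\<lambda>i x. 1 * (1 + \<bar>x\<bar>)) (\<lambda>i x. (1 + \<bar>x\<bar>) * 1) (\<lambda>i::unit. \<lambda>x y. of_real x * f x y)"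
    using tame_mult [OF tame_fst assms [unfolded schwartz_def] weight_abs weight_1 weight_1 weight_abs] .
  then show ?thesis
    unfolding schwartz_def
    by (rule tame_weights [where B = 1 and a = 1 and b = 1])
      ((intro weight_mult weight_abs weight_1)+, simp_all)
qed

lemma schwartz_pdx: "schwartz f \<Longrightarrow> schwartz (pdx f)"
  and schwartz_pdy: "schwartz f \<Longrightarrow> schwartz (pdy f)"
  unfolding schwartz_def by (fact tame_pdx, fact tame_pdy)

lemma Xi_inf_smooth: "f \<in> Xi_inf \<Longrightarrow> smooth f"
  by (simp add: Xi_inf_def)

lemma Xi_inf_add: "f \<in> Xi_inf \<Longrightarrow> g \<in> Xi_inf \<Longrightarrow> (\<lambda>x y. f x y + g x y) \<in> Xi_inf"
  by (simp add: Xi_inf_iff schwartz_add)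

lemma Xi_inf_cmult: "f \<in> Xi_inf \<Longrightarrow> (\<lambda>x y. a * f x y) \<in> Xi_inf"
  by (simp add: Xi_inf_iff schwartz_cmult)

lemma Xi_inf_fst: "f \<in> Xi_inf \<Longrightarrow> (\<lambda>x y. of_real x * f x y) \<in> Xi_inf"
  by (simp add: Xi_inf_iff schwartz_fst)

lemma Xi_inf_pdx: "f \<in> Xi_inf \<Longrightarrow> pdx f \<in> Xi_inf"
  using dd_periodic [of f "[True]"] by (simp add: Xi_inf_iff schwartz_pdx schwartz_smooth)

lemma Xi_inf_pdy: "f \<in> Xi_inf \<Longrightarrow> pdy f \<in> Xi_inf"
  using dd_periodic [of f "[False]"] by (simp add: Xi_inf_iff schwartz_pdy schwartz_smooth)

lemma Xi_inf_plus: "f \<in> Xi_inf \<Longrightarrow> g \<in> Xi_inf \<Longrightarrow> f + g \<in> Xi_inf"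
  using Xi_inf_add [of f g] by (simp add: plus_fun_def)

lemma Xi_inf_scale: "f \<in> Xi_inf \<Longrightarrow> xi_scale l f \<in> Xi_inf"
  by (simp add: xi_scale_def Xi_inf_cmult)

lemma Xi_inf_uminus: "f \<in> Xi_inf \<Longrightarrow> - f \<in> Xi_inf"
  using Xi_inf_cmult [of f "-1"] by (simp add: fun_Compl_def)

lemma Xi_inf_minus: "f \<in> Xi_inf \<Longrightarrow> g \<in> Xi_inf \<Longrightarrow> f - g \<in> Xi_inf"
  using Xi_inf_plus [OF _ Xi_inf_uminus, of f g] by simp

lemma decaying_add: "decaying F \<Longrightarrow> decaying G \<Longrightarrow> decaying (\<lambda>p x y. F p x y + G p x y)"
  unfolding decaying_def by (intro allI tame_add weight_1 weight_abs) auto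

lemma decaying_cmult:
  assumes "decaying F" shows "decaying (\<lambda>p x y. a * F p x y)"
  unfolding decaying_def
proof
  fix R
  have "tame (\<lambda>(i::int) x. \<bar>x\<bar> \<le> R) (\<lambda>i x. 1) (\<lambda>i x. 1) (\<lambda>i x y. a)"
    by (rule tame_const [where B = "norm a" and M = 0]) (simp_all add: weight_1)
  from tame_mult [OF this assms [unfolded decaying_def, rule_format] weight_1 weight_1 weight_1 weight_abs]
  show "tame (\<lambda>p x. \<bar>x\<bar> \<le> R) (\<lambda>p x. 1 + \<bar>of_int p\<bar>) (\<lambda>p x. 1) (\<lambda>p x y. a * F p x y)"
    by simp
qed

lemma decaying_fst:
  assumes "decaying F" shows "decaying (\<lambda>p x y. of_real x * F p x y)"
  unfolding decaying_def
proof
  fix R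
  have "tame (\<lambda>(i::int) x. \<bar>x\<bar> \<le> R) (\<lambda>i x. 1) (\<lambda>i x. 1 + \<bar>x\<bar>) (\<lambda>i x y. of_real x)"
    by (rule tame_subdomain [OF tame_fst]) simp
  from tame_mult [OF this assms [unfolded decaying_def, rule_format] weight_abs weight_1 weight_1 weight_abs]
  show "tame (\<lambda>p x. \<bar>x\<bar> \<le> R) (\<lambda>p x. 1 + \<bar>of_int p\<bar>) (\<lambda>p x. 1) (\<lambda>p x y. of_real x * F p x y)"
  proof (rule tame_weights [where B = "1 + \<bar>R\<bar>" and a = 1 and b = 0])
    fix p :: int and x :: real
    assume "\<bar>x\<bar> \<le> R"
    then show "(1 + \<bar>x\<bar>) * 1 \<le> (1 + \<bar>R\<bar>) * (1 * (1 + \<bar>of_int p\<bar>)) ^ 1 * 1 ^ 0"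
      using mult_mono [of "1 + \<bar>x\<bar>" "1 + \<bar>R\<bar>" 1 "1 + \<bar>of_int p\<bar>"] by simp
    show "1 + \<bar>of_int p\<bar> \<le> (1 + \<bar>R\<bar>) * (1 * (1 + \<bar>real_of_int p\<bar>)) ^ 1"
      using mult_right_mono [of 1 "1 + \<bar>R\<bar>" "1 + \<bar>real_of_int p\<bar>"] by simp
  qed (simp_all add: weight_mult weight_abs weight_1)
qed

lemma decaying_int_mult:
  assumes "decaying F" shows "decaying (\<lambda>p x y. of_int p * F p x y)"
  unfolding decaying_def
proof
  fix R
  have "tame (\<lambda>(i::int) x. \<bar>x\<bar> \<le> R) (\<lambda>i x. 1) (\<lambda>i x. 1 + \<bar>of_int i\<bar>) (\<lambda>i x y. of_int i)"
    by (rule tame_const [where B = 1 and M = 1]) (simp_all add: weight_abs)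
  from tame_mult [OF this assms [unfolded decaying_def, rule_format] weight_abs weight_1 weight_1 weight_abs]
  show "tame (\<lambda>p x. \<bar>x\<bar> \<le> R) (\<lambda>p x. 1 + \<bar>of_int p\<bar>) (\<lambda>p x. 1) (\<lambda>p x y. of_int p * F p x y)"
    by (rule tame_weights [where B = 1 and a = 1 and b = 0])
      ((intro weight_mult weight_abs weight_1)+, simp_all)
qed

section \<open>First-order operators with constant real coefficients and a potential depending on
  x\<close>

definition fop :: "real \<Rightarrow> real \<Rightarrow> (real \<Rightarrow> complex) \<Rightarrow> xi \<Rightarrow> xi" where
  "fop \<alpha> \<beta> \<gamma> f = (\<lambda>x y. of_real \<alpha> * pdx f x y + of_real \<beta> * pdy f x y + \<gamma> x * f x y)"

definition nabla0_pot :: "nat \<Rightarrow> real \<Rightarrow> mat3 \<Rightarrow> real \<Rightarrow> complex" where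
  "nabla0_pot c \<mu> W x = of_real (W $ 1 $ 2) * (of_real pi * of_nat c * \<i> / (2 * of_real \<mu>) * of_real x ^ 2)
     + of_real (of_nat c * W $ 1 $ 3) * (of_real pi * \<i> * of_real x / of_real \<mu>)"

definition delta_pot :: "nat \<Rightarrow> real \<Rightarrow> mat3 \<Rightarrow> int \<Rightarrow> real \<Rightarrow> complex" where
  "delta_pot c \<mu> W p x = of_real (W $ 1 $ 2) *
       (2 * of_real pi * \<i> * of_nat c * of_int p * of_real (x - of_int p * \<mu>))
     + of_real (of_nat c * W $ 1 $ 3) * (2 * of_real pi * \<i> * of_int p)"

lemma nabla0_eq: "nabla0 c \<mu> W f = fop (- W $ 2 $ 3) (- W $ 1 $ 2) (nabla0_pot c \<mu> W) f"
  by (simp add: nabla0_def fop_def nabla0_pot_def fun_eq_iff algebra_simps)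

text \<open>The first-order coefficients agree with those in \<open>nabla0_eq\<close>. Hence the
  Leibniz rule and the compatibility of \<open>nabla0\<close> reduce to the identities
  \<open>pot_act\<close> and \<open>pot_inner\<close> between potentials.\<close>

lemma delta_eq:
  "delta c \<mu> W a x y p = fop (- W $ 2 $ 3) (- W $ 1 $ 2) (delta_pot c \<mu> W p) (\<lambda>x y. a x y p) x y"
  by (simp add: delta_def fop_def delta_pot_def algebra_simps)

lemma fop_infsum:
  assumes T: "decaying T"
  shows "fop \<alpha> \<beta> \<gamma> (\<lambda>x y. \<Sum>\<^sub>\<infinity>p. T p x y) x y = (\<Sum>\<^sub>\<infinity>p. fop \<alpha> \<beta> \<gamma> (T p) x y)"
proof -
  have s: "(\<lambda>p. a * T p x y) summable_on UNIV" "(\<lambda>p. a * pdx (T p) x y) summable_on UNIV"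
    "(\<lambda>p. a * pdy (T p) x y) summable_on UNIV" for a
    by (intro summable_on_cmult_right decaying_summable decaying_pdx decaying_pdy T)+
  show ?thesis
    by (simp add: fop_def diff2_infsum [OF T] infsum_add s summable_on_add infsum_cmult_right')
qed

lemma nabla0_in: "f \<in> Xi_inf \<Longrightarrow> nabla0 c \<mu> W f \<in> Xi_inf"
proof -
  assume f: "f \<in> Xi_inf"
  have "nabla0 c \<mu> W f = (\<lambda>x y. (of_real (- W $ 2 $ 3) * pdx f x y + of_real (- W $ 1 $ 2) * pdy f x y)
      + (of_real (W $ 1 $ 2) * (of_real pi * of_nat c * \<i> / (2 * of_real \<mu>)) * (of_real x * (of_real x * f x y))
      + of_real (of_nat c * W $ 1 $ 3) * (of_real pi * \<i> / of_real \<mu>) * (of_real x * f x y)))"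
    by (simp add: nabla0_def fun_eq_iff algebra_simps power2_eq_square)
  also have "\<dots> \<in> Xi_inf"
    by (intro Xi_inf_add Xi_inf_cmult Xi_inf_fst Xi_inf_pdx Xi_inf_pdy f)
  finally show ?thesis .
qed

text \<open>The delicate point is quasi-periodicity: the y-derivative of the phase contributes
  -2\<pi>i c k p, and replacing x by x + k in the potential contributes the same term with the
  opposite sign.\<close>

lemma delta_in:
  assumes a: "a \<in> D_inf c \<nu>"
  shows "delta c \<mu> W a \<in> D_inf c \<nu>"
proof -
  let ?a = "\<lambda>p x y. a x y p"
  have d: "decaying ?a" and q: "quasi_periodic c \<nu> a"
    using a by (simp_all add: D_inf_iff)
  have sm: "diff2 (?a p)" for p
    using d by (intro smooth_diff2 decaying_smooth)
  have eq: "(\<lambda>p x y. delta c \<mu> W a x y p) = (\<lambda>p x y.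
      (of_real (- W $ 2 $ 3) * pdx (?a p) x y + of_real (- W $ 1 $ 2) * pdy (?a p) x y)
      + ((of_real (W $ 1 $ 2) * 2 * of_real pi * \<i> * of_nat c) * (of_int p * (of_real x * a x y p))
      + ((of_real (- (W $ 1 $ 2) * \<mu>) * 2 * of_real pi * \<i> * of_nat c) * (of_int p * (of_int p * a x y p))
      + (of_real (of_nat c * W $ 1 $ 3) * 2 * of_real pi * \<i>) * (of_int p * a x y p))))"
    by (simp add: delta_def fun_eq_iff algebra_simps)
  have "decaying (\<lambda>p x y. delta c \<mu> W a x y p)"
    unfolding eq
    by (rule decaying_add [OF
          decaying_add [OF decaying_cmult [OF decaying_pdx [OF d]] decaying_cmult [OF decaying_pdy [OF d]]]
          decaying_add [OF decaying_cmult [OF decaying_int_mult [OF decaying_fst [OF d]]]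
            decaying_add [OF decaying_cmult [OF decaying_int_mult [OF decaying_int_mult [OF d]]]
              decaying_cmult [OF decaying_int_mult [OF d]]]]])
  moreover have "delta c \<mu> W a x (y + 1) p = delta c \<mu> W a x y p" for x y p
  proof -
    have "a x (y + 1) p = a x y p" for x y p using q by (simp add: quasi_periodic_def)
    then show ?thesis
      using dd_periodic [OF decaying_smooth [OF d], of p "[True]"]
        dd_periodic [OF decaying_smooth [OF d], of p "[False]"]
      by (simp add: delta_def)
  qed
  moreover have "delta c \<mu> W a (x + of_int k) y p
      = ee (of_nat c * of_int k * of_int p * (y - of_int p * \<nu>)) * delta c \<mu> W a x y p" for x y p k
  proof -
    let ?r = "of_nat c * of_int k * of_int p" and ?s = "- of_nat c * of_int k * of_int p * of_int p * \<nu>"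
    let ?E = "\<lambda>x y. ee (?r * y + ?s)"
    have E: "ee (of_nat c * of_int k * of_int p * (y - of_int p * \<nu>)) = ee (?r * y + ?s)" for y
      by (simp add: algebra_simps)
    have eq: "(\<lambda>x y. ?a p (x + of_int k) (y + 0)) = (\<lambda>x y. ?E x y * ?a p x y)"
      using q by (simp add: quasi_periodic_def E fun_eq_iff)
    have "pdx (?a p) (x + of_int k) y = ?E x y * pdx (?a p) x y"
      using diff2_shift(2) [OF sm [of p], of "of_int k" 0] unfolding eq diff2_mult(2) [OF diff2_ee(1) sm] diff2_ee(2,3)
      by (simp add: fun_eq_iff)
    moreover have "pdy (?a p) (x + of_int k) y
        = 2 * of_real pi * \<i> * of_real ?r * ?E x y * ?a p x y + ?E x y * pdy (?a p) x y"
      using diff2_shift(3) [OF sm [of p], of "of_int k" 0] unfolding eq diff2_mult(3) [OF diff2_ee(1) sm] diff2_ee(2,3)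
      by (simp add: fun_eq_iff)
    moreover have "a (x + of_int k) y p = ?E x y * a x y p"
      using eq by (simp add: fun_eq_iff)
    ultimately show ?thesis
      unfolding E delta_def by (simp add: algebra_simps)
  qed
  ultimately show ?thesis by (simp add: D_inf_iff quasi_periodic_def)
qed

lemma cnj_nabla0_pot: "cnj (nabla0_pot c \<mu> W x) = - nabla0_pot c \<mu> W x"
  by (simp add: nabla0_pot_def)

lemma cnj_delta_pot: "cnj (delta_pot c \<mu> W p x) = - delta_pot c \<mu> W p x"
  by (simp add: delta_pot_def)

text \<open>This identity explains the constants in \<open>nabla0\<close>: the increment of \<pi>ci
  x^2/(2\<mu>) under x \<mapsto> x + 2p\<mu> is 2\<pi>i c p(x + p\<mu>), and that of \<pi>i x/\<mu>
  is 2\<pi>i p.\<close>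

lemma pot_act:
  assumes "\<mu> \<noteq> 0"
  shows "nabla0_pot c \<mu> W (x + 2 * of_int p * \<mu>) - delta_pot c \<mu> W p (x + 2 * of_int p * \<mu>)
    = nabla0_pot c \<mu> W x"
  using assms by (simp add: nabla0_pot_def delta_pot_def field_simps power2_eq_square)

text \<open>The additional summand on the left is the contribution of the y-derivative of the phase
  in \<open>inner_term\<close>.\<close>

lemma pot_inner:
  assumes "\<mu> \<noteq> 0"
  shows "delta_pot c \<mu> W p x + of_real (W $ 1 $ 2) * (2 * of_real pi * \<i> * (of_nat c * of_int k * of_int p))
    = nabla0_pot c \<mu> W (x + of_int k) - nabla0_pot c \<mu> W (x - 2 * of_int p * \<mu> + of_int k)"
  using assms by (simp add: nabla0_pot_def delta_pot_def field_simps power2_eq_square)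

lemma D_inf_smooth: "a \<in> D_inf c \<nu> \<Longrightarrow> smooth (\<lambda>x y. a x y p)"
  by (simp add: D_inf_def)

text \<open>True for each summand: real coefficients let the derivatives pass through the
  conjugation, and the zero-order parts match by \<open>pot_act\<close>, the potential of
  \<open>delta\<close> changing sign under conjugation.\<close>

lemma nabla0_act:
  assumes f: "f \<in> Xi_inf" and a: "a \<in> D_inf c \<nu>" and \<mu>: "\<mu> \<noteq> 0"
  shows "nabla0 c \<mu> W (xi_act \<mu> \<nu> f a)
    = (\<lambda>x y. xi_act \<mu> \<nu> (nabla0 c \<mu> W f) a x y + xi_act \<mu> \<nu> f (delta c \<mu> W a) x y)"
proof (intro ext)
  fix x y
  have sch: "schwartz f" "schwartz (nabla0 c \<mu> W f)"
    using f nabla0_in by (auto simp: Xi_inf_iff)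
  have da: "delta c \<mu> W a \<in> D_inf c \<nu>" by (rule delta_in [OF a])
  have trm: "fop (- W $ 2 $ 3) (- W $ 1 $ 2) (nabla0_pot c \<mu> W) (act_term \<mu> \<nu> f a p) x y
      = act_term \<mu> \<nu> (nabla0 c \<mu> W f) a p x y + act_term \<mu> \<nu> f (delta c \<mu> W a) p x y" for p
  proof -
    have d: "diff2 (\<lambda>x y. a x y p)" "diff2 f"
      using D_inf_smooth [OF a] Xi_inf_smooth [OF f] by (auto intro: smooth_diff2)
    note dm = diff2_mult [OF diff2_cnj(1) [OF d(1)] d(2)]
    have p: "nabla0_pot c \<mu> W x = nabla0_pot c \<mu> W (x + 2 * of_int p * \<mu>)
        - delta_pot c \<mu> W p (x + 2 * of_int p * \<mu>)"
      using pot_act [OF \<mu>] by simp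
    show ?thesis
      unfolding act_term_def nabla0_eq delta_eq
      unfolding fop_def p diff2_shift(2,3) [OF dm(1)] dm diff2_cnj(2,3) [OF d(1)]
      by (simp add: cnj_delta_pot algebra_simps)
  qed
  show "nabla0 c \<mu> W (xi_act \<mu> \<nu> f a) x y
      = xi_act \<mu> \<nu> (nabla0 c \<mu> W f) a x y + xi_act \<mu> \<nu> f (delta c \<mu> W a) x y"
    unfolding xi_act_eq nabla0_eq [of _ _ _ "\<lambda>x y. \<Sum>\<^sub>\<infinity>p. act_term \<mu> \<nu> f a p x y"] fop_infsum [OF decaying_act_term [OF sch(1) a]]
      trm
    by (rule infsum_add [OF decaying_summable [OF decaying_act_term [OF sch(2) a]]
          decaying_summable [OF decaying_act_term [OF sch(1) da]]])
qed

text \<open>Again summand by summand, now with \<open>pot_inner\<close>; the potential of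
  \<open>nabla0\<close> is purely imaginary, so its conjugate in the second argument supplies the
  difference of two values.\<close>

lemma nabla0_inner:
  assumes f: "f \<in> Xi_inf" and g: "g \<in> Xi_inf" and \<mu>: "\<mu> \<noteq> 0"
  shows "(\<lambda>x y p. xi_inner c \<mu> \<nu> (nabla0 c \<mu> W f) g x y p + xi_inner c \<mu> \<nu> f (nabla0 c \<mu> W g) x y p)
    = delta c \<mu> W (xi_inner c \<mu> \<nu> f g)"
proof (intro ext)
  fix x y p
  have sch: "schwartz f" "schwartz g" "schwartz (nabla0 c \<mu> W f)" "schwartz (nabla0 c \<mu> W g)"
    using f g nabla0_in by (auto simp: Xi_inf_iff)
  have trm: "fop (- W $ 2 $ 3) (- W $ 1 $ 2) (delta_pot c \<mu> W p) (inner_term c \<mu> \<nu> f g p k) x y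
      = inner_term c \<mu> \<nu> (nabla0 c \<mu> W f) g p k x y + inner_term c \<mu> \<nu> f (nabla0 c \<mu> W g) p k x y" for k
  proof -
    let ?r = "- of_nat c * of_int k * of_int p" and ?s = "of_nat c * of_int k * of_int p * of_int p * \<nu>"
    have df: "diff2 f" and dg: "diff2 g"
      using Xi_inf_smooth [OF f] Xi_inf_smooth [OF g] by (auto intro: smooth_diff2)
    note sf = diff2_shift [OF df, of "of_int k" 0]
    note sg = diff2_shift [OF dg, of "of_int k - 2 * of_int p * \<mu>" "- 2 * of_int p * \<nu>"]
    note cg = diff2_cnj [OF sg(1)]
    note ef = diff2_mult [OF diff2_ee(1) [of ?r ?s] sf(1)]
    note m = diff2_mult [OF ef(1) cg(1)]
    have eq: "inner_term c \<mu> \<nu> h h' p k = (\<lambda>x y. ee (?r * y + ?s) * h (x + of_int k) (y + 0)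
        * cnj (h' (x + (of_int k - 2 * of_int p * \<mu>)) (y + - 2 * of_int p * \<nu>)))" for h h'
      by (simp add: inner_term_def cnj_ee fun_eq_iff algebra_simps)
    have p: "delta_pot c \<mu> W p x = nabla0_pot c \<mu> W (x + of_int k)
        - nabla0_pot c \<mu> W (x + (of_int k - 2 * of_int p * \<mu>))
        - of_real (W $ 1 $ 2) * (2 * of_real pi * \<i> * (of_nat c * of_int k * of_int p))"
      using pot_inner [OF \<mu>, of c W p x k] by (simp add: algebra_simps)
    show ?thesis
      unfolding nabla0_eq eq
      unfolding fop_def p m(2,3) ef(2,3) cg(2,3) sf(2,3) sg(2,3) diff2_ee(2,3)
      by (simp add: cnj_nabla0_pot algebra_simps)
  qed
  show "xi_inner c \<mu> \<nu> (nabla0 c \<mu> W f) g x y p + xi_inner c \<mu> \<nu> f (nabla0 c \<mu> W g) x y p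
      = delta c \<mu> W (xi_inner c \<mu> \<nu> f g) x y p"
    unfolding delta_eq xi_inner_eq fop_infsum [OF decaying_inner_term [OF sch(1,2) \<mu>]] trm
    by (rule infsum_add [OF decaying_summable [OF decaying_inner_term [OF sch(3,2) \<mu>]]
          decaying_summable [OF decaying_inner_term [OF sch(1,4) \<mu>]], symmetric])
qed

lemma nabla0_plus: "f \<in> Xi_inf \<Longrightarrow> g \<in> Xi_inf \<Longrightarrow> nabla0 c \<mu> W (f + g) = nabla0 c \<mu> W f + nabla0 c \<mu> W g"
  using diff2_add [of f g] Xi_inf_smooth [of f] Xi_inf_smooth [of g]
  by (simp add: nabla0_def plus_fun_def smooth_diff2 fun_eq_iff algebra_simps add_divide_distrib)

lemma nabla0_scale: "f \<in> Xi_inf \<Longrightarrow> nabla0 c \<mu> W (xi_scale l f) = xi_scale l (nabla0 c \<mu> W f)"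
  using diff2_mult [OF diff2_const(1), of f "cnj l"] Xi_inf_smooth [of f]
  by (simp add: nabla0_def xi_scale_def smooth_diff2 diff2_const fun_eq_iff algebra_simps)

theorem nabla0_compatible:
  assumes \<mu>: "\<mu> \<noteq> 0"
  shows "compatible_connection c \<mu> \<nu> (nabla0 c \<mu>)"
  unfolding compatible_connection_def connection_def
proof (intro conjI ballI allI)
  show "nabla0 c \<mu> W (xi_act \<mu> \<nu> \<xi> a) = xi_act \<mu> \<nu> (nabla0 c \<mu> W \<xi>) a + xi_act \<mu> \<nu> \<xi> (delta c \<mu> W a)"
    if "\<xi> \<in> Xi_inf" "a \<in> D_inf c \<nu>" for W \<xi> a
    using nabla0_act [OF that \<mu>] by (simp add: plus_fun_def)
  show "xi_inner c \<mu> \<nu> (nabla0 c \<mu> W \<xi>) \<eta> + xi_inner c \<mu> \<nu> \<xi> (nabla0 c \<mu> W \<eta>) = delta c \<mu> W (xi_inner c \<mu> \<nu> \<xi> \<eta>)"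
    if "\<xi> \<in> Xi_inf" "\<eta> \<in> Xi_inf" for W \<xi> \<eta>
    using nabla0_inner [OF that \<mu>] by (simp add: plus_fun_def)
  show "nabla0 c \<mu> (V + W) \<xi> = nabla0 c \<mu> V \<xi> + nabla0 c \<mu> W \<xi>" for V W \<xi>
    by (simp add: nabla0_def plus_fun_def fun_eq_iff algebra_simps add_divide_distrib)
  show "nabla0 c \<mu> (r *\<^sub>R W) \<xi> = xi_scale (of_real r) (nabla0 c \<mu> W \<xi>)" for r W \<xi>
    by (simp add: nabla0_def xi_scale_def fun_eq_iff algebra_simps)
qed (simp_all add: nabla0_in nabla0_plus nabla0_scale)

subsection \<open>Sesquilinearity\<close>

lemma summable_act_term:
  assumes "f \<in> Xi_inf" "a \<in> D_inf c \<nu>"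
  shows "(\<lambda>p. act_term \<mu> \<nu> f a p x y) summable_on UNIV"
  using assms by (intro decaying_summable decaying_act_term) (simp_all add: Xi_inf_iff)

lemma summable_inner_term:
  assumes "f \<in> Xi_inf" "g \<in> Xi_inf" "\<mu> \<noteq> 0"
  shows "(\<lambda>k. inner_term c \<mu> \<nu> f g p k x y) summable_on UNIV"
  using assms by (intro decaying_summable decaying_inner_term) (simp_all add: Xi_inf_iff)

lemma xi_act_plus_left:
  assumes "f \<in> Xi_inf" "g \<in> Xi_inf" "a \<in> D_inf c \<nu>"
  shows "xi_act \<mu> \<nu> (f + g) a = xi_act \<mu> \<nu> f a + xi_act \<mu> \<nu> g a"
  unfolding xi_act_eq plus_fun_def
  using infsum_add [OF summable_act_term [OF assms(1,3)] summable_act_term [OF assms(2,3)]]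
  by (simp add: act_term_def algebra_simps)

lemma xi_act_plus_right:
  assumes "f \<in> Xi_inf" "a \<in> D_inf c \<nu>" "b \<in> D_inf c \<nu>"
  shows "xi_act \<mu> \<nu> f (a + b) = xi_act \<mu> \<nu> f a + xi_act \<mu> \<nu> f b"
  unfolding xi_act_eq plus_fun_def
  using infsum_add [OF summable_act_term [OF assms(1,2)] summable_act_term [OF assms(1,3)]]
  by (simp add: act_term_def algebra_simps)

lemma xi_act_scale_left: "xi_act \<mu> \<nu> (xi_scale l f) a = xi_scale l (xi_act \<mu> \<nu> f a)"
  by (simp add: xi_act_eq act_term_def xi_scale_def infsum_cmult_right' [symmetric] mult_ac)

lemma xi_act_scale_right: "xi_act \<mu> \<nu> f (\<lambda>x y p. l * a x y p) = xi_scale l (xi_act \<mu> \<nu> f a)"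
  by (simp add: xi_act_eq act_term_def xi_scale_def infsum_cmult_right' [symmetric] mult_ac)

lemma xi_inner_plus_left:
  assumes "f \<in> Xi_inf" "g \<in> Xi_inf" "h \<in> Xi_inf" "\<mu> \<noteq> 0"
  shows "xi_inner c \<mu> \<nu> (f + g) h = xi_inner c \<mu> \<nu> f h + xi_inner c \<mu> \<nu> g h"
  unfolding xi_inner_eq plus_fun_def
  using infsum_add [OF summable_inner_term [OF assms(1,3,4)] summable_inner_term [OF assms(2,3,4)]]
  by (simp add: inner_term_def algebra_simps)

lemma xi_inner_plus_right:
  assumes "f \<in> Xi_inf" "g \<in> Xi_inf" "h \<in> Xi_inf" "\<mu> \<noteq> 0"
  shows "xi_inner c \<mu> \<nu> h (f + g) = xi_inner c \<mu> \<nu> h f + xi_inner c \<mu> \<nu> h g"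
  unfolding xi_inner_eq plus_fun_def
  using infsum_add [OF summable_inner_term [OF assms(3,1,4)] summable_inner_term [OF assms(3,2,4)]]
  by (simp add: inner_term_def algebra_simps)

lemma xi_inner_scale_left: "xi_inner c \<mu> \<nu> (xi_scale l f) g = (\<lambda>x y p. cnj l * xi_inner c \<mu> \<nu> f g x y p)"
  by (simp add: xi_inner_eq inner_term_def xi_scale_def infsum_cmult_right' [symmetric] mult_ac)

lemma xi_inner_scale_right: "xi_inner c \<mu> \<nu> f (xi_scale l g) = (\<lambda>x y p. l * xi_inner c \<mu> \<nu> f g x y p)"
  by (simp add: xi_inner_eq inner_term_def xi_scale_def infsum_cmult_right' [symmetric] mult_ac)

subsection \<open>Kernels of the rank-one operators\<close>

definition invsq :: "int \<Rightarrow> real" where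
  "invsq p = 1 / (1 + \<bar>of_int p\<bar>)\<^sup>2"

lemma invsq_pos: "0 < invsq p"
  by (simp add: invsq_def add_pos_nonneg)

lemma invsq_nonneg [simp]: "0 \<le> invsq p"
  using invsq_pos less_imp_le by blast

lemma summable_invsq: "invsq summable_on UNIV"
  using summable_on_int_inverse_square by (simp add: invsq_def [abs_def])

lemma summable_on_invsq:
  fixes f :: "int \<Rightarrow> complex"
  assumes "\<And>p. norm (f p) \<le> C * invsq p"
  shows "f summable_on UNIV"
  by (rule summable_on_dominated [OF summable_on_cmult_right [OF summable_invsq]]) (use assms in simp)

lemma norm_infsum_invsq:
  fixes f :: "int \<Rightarrow> complex"
  assumes "\<And>p. norm (f p) \<le> C * invsq p"
  shows "norm (\<Sum>\<^sub>\<infinity>p. f p) \<le> C * (\<Sum>\<^sub>\<infinity>p. invsq p)"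
proof -
  have "norm (\<Sum>\<^sub>\<infinity>p. f p) \<le> (\<Sum>\<^sub>\<infinity>p. C * invsq p)"
    by (rule norm_infsum_le [OF has_sum_infsum has_sum_infsum])
      (use assms summable_on_invsq [OF assms] summable_on_cmult_right [OF summable_invsq] in auto)
  then show ?thesis by (simp add: infsum_cmult_right')
qed

text \<open>A product of inverse squares majorises the terms, so the double family is absolutely
  summable. Every exchange of two infinite sums below is an instance.\<close>

lemma infsum_swap_int:
  fixes f :: "int \<Rightarrow> int \<Rightarrow> complex"
  assumes "\<And>p k. norm (f p k) \<le> C * invsq p * invsq k"
  shows "(\<Sum>\<^sub>\<infinity>p. \<Sum>\<^sub>\<infinity>k. f p k) = (\<Sum>\<^sub>\<infinity>k. \<Sum>\<^sub>\<infinity>p. f p k)"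
proof (rule infsum_swap_banach)
  have 1: "(\<lambda>(p, k). \<bar>C\<bar> * invsq p * invsq k) summable_on (UNIV \<times> UNIV)"
  proof (rule summable_on_SigmaI)
    show "((\<lambda>k. case (p, k) of (p, k) \<Rightarrow> \<bar>C\<bar> * invsq p * invsq k)
        has_sum (\<bar>C\<bar> * invsq p * (\<Sum>\<^sub>\<infinity>k. invsq k))) UNIV" for p
      by (simp add: has_sum_cmult_right summable_invsq)
    show "(\<lambda>p. \<bar>C\<bar> * invsq p * (\<Sum>\<^sub>\<infinity>k. invsq k)) summable_on UNIV"
      by (intro summable_on_cmult_left summable_on_cmult_right summable_invsq)
  qed auto
  show "(\<lambda>(p, k). f p k) summable_on UNIV \<times> UNIV"
  proof (rule summable_on_dominated [OF 1])
    fix z :: "int \<times> int"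
    obtain p k where z: "z = (p, k)" by (cases z)
    have "C * invsq p * invsq k \<le> \<bar>C\<bar> * invsq p * invsq k"
      by (intro mult_right_mono) auto
    with assms [of p k] show "norm (case z of (p, k) \<Rightarrow> f p k) \<le> (case z of (p, k) \<Rightarrow> \<bar>C\<bar> * invsq p * invsq k)"
      by (simp add: z)
  qed
qed

text \<open>Peetre's inequality with exponent 1: decay at x + z becomes decay in z, at the cost of
  growth in x.\<close>

lemma peetre: "1 + \<bar>z\<bar> \<le> (1 + \<bar>x\<bar>) * (1 + \<bar>x + z\<bar>)" for x z :: real
proof -
  have "\<bar>z\<bar> \<le> \<bar>x\<bar> + \<bar>x + z\<bar>" by linarith
  also have "\<dots> \<le> \<bar>x\<bar> + \<bar>x + z\<bar> + \<bar>x\<bar> * \<bar>x + z\<bar>" by simp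
  finally show ?thesis by (simp add: algebra_simps)
qed

lemma Xi_inf_bound:
  assumes "f \<in> Xi_inf"
  obtains C where "0 \<le> C" "\<And>x y. (1 + \<bar>x\<bar>) ^ j * norm (f x y) \<le> C"
proof -
  have "schwartz f" using assms by (simp add: Xi_inf_iff)
  then obtain C where C: "\<And>x y. (1 + \<bar>x\<bar>) ^ j * norm (dd [] f x y) \<le> C"
    using schwartz_bound by blast
  moreover have "0 \<le> C"
    using C [of 0 0] by (rule order_trans [rotated]) simp
  ultimately show ?thesis using that by simp
qed

lemma Xi_inf_translate:
  assumes "f \<in> Xi_inf"
  obtains C where "0 \<le> C" "\<And>x y z. (1 + \<bar>z\<bar>) ^ j * norm (f (x + z) y) \<le> C * (1 + \<bar>x\<bar>) ^ j"
proof -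
  obtain C where C: "0 \<le> C" "\<And>x y. (1 + \<bar>x\<bar>) ^ j * norm (f x y) \<le> C"
    using Xi_inf_bound [OF assms] by blast
  have "(1 + \<bar>z\<bar>) ^ j * norm (f (x + z) y) \<le> C * (1 + \<bar>x\<bar>) ^ j" for x y z
  proof -
    have "(1 + \<bar>z\<bar>) ^ j * norm (f (x + z) y) \<le> ((1 + \<bar>x\<bar>) * (1 + \<bar>x + z\<bar>)) ^ j * norm (f (x + z) y)"
      by (intro mult_right_mono power_mono peetre) auto
    also have "\<dots> = (1 + \<bar>x\<bar>) ^ j * ((1 + \<bar>x + z\<bar>) ^ j * norm (f (x + z) y))"
      by (simp add: power_mult_distrib)
    also have "\<dots> \<le> (1 + \<bar>x\<bar>) ^ j * C"
      by (intro mult_left_mono C) simp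
    finally show ?thesis by (simp add: mult.commute)
  qed
  then show ?thesis using that C by blast
qed

lemma le_invsqI: "(1 + \<bar>of_int p\<bar>)\<^sup>2 * r \<le> C \<Longrightarrow> r \<le> C * invsq p"
  by (simp add: invsq_def field_simps add_pos_nonneg)

lemma Xi_inf_translate_int:
  assumes "f \<in> Xi_inf"
  obtains C where "0 \<le> C" "\<And>x y k. norm (f (x + of_int k) y) \<le> C * (1 + \<bar>x\<bar>)\<^sup>2 * invsq k"
proof -
  obtain C where "0 \<le> C" "\<And>x y z. (1 + \<bar>z\<bar>)\<^sup>2 * norm (f (x + z) y) \<le> C * (1 + \<bar>x\<bar>)\<^sup>2"
    using Xi_inf_translate [OF assms] by blast
  then show ?thesis using that by (blast intro: le_invsqI)
qed

lemma Xi_inf_translate_mu: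
  assumes f: "f \<in> Xi_inf" and \<mu>: "\<mu> \<noteq> 0"
  obtains C where "0 \<le> C" "\<And>x y p. norm (f (x + 2 * of_int p * \<mu>) y) \<le> C * (1 + \<bar>x\<bar>)\<^sup>2 * invsq p"
proof -
  obtain C where C: "0 \<le> C" "\<And>x y z. (1 + \<bar>z\<bar>)\<^sup>2 * norm (f (x + z) y) \<le> C * (1 + \<bar>x\<bar>)\<^sup>2"
    using Xi_inf_translate [OF assms(1)] by blast
  \<comment> \<open>Chosen so that 1 + |p| \<le> \<open>?B\<close> (1 + |2p\<mu>|), which converts
    decay along the translates by 2p\<mu> into decay in p.\<close>
  let ?B = "1 + 1 / (2 * \<bar>\<mu>\<bar>)"
  have "norm (f (x + 2 * of_int p * \<mu>) y) \<le> ?B\<^sup>2 * C * (1 + \<bar>x\<bar>)\<^sup>2 * invsq p" for x y p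
  proof (rule le_invsqI)
    have "1 + \<bar>of_int p\<bar> \<le> ?B * (1 + \<bar>2 * of_int p * \<mu>\<bar>)"
      using \<mu> by (simp add: abs_mult field_simps)
    then have "(1 + \<bar>of_int p\<bar>)\<^sup>2 * norm (f (x + 2 * of_int p * \<mu>) y)
        \<le> (?B * (1 + \<bar>2 * of_int p * \<mu>\<bar>))\<^sup>2 * norm (f (x + 2 * of_int p * \<mu>) y)"
      by (intro mult_right_mono power_mono) auto
    also have "\<dots> = ?B\<^sup>2 * ((1 + \<bar>2 * of_int p * \<mu>\<bar>)\<^sup>2 * norm (f (x + 2 * of_int p * \<mu>) y))"
      by (simp only: power_mult_distrib mult.assoc)
    also have "\<dots> \<le> ?B\<^sup>2 * (C * (1 + \<bar>x\<bar>)\<^sup>2)"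
      by (intro mult_left_mono C) simp
    finally show "(1 + \<bar>of_int p\<bar>)\<^sup>2 * norm (f (x + 2 * of_int p * \<mu>) y) \<le> ?B\<^sup>2 * C * (1 + \<bar>x\<bar>)\<^sup>2"
      by (simp only: mult.assoc)
  qed
  then show ?thesis using that [of "?B\<^sup>2 * C"] C by simp
qed

text \<open>The coefficient of \<zeta>(x + k, y) contributed by index p when the inner product
  \<langle>\<eta>, \<zeta>\<rangle> is inserted into the action on \<xi>; the phase is that of the
  inner product, conjugated and evaluated at the translated point. See
  \<open>inner_term_shift\<close>.\<close>

definition kern_term :: "nat \<Rightarrow> real \<Rightarrow> real \<Rightarrow> xi \<Rightarrow> xi \<Rightarrow> real \<Rightarrow> real \<Rightarrow> int \<Rightarrow> int \<Rightarrow> complex" where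
  "kern_term c \<mu> \<nu> \<xi> \<eta> x y k p = ee (of_nat c * of_int k * of_int p * (y + of_int p * \<nu>))
     * cnj (\<eta> (x + 2 * of_int p * \<mu> + of_int k) (y + 2 * of_int p * \<nu>))
     * \<xi> (x + 2 * of_int p * \<mu>) (y + 2 * of_int p * \<nu>)"

definition kern :: "nat \<Rightarrow> real \<Rightarrow> real \<Rightarrow> xi \<Rightarrow> xi \<Rightarrow> real \<Rightarrow> real \<Rightarrow> int \<Rightarrow> complex" where
  "kern c \<mu> \<nu> \<xi> \<eta> x y k = (\<Sum>\<^sub>\<infinity>p. kern_term c \<mu> \<nu> \<xi> \<eta> x y k p)"

lemma kern_term_bound:
  assumes \<xi>: "\<xi> \<in> Xi_inf" and \<eta>: "\<eta> \<in> Xi_inf" and \<mu>: "\<mu> \<noteq> 0"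
  obtains D where "0 \<le> D"
    "\<And>x y k p. norm (kern_term c \<mu> \<nu> \<xi> \<eta> x y k p) \<le> D * (1 + \<bar>x\<bar>)\<^sup>2 * invsq k * invsq p"
proof -
  \<comment> \<open>Decay in k of the translate of \<eta> costs a factor (1 + |u|)^2 with u = x +
    2p\<mu>. Since \<xi>' is again in the module, \<xi> can pay for this factor and still decay in
    p.\<close>
  define \<xi>' where "\<xi>' = (\<lambda>x y. (1 + of_real x * of_real x) * \<xi> x y)"
  have "\<xi>' = (\<lambda>x y. \<xi> x y + of_real x * (of_real x * \<xi> x y))"
    by (simp add: \<xi>'_def algebra_simps)
  then have "\<xi>' \<in> Xi_inf" using \<xi> by (simp add: Xi_inf_add Xi_inf_fst)
  then obtain C where C: "0 \<le> C"
    "\<And>x y p. norm (\<xi>' (x + 2 * of_int p * \<mu>) y) \<le> C * (1 + \<bar>x\<bar>)\<^sup>2 * invsq p"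
    using Xi_inf_translate_mu [OF _ \<mu>] by blast
  obtain A where A: "0 \<le> A" "\<And>x y k. norm (\<eta> (x + of_int k) y) \<le> A * (1 + \<bar>x\<bar>)\<^sup>2 * invsq k"
    using Xi_inf_translate_int [OF \<eta>] by blast
  have "norm (kern_term c \<mu> \<nu> \<xi> \<eta> x y k p) \<le> (2 * A * C) * (1 + \<bar>x\<bar>)\<^sup>2 * invsq k * invsq p" for x y k p
  proof -
    let ?u = "x + 2 * of_int p * \<mu>" and ?v = "y + 2 * of_int p * \<nu>"
    have sq: "(1 + \<bar>?u\<bar>)\<^sup>2 \<le> 2 * (1 + ?u * ?u)"
      using sum_squares_bound [of 1 "\<bar>?u\<bar>"] by (simp add: power2_eq_square algebra_simps)
    have "norm (\<xi>' ?u ?v) = (1 + ?u * ?u) * norm (\<xi> ?u ?v)"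
    proof -
      have "(1 + of_real ?u * of_real ?u :: complex) = of_real (1 + ?u * ?u)" by simp
      then show ?thesis unfolding \<xi>'_def norm_mult norm_of_real
        by (metis abs_of_nonneg add_nonneg_nonneg norm_of_real zero_le_one zero_le_square)
    qed
    then have 1: "(1 + ?u * ?u) * norm (\<xi> ?u ?v) \<le> C * (1 + \<bar>x\<bar>)\<^sup>2 * invsq p"
      using C(2) [of x p ?v] by simp
    have "norm (kern_term c \<mu> \<nu> \<xi> \<eta> x y k p) = norm (\<eta> (?u + of_int k) ?v) * norm (\<xi> ?u ?v)"
      by (simp add: kern_term_def norm_mult)
    also have "\<dots> \<le> (A * (2 * (1 + ?u * ?u)) * invsq k) * norm (\<xi> ?u ?v)"
      by (intro mult_right_mono order_trans [OF A(2)] mult_left_mono sq A) auto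
    also have "\<dots> = 2 * A * invsq k * ((1 + ?u * ?u) * norm (\<xi> ?u ?v))"
      by (simp only: mult_ac)
    also have "\<dots> \<le> 2 * A * invsq k * (C * (1 + \<bar>x\<bar>)\<^sup>2 * invsq p)"
      by (intro mult_left_mono 1 mult_nonneg_nonneg A) auto
    finally show ?thesis by (simp only: mult_ac)
  qed
  then show ?thesis using that [of "2 * A * C"] A C by simp
qed

lemma kern_term_summable:
  assumes "\<xi> \<in> Xi_inf" "\<eta> \<in> Xi_inf" "\<mu> \<noteq> 0"
  shows "kern_term c \<mu> \<nu> \<xi> \<eta> x y k summable_on UNIV"
proof -
  obtain D where D: "0 \<le> D"
    "\<And>x y k p. norm (kern_term c \<mu> \<nu> \<xi> \<eta> x y k p) \<le> D * (1 + \<bar>x\<bar>)\<^sup>2 * invsq k * invsq p"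
    using kern_term_bound [OF assms] by blast
  show ?thesis
    by (rule summable_on_invsq [where C = "D * (1 + \<bar>x\<bar>)\<^sup>2 * invsq k"]) (rule D(2))
qed

lemma kern_bound:
  assumes "\<xi> \<in> Xi_inf" "\<eta> \<in> Xi_inf" "\<mu> \<noteq> 0"
  obtains D where "0 \<le> D" "\<And>x y k. norm (kern c \<mu> \<nu> \<xi> \<eta> x y k) \<le> D * (1 + \<bar>x\<bar>)\<^sup>2 * invsq k"
proof -
  obtain D where D: "0 \<le> D"
    "\<And>x y k p. norm (kern_term c \<mu> \<nu> \<xi> \<eta> x y k p) \<le> D * (1 + \<bar>x\<bar>)\<^sup>2 * invsq k * invsq p"
    using kern_term_bound [OF assms] by blast
  let ?I = "\<Sum>\<^sub>\<infinity>p. invsq p"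
  have "norm (kern c \<mu> \<nu> \<xi> \<eta> x y k) \<le> (D * ?I) * (1 + \<bar>x\<bar>)\<^sup>2 * invsq k" for x y k
  proof -
    have "norm (kern c \<mu> \<nu> \<xi> \<eta> x y k) \<le> (D * (1 + \<bar>x\<bar>)\<^sup>2 * invsq k) * ?I"
      unfolding kern_def by (rule norm_infsum_invsq) (rule D(2))
    then show ?thesis by (simp only: mult_ac)
  qed
  then show ?thesis
    using that [of "D * ?I"] D(1) by (simp add: infsum_nonneg)
qed

lemma inner_term_shift:
  "cnj (inner_term c \<mu> \<nu> \<eta> \<zeta> p k (x + 2 * of_int p * \<mu>) (y + 2 * of_int p * \<nu>))
     * \<xi> (x + 2 * of_int p * \<mu>) (y + 2 * of_int p * \<nu>)
   = kern_term c \<mu> \<nu> \<xi> \<eta> x y k p * \<zeta> (x + of_int k) y"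
  by (simp add: inner_term_def kern_term_def) (simp add: algebra_simps)

lemma E_inner_kern:
  assumes \<xi>: "\<xi> \<in> Xi_inf" and \<eta>: "\<eta> \<in> Xi_inf" and \<zeta>: "\<zeta> \<in> Xi_inf" and \<mu>: "\<mu> \<noteq> 0"
  shows "E_inner c \<mu> \<nu> \<xi> \<eta> \<zeta> x y = (\<Sum>\<^sub>\<infinity>k. kern c \<mu> \<nu> \<xi> \<eta> x y k * \<zeta> (x + of_int k) y)"
proof -
  obtain D where D: "0 \<le> D"
    "\<And>x y k p. norm (kern_term c \<mu> \<nu> \<xi> \<eta> x y k p) \<le> D * (1 + \<bar>x\<bar>)\<^sup>2 * invsq k * invsq p"
    using kern_term_bound [OF \<xi> \<eta> \<mu>] by blast
  obtain Z where Z: "0 \<le> Z" "\<And>x y. (1 + \<bar>x\<bar>) ^ 0 * norm (\<zeta> x y) \<le> Z"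
    using Xi_inf_bound [OF \<zeta>] by blast
  have "E_inner c \<mu> \<nu> \<xi> \<eta> \<zeta> x y
      = (\<Sum>\<^sub>\<infinity>p. \<Sum>\<^sub>\<infinity>k. kern_term c \<mu> \<nu> \<xi> \<eta> x y k p * \<zeta> (x + of_int k) y)"
    using \<zeta> unfolding E_inner_def xi_act_def xi_inner_eq
    by (simp add: infsum_cmult_left' [symmetric] infsum_cnj [symmetric] inner_term_shift del: infsum_cnj)
  also have "\<dots> = (\<Sum>\<^sub>\<infinity>k. \<Sum>\<^sub>\<infinity>p. kern_term c \<mu> \<nu> \<xi> \<eta> x y k p * \<zeta> (x + of_int k) y)"
  proof (rule infsum_swap_int)
    fix p k
    have "norm (kern_term c \<mu> \<nu> \<xi> \<eta> x y k p * \<zeta> (x + of_int k) y)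
        \<le> (D * (1 + \<bar>x\<bar>)\<^sup>2 * invsq k * invsq p) * Z"
      unfolding norm_mult using Z(2) [of "x + of_int k" y] D
      by (intro mult_mono D) auto
    then show "norm (kern_term c \<mu> \<nu> \<xi> \<eta> x y k p * \<zeta> (x + of_int k) y)
        \<le> (D * (1 + \<bar>x\<bar>)\<^sup>2 * Z) * invsq p * invsq k"
      by (simp only: mult_ac)
  qed
  finally show ?thesis by (simp add: kern_def infsum_cmult_left')
qed

text \<open>Translation by (2q\<mu>, 2q\<nu>) is undone by shifting p by q, up to a phase. This
  covariance is what makes the operators linear over the algebra.\<close>

lemma kern_shift:
  "kern c \<mu> \<nu> \<xi> \<eta> (x + 2 * of_int q * \<mu>) (y + 2 * of_int q * \<nu>) k
    = ee (- of_nat c * of_int k * of_int q * (y + of_int q * \<nu>)) * kern c \<mu> \<nu> \<xi> \<eta> x y k"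
proof -
  let ?e = "ee (- of_nat c * of_int k * of_int q * (y + of_int q * \<nu>))"
  have "?e * kern c \<mu> \<nu> \<xi> \<eta> x y k = (\<Sum>\<^sub>\<infinity>p. ?e * kern_term c \<mu> \<nu> \<xi> \<eta> x y k p)"
    by (simp add: kern_def infsum_cmult_right')
  also have "\<dots> = (\<Sum>\<^sub>\<infinity>p. ?e * kern_term c \<mu> \<nu> \<xi> \<eta> x y k (p + q))"
    by (rule infsum_int_shift [symmetric])
  also have "\<dots> = (\<Sum>\<^sub>\<infinity>p. kern_term c \<mu> \<nu> \<xi> \<eta> (x + 2 * of_int q * \<mu>) (y + 2 * of_int q * \<nu>) k p)"
  proof (rule infsum_cong)
    fix p
    have "?e * ee (of_nat c * of_int k * of_int (p + q) * (y + of_int (p + q) * \<nu>))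
        = ee (of_nat c * of_int k * of_int p * (y + 2 * of_int q * \<nu> + of_int p * \<nu>))"
      unfolding ee_add [symmetric] by (rule arg_cong [where f = ee]) (simp add: algebra_simps)
    moreover have "x + 2 * of_int (p + q) * \<mu> = x + 2 * of_int q * \<mu> + 2 * of_int p * \<mu>"
      "y + 2 * of_int (p + q) * \<nu> = y + 2 * of_int q * \<nu> + 2 * of_int p * \<nu>"
      by (simp_all add: algebra_simps)
    ultimately show "?e * kern_term c \<mu> \<nu> \<xi> \<eta> x y k (p + q)
        = kern_term c \<mu> \<nu> \<xi> \<eta> (x + 2 * of_int q * \<mu>) (y + 2 * of_int q * \<nu>) k p"
      by (simp only: kern_term_def mult.assoc [symmetric])
  qed
  finally show ?thesis by (simp add: kern_def)
qed

text \<open>Hermitian symmetry: exchanging the two vectors transposes and conjugates the kernel. It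
  is the source of the adjoint formula.\<close>

lemma cnj_kern: "cnj (kern c \<mu> \<nu> \<eta> \<xi> (x + of_int k) y (- k)) = kern c \<mu> \<nu> \<xi> \<eta> x y k"
proof -
  have "cnj (kern_term c \<mu> \<nu> \<eta> \<xi> (x + of_int k) y (- k) p) = kern_term c \<mu> \<nu> \<xi> \<eta> x y k p" for p
    by (simp add: kern_term_def cnj_ee algebra_simps)
  then show ?thesis
    unfolding kern_def by (simp add: infsum_cnj [symmetric] del: infsum_cnj)
qed

lemma E_inner_in:
  assumes \<xi>: "\<xi> \<in> Xi_inf" and \<eta>: "\<eta> \<in> Xi_inf" and \<mu>: "\<mu> \<noteq> 0"
  shows "E_inner c \<mu> \<nu> \<xi> \<eta> \<in> E_alg c \<mu> \<nu>"
proof -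
  let ?T = "E_inner c \<mu> \<nu> \<xi> \<eta>"
  have eq: "?T \<zeta> = xi_act \<mu> \<nu> \<xi> (xi_inner c \<mu> \<nu> \<eta> \<zeta>)" if "\<zeta> \<in> Xi_inf" for \<zeta>
    using that by (simp add: E_inner_def)
  have in_Xi: "?T \<zeta> \<in> Xi_inf" if "\<zeta> \<in> Xi_inf" for \<zeta>
    using that by (simp add: eq xi_act_in [OF \<xi> xi_inner_in [OF \<eta> that \<mu>]])
  \<comment> \<open>Linearity over the algebra is verified on kernels: the phase from the
    quasi-periodicity of \<open>a\<close> under x \<mapsto> x + k is exactly the one in
    \<open>kern_shift\<close>.\<close>
  have lin: "?T (xi_act \<mu> \<nu> \<zeta> a) = xi_act \<mu> \<nu> (?T \<zeta>) a"
    if \<zeta>: "\<zeta> \<in> Xi_inf" and a: "a \<in> D_inf c \<nu>" for \<zeta> a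
  proof (intro ext)
    fix x y
    obtain D where D: "0 \<le> D" "\<And>x y k. norm (kern c \<mu> \<nu> \<xi> \<eta> x y k) \<le> D * (1 + \<bar>x\<bar>)\<^sup>2 * invsq k"
      using kern_bound [OF \<xi> \<eta> \<mu>] by blast
    have s: "schwartz \<zeta>" using \<zeta> by (simp add: Xi_inf_iff)
    obtain A where A: "\<And>p x y. True \<Longrightarrow>
        ((1 + \<bar>of_int p\<bar>) * (1 + \<bar>x\<bar>))\<^sup>2 * norm (dd [] (act_term \<mu> \<nu> \<zeta> a p) x y) \<le> A"
      using tame_bound [OF tame_act_term [OF s a]] by blast
    have A': "norm (act_term \<mu> \<nu> \<zeta> a p x y) \<le> A * invsq p" for p x y
    proof (rule le_invsqI)
      have "(1 + \<bar>of_int p\<bar>)\<^sup>2 * norm (act_term \<mu> \<nu> \<zeta> a p x y)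
          \<le> ((1 + \<bar>of_int p\<bar>) * (1 + \<bar>x\<bar>))\<^sup>2 * norm (act_term \<mu> \<nu> \<zeta> a p x y)"
        using mult_left_mono [of 1 "1 + \<bar>x\<bar>" "1 + \<bar>real_of_int p\<bar>"]
        by (intro mult_right_mono power_mono) auto
      also have "\<dots> \<le> A" using A by simp
      finally show "(1 + \<bar>of_int p\<bar>)\<^sup>2 * norm (act_term \<mu> \<nu> \<zeta> a p x y) \<le> A" .
    qed
    have "?T (xi_act \<mu> \<nu> \<zeta> a) x y
        = (\<Sum>\<^sub>\<infinity>k. \<Sum>\<^sub>\<infinity>q. kern c \<mu> \<nu> \<xi> \<eta> x y k * act_term \<mu> \<nu> \<zeta> a q (x + of_int k) y)"
      unfolding E_inner_kern [OF \<xi> \<eta> xi_act_in [OF \<zeta> a] \<mu>] by (simp add: xi_act_eq infsum_cmult_right')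
    also have "\<dots> = (\<Sum>\<^sub>\<infinity>q. \<Sum>\<^sub>\<infinity>k. kern c \<mu> \<nu> \<xi> \<eta> x y k * act_term \<mu> \<nu> \<zeta> a q (x + of_int k) y)"
    proof (rule infsum_swap_int)
      fix k q
      have "norm (kern c \<mu> \<nu> \<xi> \<eta> x y k * act_term \<mu> \<nu> \<zeta> a q (x + of_int k) y)
          \<le> (D * (1 + \<bar>x\<bar>)\<^sup>2 * invsq k) * (A * invsq q)"
        unfolding norm_mult by (intro mult_mono D A' mult_nonneg_nonneg) auto
      then show "norm (kern c \<mu> \<nu> \<xi> \<eta> x y k * act_term \<mu> \<nu> \<zeta> a q (x + of_int k) y)
          \<le> (D * (1 + \<bar>x\<bar>)\<^sup>2 * A) * invsq k * invsq q"
        by (simp only: mult_ac)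
    qed
    also have "\<dots> = (\<Sum>\<^sub>\<infinity>q. act_term \<mu> \<nu> (?T \<zeta>) a q x y)"
    proof (rule infsum_cong)
      fix q
      let ?x = "x + 2 * of_int q * \<mu>" and ?y = "y + 2 * of_int q * \<nu>"
      have "kern c \<mu> \<nu> \<xi> \<eta> x y k * act_term \<mu> \<nu> \<zeta> a q (x + of_int k) y
          = cnj (a ?x ?y q) * (kern c \<mu> \<nu> \<xi> \<eta> ?x ?y k * \<zeta> (?x + of_int k) ?y)" for k
      proof -
        have e: "x + of_int k + 2 * of_int q * \<mu> = ?x + of_int k" by simp
        have "a (?x + of_int k) ?y q = ee (of_nat c * of_int k * of_int q * (?y - of_int q * \<nu>)) * a ?x ?y q"
          using a by (simp add: D_inf_def)
        then have "cnj (a (?x + of_int k) ?y q)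
            = ee (- of_nat c * of_int k * of_int q * (y + of_int q * \<nu>)) * cnj (a ?x ?y q)"
          by (simp add: cnj_ee algebra_simps)
        then show ?thesis
          unfolding act_term_def e kern_shift by (simp only: mult_ac)
      qed
      then show "(\<Sum>\<^sub>\<infinity>k. kern c \<mu> \<nu> \<xi> \<eta> x y k * act_term \<mu> \<nu> \<zeta> a q (x + of_int k) y)
          = act_term \<mu> \<nu> (?T \<zeta>) a q x y"
        by (simp add: infsum_cmult_right' act_term_def E_inner_kern [OF \<xi> \<eta> \<zeta> \<mu>])
    qed
    finally show "?T (xi_act \<mu> \<nu> \<zeta> a) x y = xi_act \<mu> \<nu> (?T \<zeta>) a x y"
      by (simp add: xi_act_eq)
  qed
  have add: "?T (f + g) = ?T f + ?T g" if "f \<in> Xi_inf" "g \<in> Xi_inf" for f g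
    using that by (simp add: eq Xi_inf_plus xi_inner_plus_right [OF _ _ \<eta> \<mu>]
        xi_act_plus_right [OF \<xi> xi_inner_in xi_inner_in] \<eta> \<mu>)
  have scale: "?T (xi_scale l f) = xi_scale l (?T f)" if "f \<in> Xi_inf" for f l
    using that by (simp add: eq Xi_inf_scale xi_inner_scale_right xi_act_scale_right)
  show ?thesis
    using in_Xi lin add scale by (auto simp: E_alg_def E_inner_def)
qed

text \<open>Both sides are double sums over pairs \<open>(m, n)\<close>. By
  \<open>kern_shift\<close> and \<open>cnj_kern\<close> the terms coincide, so only the order of
  summation has to be exchanged.\<close>

lemma E_inner_adjoint:
  assumes a: "a \<in> Xi_inf" and b: "b \<in> Xi_inf" and \<xi>: "\<xi> \<in> Xi_inf" and \<eta>: "\<eta> \<in> Xi_inf" and \<mu>: "\<mu> \<noteq> 0"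
  shows "xi_inner c \<mu> \<nu> (E_inner c \<mu> \<nu> a b \<xi>) \<eta> = xi_inner c \<mu> \<nu> \<xi> (E_inner c \<mu> \<nu> b a \<eta>)"
proof (intro ext)
  fix x y p
  define E where "E = (\<lambda>m. cnj (ee (of_nat c * of_int m * of_int p * (y - of_int p * \<nu>))))"
  let ?x = "x - 2 * of_int p * \<mu>" and ?y = "y - 2 * of_int p * \<nu>"
  let ?L = "\<lambda>m n. E m * kern c \<mu> \<nu> a b (x + of_int m) y (n - m) * \<xi> (x + of_int n) y * cnj (\<eta> (?x + of_int m) ?y)"
  let ?R = "\<lambda>n m. E n * \<xi> (x + of_int n) y * cnj (kern c \<mu> \<nu> b a (?x + of_int n) ?y (m - n) * \<eta> (?x + of_int m) ?y)"
  \<comment> \<open>The index is recentred by k = n - m, so that the argument x + m + k becomes x +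
    n and both sides run over the same pairs.\<close>
  have sh: "E_inner c \<mu> \<nu> f g h x' y' = (\<Sum>\<^sub>\<infinity>n. kern c \<mu> \<nu> f g x' y' (n - m) * h (x' - of_int m + of_int n) y')"
    if "f \<in> Xi_inf" "g \<in> Xi_inf" "h \<in> Xi_inf" for f g h x' y' m
    unfolding E_inner_kern [OF that \<mu>]
    using infsum_int_shift [of "\<lambda>k. kern c \<mu> \<nu> f g x' y' k * h (x' + of_int k) y'" "- m"]
    by (simp add: algebra_simps)
  have 1: "inner_term c \<mu> \<nu> (E_inner c \<mu> \<nu> a b \<xi>) \<eta> p m x y = (\<Sum>\<^sub>\<infinity>n. ?L m n)" for m
    unfolding inner_term_def E_def sh [OF a b \<xi>, of _ _ m]
    by (simp add: infsum_cmult_right' [symmetric] infsum_cmult_left' [symmetric] mult_ac)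
  have 2: "inner_term c \<mu> \<nu> \<xi> (E_inner c \<mu> \<nu> b a \<eta>) p n x y = (\<Sum>\<^sub>\<infinity>m. ?R n m)" for n
    unfolding inner_term_def E_def sh [OF b a \<eta>, of _ _ n]
    by (simp add: infsum_cmult_right' [symmetric] infsum_cnj [symmetric] mult_ac del: infsum_cnj)
  have eq: "?L m n = ?R n m" for m n
  proof -
    have k: "kern c \<mu> \<nu> b a (?x + of_int n) ?y (m - n)
        = ee (of_nat c * of_int (m - n) * of_int p * (y - of_int p * \<nu>)) * kern c \<mu> \<nu> b a (x + of_int n) y (m - n)"
      using kern_shift [of c \<mu> \<nu> b a "x + of_int n" "- p" y "m - n"] by (simp add: algebra_simps)
    have "cnj (kern c \<mu> \<nu> b a (x + of_int n) y (m - n)) = kern c \<mu> \<nu> a b (x + of_int m) y (n - m)"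
      using cnj_kern [of c \<mu> \<nu> b a "x + of_int m" "n - m" y] by simp
    moreover have "E n * cnj (ee (of_nat c * of_int (m - n) * of_int p * (y - of_int p * \<nu>))) = E m"
      unfolding E_def cnj_ee ee_add [symmetric]
      by (rule arg_cong [where f = ee]) (simp add: algebra_simps)
    ultimately show ?thesis
      unfolding k by (simp add: mult_ac)
  qed
  obtain D where D: "0 \<le> D" "\<And>x y k. norm (kern c \<mu> \<nu> a b x y k) \<le> D * (1 + \<bar>x\<bar>)\<^sup>2 * invsq k"
    using kern_bound [OF a b \<mu>] by blast
  obtain A where A: "0 \<le> A" "\<And>x y k. norm (\<xi> (x + of_int k) y) \<le> A * (1 + \<bar>x\<bar>)\<^sup>2 * invsq k"
    using Xi_inf_translate_int [OF \<xi>] by blast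
  \<comment> \<open>Fourth order: two powers compensate the growth of the kernel at x + m, the other
    two make the sum over m converge.\<close>
  obtain B where B: "0 \<le> B" "\<And>x y z. (1 + \<bar>z\<bar>) ^ 4 * norm (\<eta> (x + z) y) \<le> B * (1 + \<bar>x\<bar>) ^ 4"
    using Xi_inf_translate [OF \<eta>] by blast
  have "xi_inner c \<mu> \<nu> (E_inner c \<mu> \<nu> a b \<xi>) \<eta> x y p = (\<Sum>\<^sub>\<infinity>m. \<Sum>\<^sub>\<infinity>n. ?L m n)"
    by (simp add: xi_inner_eq 1)
  also have "\<dots> = (\<Sum>\<^sub>\<infinity>n. \<Sum>\<^sub>\<infinity>m. ?L m n)"
  proof (rule infsum_swap_int)
    fix m n
    let ?m = "1 + \<bar>real_of_int m\<bar>"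
    have k1: "invsq k \<le> 1" for k by (simp add: invsq_def divide_simps)
    have "norm (kern c \<mu> \<nu> a b (x + of_int m) y (n - m)) \<le> D * (1 + \<bar>x + of_int m\<bar>)\<^sup>2 * 1"
      by (intro order_trans [OF D(2)] mult_left_mono k1 mult_nonneg_nonneg D) auto
    also have "\<dots> \<le> D * ((1 + \<bar>x\<bar>) * ?m)\<^sup>2 * 1"
      using peetre [of "x + of_int m" "- of_int m"]
      by (intro mult_right_mono mult_left_mono power_mono D) (auto simp: mult.commute)
    finally have K: "norm (kern c \<mu> \<nu> a b (x + of_int m) y (n - m)) \<le> D * (1 + \<bar>x\<bar>)\<^sup>2 * ?m\<^sup>2"
      by (simp add: power_mult_distrib mult_ac)
    have H: "?m\<^sup>2 * norm (\<eta> (?x + of_int m) ?y) \<le> (B * (1 + \<bar>?x\<bar>) ^ 4) * invsq m"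
    proof (rule le_invsqI)
      show "?m\<^sup>2 * (?m\<^sup>2 * norm (\<eta> (?x + of_int m) ?y)) \<le> B * (1 + \<bar>?x\<bar>) ^ 4"
        using B(2) [of "of_int m" ?x ?y] by (simp add: mult.assoc [symmetric] power_add [symmetric])
    qed
    have "norm (?L m n) = norm (kern c \<mu> \<nu> a b (x + of_int m) y (n - m)) * norm (\<xi> (x + of_int n) y)
        * norm (\<eta> (?x + of_int m) ?y)"
      by (simp add: norm_mult E_def)
    also have "\<dots> \<le> (D * (1 + \<bar>x\<bar>)\<^sup>2 * ?m\<^sup>2) * (A * (1 + \<bar>x\<bar>)\<^sup>2 * invsq n) * norm (\<eta> (?x + of_int m) ?y)"
      by (intro mult_right_mono mult_mono K A mult_nonneg_nonneg D) auto
    also have "\<dots> = (D * (1 + \<bar>x\<bar>)\<^sup>2 * A * (1 + \<bar>x\<bar>)\<^sup>2 * invsq n) * (?m\<^sup>2 * norm (\<eta> (?x + of_int m) ?y))"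
      by (simp only: mult_ac)
    also have "\<dots> \<le> (D * (1 + \<bar>x\<bar>)\<^sup>2 * A * (1 + \<bar>x\<bar>)\<^sup>2 * invsq n) * ((B * (1 + \<bar>?x\<bar>) ^ 4) * invsq m)"
      by (intro mult_left_mono H mult_nonneg_nonneg D A) auto
    finally show "norm (?L m n)
        \<le> (D * (1 + \<bar>x\<bar>)\<^sup>2 * A * (1 + \<bar>x\<bar>)\<^sup>2 * (B * (1 + \<bar>?x\<bar>) ^ 4)) * invsq m * invsq n"
      by (simp only: mult_ac)
  qed
  also have "\<dots> = (\<Sum>\<^sub>\<infinity>n. \<Sum>\<^sub>\<infinity>m. ?R n m)"
    unfolding eq ..
  also have "\<dots> = xi_inner c \<mu> \<nu> \<xi> (E_inner c \<mu> \<nu> b a \<eta>) x y p"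
    by (simp only: xi_inner_eq 2)
  finally show "xi_inner c \<mu> \<nu> (E_inner c \<mu> \<nu> a b \<xi>) \<eta> x y p
      = xi_inner c \<mu> \<nu> \<xi> (E_inner c \<mu> \<nu> b a \<eta>) x y p" .
qed

subsection \<open>Integration over the torus\<close>

definition torus_integral :: "xi \<Rightarrow> complex" where
  "torus_integral f = integral (cbox (0, 0) (1, 1)) (\<lambda>(x, y). f x y)"

lemma D_inf_continuous: "a \<in> D_inf c \<nu> \<Longrightarrow> continuous_on A (\<lambda>(x, y). a x y p)"
  using smooth_continuous [OF D_inf_smooth] by blast

text \<open>On continuous functions the Lebesgue and the gauge integral agree. The latter is used
  from here on, with the fundamental theorem, iterated integrals and uniform limits.\<close>

lemma trace_D_eq:
  assumes "a \<in> D_inf c \<nu>"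
  shows "trace_D a = torus_integral (\<lambda>x y. a x y 0)"
proof -
  have "set_integrable lborel (cbox (0, 0) (1, 1)) (\<lambda>(x, y). a x y 0)"
    unfolding set_integrable_def
    by (rule borel_integrable_compact) (auto intro: D_inf_continuous [OF assms])
  then show ?thesis
    unfolding trace_D_def torus_integral_def by (rule set_borel_integral_eq_integral)
qed

lemma torus_integral_add:
  assumes "continuous_on UNIV (\<lambda>(x, y). f x y)" "continuous_on UNIV (\<lambda>(x, y). g x y)"
  shows "torus_integral (\<lambda>x y. f x y + g x y) = torus_integral f + torus_integral g"
proof -
  have "(\<lambda>(x, y). f x y) integrable_on cbox (0, 0) (1, 1)" "(\<lambda>(x, y). g x y) integrable_on cbox (0, 0) (1, 1)"
    using assms continuous_on_subset by (blast intro: integrable_continuous)+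
  from integral_add [OF this] show ?thesis
    unfolding torus_integral_def by (simp add: case_prod_unfold)
qed

lemma torus_integral_cmult: "torus_integral (\<lambda>x y. l * f x y) = l * torus_integral f"
  unfolding torus_integral_def by (simp add: case_prod_unfold)

lemma trace_D_plus:
  assumes "a \<in> D_inf c \<nu>" "b \<in> D_inf c \<nu>" "a + b \<in> D_inf c \<nu>"
  shows "trace_D (a + b) = trace_D a + trace_D b"
  using torus_integral_add [OF D_inf_continuous [OF assms(1)] D_inf_continuous [OF assms(2)], of 0 0]
  by (simp add: trace_D_eq [OF assms(1)] trace_D_eq [OF assms(2)] trace_D_eq [OF assms(3)])

lemma trace_D_cmult: "trace_D (\<lambda>x y p. l * a x y p) = l * trace_D a"
  unfolding trace_D_def case_prod_unfold by simp

lemma integral_periodic_shift: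
  fixes g :: "real \<Rightarrow> complex"
  assumes c: "continuous_on UNIV g" and p: "\<And>y. g (y + 1) = g y"
  shows "integral {0..1} (\<lambda>y. g (y + r)) = integral {0..1} g"
proof -
  define s where "s = frac r"
  have s: "0 \<le> s" "s \<le> 1" by (simp_all add: s_def frac_lt_1 less_imp_le)
  have int: "g integrable_on {a..b}" for a b
    by (intro integrable_continuous_interval continuous_on_subset [OF c]) auto
  have sh: "integral {a..b} (\<lambda>y. g (y + t)) = integral {a + t..b + t} g" for a b t
    using integral_shift_real_ivl [of "a + t" t "b + t" g] by simp
  have "g (y + r) = g (y + s)" for y
    using periodic_int [of g, OF p, of "y + s" "\<lfloor>r\<rfloor>"] by (simp add: s_def frac_def)
  then have "integral {0..1} (\<lambda>y. g (y + r)) = integral {s..1 + s} g"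
    using sh [of 0 1 s] by simp
  also have "\<dots> = integral {s..1} g + integral {1..1 + s} g"
    by (rule Henstock_Kurzweil_Integration.integral_combine [symmetric]) (use s int in auto)
  also have "integral {1..1 + s} g = integral {0..s} g"
    using sh [of 0 s 1] p by (simp add: add.commute)
  also have "integral {s..1} g + integral {0..s} g = integral {0..1} g"
    using Henstock_Kurzweil_Integration.integral_combine [of 0 s 1 g] s int by (simp add: add.commute)
  finally show ?thesis .
qed

lemma torus_integral_iterated:
  assumes "continuous_on UNIV (\<lambda>(x, y). f x y)"
  shows "torus_integral f = integral {0..1} (\<lambda>x. integral {0..1} (f x))"
    and "torus_integral f = integral {0..1} (\<lambda>y. integral {0..1} (\<lambda>x. f x y))"
proof -
  have c: "continuous_on (cbox (0, 0) (1, 1)) (\<lambda>(x, y). f x y)"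
    using assms continuous_on_subset by blast
  show 1: "torus_integral f = integral {0..1} (\<lambda>x. integral {0..1} (f x))"
    unfolding torus_integral_def integral_prod_continuous [OF c] by simp
  show "torus_integral f = integral {0..1} (\<lambda>y. integral {0..1} (\<lambda>x. f x y))"
    unfolding 1 using integral_swap_continuous [OF c] by simp
qed

lemma continuous_on_slice:
  fixes f :: xi
  assumes "continuous_on UNIV (\<lambda>(x, y). f x y)"
  shows "continuous_on A (\<lambda>y. f x y)" "continuous_on A (\<lambda>x. f x y)"
proof -
  have "continuous_on A (\<lambda>y. (x, y))" "continuous_on A (\<lambda>x. (x, y))"
    by (intro continuous_intros)+
  then show "continuous_on A (\<lambda>y. f x y)" "continuous_on A (\<lambda>x. f x y)"
    using continuous_on_compose2 [OF assms, of A "\<lambda>y. (x, y)"]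
      continuous_on_compose2 [OF assms, of A "\<lambda>x. (x, y)"] by simp_all
qed

lemma torus_integral_shift:
  assumes c: "continuous_on UNIV (\<lambda>(x, y). f x y)"
    and p: "\<And>x y. f (x + 1) y = f x y" "\<And>x y. f x (y + 1) = f x y"
  shows "torus_integral (\<lambda>x y. f (x + s) (y + r)) = torus_integral f"
proof -
  have "torus_integral (\<lambda>x y. f (x + s) (y + r))
      = integral {0..1} (\<lambda>x. integral {0..1} (\<lambda>y. f (x + s) (y + r)))"
    by (rule torus_integral_iterated(1) [OF continuous_on_shift2 [OF c]])
  also have "\<dots> = integral {0..1} (\<lambda>x. integral {0..1} (f (x + s)))"
    by (intro integral_cong integral_periodic_shift continuous_on_slice(1) c p)
  also have "\<dots> = torus_integral (\<lambda>x y. f (x + s) (y + 0))"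
    using torus_integral_iterated(1) [OF continuous_on_shift2 [OF c, of s 0]] by simp
  also have "\<dots> = integral {0..1} (\<lambda>y. integral {0..1} (\<lambda>x. f (x + s) (y + 0)))"
    by (rule torus_integral_iterated(2) [OF continuous_on_shift2 [OF c]])
  also have "\<dots> = integral {0..1} (\<lambda>y. integral {0..1} (\<lambda>x. f x (y + 0)))"
    by (intro integral_cong integral_periodic_shift continuous_on_slice(2) c p)
  also have "\<dots> = torus_integral f"
    using torus_integral_iterated(2) [OF c] by simp
  finally show ?thesis .
qed

text \<open>The majorant is required for x in the unit interval only, since uniform convergence on
  the square of integration is enough.\<close>

lemma torus_integral_infsum:
  assumes c: "\<And>p. continuous_on UNIV (\<lambda>(x, y). h p x y)"
    and le: "\<And>p x y. 0 \<le> x \<Longrightarrow> x \<le> 1 \<Longrightarrow> norm (h p x y) \<le> C * invsq p"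
  shows "torus_integral (\<lambda>x y. \<Sum>\<^sub>\<infinity>p. h p x y) = (\<Sum>\<^sub>\<infinity>p. torus_integral (h p))"
proof -
  let ?B = "cbox (0, 0) (1, 1) :: (real \<times> real) set"
  let ?h = "\<lambda>p (x, y). h p x y"
  have cB: "continuous_on ?B (?h p)" for p
    using c continuous_on_subset by blast
  have u: "uniform_limit ?B (\<lambda>X z. \<Sum>p\<in>X. ?h p z) (\<lambda>z. \<Sum>\<^sub>\<infinity>p. ?h p z) (finite_subsets_at_top UNIV)"
    by (rule Weierstrass_m_test_general [OF _ summable_on_cmult_right [OF summable_invsq]])
      (use le in \<open>auto simp: cbox_Pair_eq\<close>)
  have cs: "continuous_on ?B (\<lambda>z. \<Sum>p\<in>X. ?h p z)" for X
    by (intro continuous_on_sum cB)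
  obtain I J where I: "\<And>X. ((\<lambda>z. \<Sum>p\<in>X. ?h p z) has_integral I X) ?B"
    and J: "((\<lambda>z. \<Sum>\<^sub>\<infinity>p. ?h p z) has_integral J) ?B" and lim: "(I \<longlongrightarrow> J) (finite_subsets_at_top UNIV)"
    by (rule uniform_limit_integral_cbox [OF u cs finite_subsets_at_top_neq_bot]) (rule that)
  have "I X = (\<Sum>p\<in>X. torus_integral (h p))" if "finite X" for X
  proof -
    have "integral ?B (\<lambda>z. \<Sum>p\<in>X. ?h p z) = (\<Sum>p\<in>X. integral ?B (?h p))"
      by (rule integral_sum [OF that]) (rule integrable_continuous [OF cB])
    then show ?thesis
      using integral_unique [OF I [of X]] by (simp add: torus_integral_def)
  qed
  then have "((\<lambda>X. \<Sum>p\<in>X. torus_integral (h p)) \<longlongrightarrow> J) (finite_subsets_at_top UNIV)"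
    by (intro Lim_transform_eventually [OF lim] eventually_finite_subsets_at_top_weakI) auto
  then have "((\<lambda>p. torus_integral (h p)) has_sum J) UNIV"
    by (simp add: has_sum_def)
  moreover have "torus_integral (\<lambda>x y. \<Sum>\<^sub>\<infinity>p. h p x y) = J"
    using integral_unique [OF J] by (simp add: torus_integral_def case_prod_unfold)
  ultimately show ?thesis by (simp add: infsumI)
qed

text \<open>At p = 0 the phase is trivial, so the function is 1-periodic in x and the integral of
  its x-derivative over a period vanishes.\<close>

lemma trace_D_delta_X:
  assumes a: "a \<in> D_inf c \<nu>"
  shows "trace_D (delta c \<mu> X_heis a) = 0"
proof -
  let ?a = "\<lambda>x y. a x y 0"
  have sm: "smooth ?a" by (rule D_inf_smooth [OF a])
  have d: "delta c \<mu> X_heis a x y 0 = - 1 * pdx ?a x y" for x y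
    by (simp add: delta_def X_heis_def mat_unit_def)
  have "integral {0..1} (\<lambda>x. pdx ?a x y) = 0" for y
  proof -
    have "((\<lambda>x. pdx ?a x y) has_integral ?a 1 y - ?a 0 y) {0..1}"
      by (rule fundamental_theorem_of_calculus)
        (auto intro: has_vector_derivative_at_within has_pdx [OF smooth_diff2 [OF sm]])
    moreover have "a (0 + of_int 1) y 0 = a 0 y 0"
      using a by (simp only: D_inf_def mem_Collect_eq) simp
    ultimately show ?thesis by (simp add: integral_unique)
  qed
  then have "torus_integral (pdx ?a) = 0"
    using torus_integral_iterated(2) [OF smooth_continuous [OF smooth_pdx [OF sm]]] by simp
  then show ?thesis
    using torus_integral_cmult [of "-1" "pdx ?a"] by (simp add: trace_D_eq [OF delta_in [OF a]] d)
qed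

lemma trace_D_delta_Z: "trace_D (delta c \<mu> (Z_heis c) a) = 0"
proof -
  have "delta c \<mu> (Z_heis c) a x y 0 = 0" for x y
    by (simp add: delta_def Z_heis_def mat_unit_def)
  then show ?thesis
    by (simp add: trace_D_def case_prod_unfold)
qed

lemma xi_inner_0: "xi_inner c \<mu> \<nu> f g x y 0 = (\<Sum>\<^sub>\<infinity>k. f (x + of_int k) y * cnj (g (x + of_int k) y))"
  by (simp add: xi_inner_def)

lemma xi_inner_periodic:
  assumes "f \<in> Xi_inf" "g \<in> Xi_inf" "\<mu> \<noteq> 0"
  shows "xi_inner c \<mu> \<nu> f g (x + 1) y 0 = xi_inner c \<mu> \<nu> f g x y 0"
    and "xi_inner c \<mu> \<nu> f g x (y + 1) p = xi_inner c \<mu> \<nu> f g x y p"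
proof -
  have q: "quasi_periodic c \<nu> (xi_inner c \<mu> \<nu> f g)"
    using xi_inner_in [OF assms] by (simp add: D_inf_iff)
  show "xi_inner c \<mu> \<nu> f g x (y + 1) p = xi_inner c \<mu> \<nu> f g x y p"
    using q by (simp add: quasi_periodic_def)
  have "xi_inner c \<mu> \<nu> f g (x + of_int 1) y 0 = xi_inner c \<mu> \<nu> f g x y 0"
    using q unfolding quasi_periodic_def by (simp del: of_int_1)
  then show "xi_inner c \<mu> \<nu> f g (x + 1) y 0 = xi_inner c \<mu> \<nu> f g x y 0"
    by simp
qed

text \<open>At p = 0 the inner product of \<open>f\<close> with itself is the sum of |f(x + k, y)|^2
  over k, a continuous nonnegative function. If its integral over the square is zero it vanishes on
  the square, and then so does every translate of \<open>f\<close>.\<close>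

lemma trace_D_inner_pos:
  assumes f: "f \<in> Xi_inf" and \<mu>: "\<mu> \<noteq> 0"
  shows "trace_D (xi_inner c \<mu> \<nu> f f) \<in> \<real>\<^sub>\<ge>\<^sub>0"
    and "trace_D (xi_inner c \<mu> \<nu> f f) = 0 \<Longrightarrow> f = 0"
proof -
  let ?F = "\<lambda>x y. xi_inner c \<mu> \<nu> f f x y 0"
  let ?B = "cbox (0, 0) (1, 1) :: (real \<times> real) set"
  define h where "h = (\<lambda>(x, y). Re (?F x y))"
  have in_D: "xi_inner c \<mu> \<nu> f f \<in> D_inf c \<nu>" by (rule xi_inner_in [OF f f \<mu>])
  have s: "(\<lambda>k. f (x + of_int k) y * cnj (f (x + of_int k) y)) summable_on UNIV" for x y
    using summable_inner_term [OF f f \<mu>, of c \<nu> 0 x y] by (simp add: inner_term_def)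
  have hs: "((\<lambda>k. (norm (f (x + of_int k) y))\<^sup>2) has_sum Re (?F x y)) UNIV" for x y
    using has_sum_Re [OF has_sum_infsum [OF s [of x y]]]
    by (simp only: xi_inner_0 complex_norm_square [symmetric] Re_complex_of_real)
  have pos: "0 \<le> Re (?F x y)" for x y
    by (rule has_sum_nonneg [OF hs]) simp
  have re: "?F x y = of_real (Re (?F x y))" for x y
  proof -
    have "?F x y = (\<Sum>\<^sub>\<infinity>k. of_real ((norm (f (x + of_int k) y))\<^sup>2))"
      unfolding xi_inner_0 by (intro infsum_cong) (simp only: complex_norm_square)
    also have "\<dots> = of_real (Re (?F x y))"
      using has_sum_of_real [OF hs [of x y], where 'a = complex] by (simp add: infsumI)
    finally show ?thesis .
  qed
  have ch: "continuous_on ?B h"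
    using continuous_on_Re [OF D_inf_continuous [OF in_D, of ?B 0]]
    by (simp add: h_def case_prod_unfold)
  have h: "(h has_integral integral ?B h) ?B"
    using integrable_integral [OF integrable_continuous [OF ch]] .
  have "trace_D (xi_inner c \<mu> \<nu> f f) = integral ?B (\<lambda>z. of_real (h z))"
    unfolding trace_D_eq [OF in_D] torus_integral_def h_def
    by (intro integral_cong) (use re in auto)
  also have "\<dots> = of_real (integral ?B h)"
    by (rule integral_unique) (rule has_integral_of_real [OF h])
  finally have tr: "trace_D (xi_inner c \<mu> \<nu> f f) = of_real (integral ?B h)" .
  have "0 \<le> integral ?B h"
    by (rule integral_nonneg [OF integrable_continuous [OF ch]]) (auto simp: h_def pos)
  then show "trace_D (xi_inner c \<mu> \<nu> f f) \<in> \<real>\<^sub>\<ge>\<^sub>0"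
    by (simp add: tr)
  show "f = 0" if "trace_D (xi_inner c \<mu> \<nu> f f) = 0"
  proof (intro ext)
    fix x y :: real
    have "h (frac x, frac y) = 0"
    proof (rule has_integral_0_cbox_imp_0 [OF ch])
      show "(h has_integral 0) ?B" using h that tr by simp
      have "(1/2, 1/2) \<in> box (0, 0) (1 :: real, 1 :: real)" by (auto simp: mem_box Basis_prod_def)
      then show "box (0, 0) (1, 1) \<noteq> ({} :: (real \<times> real) set)" by blast
      show "(frac x, frac y) \<in> ?B" by (simp add: cbox_Pair_eq frac_lt_1 less_imp_le)
    qed (auto simp: h_def pos)
    then have "((\<lambda>k. (norm (f (frac x + of_int k) (frac y)))\<^sup>2) has_sum 0) UNIV"
      using hs [of "frac x" "frac y"] by (simp add: h_def)
    then have "(norm (f (frac x + of_int \<lfloor>x\<rfloor>) (frac y)))\<^sup>2 = 0"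
      by (rule nonneg_has_sum_le_0D [where A = UNIV]) auto
    then have "f x (frac y) = 0" by (simp add: frac_def)
    moreover have "f x (frac y + of_int \<lfloor>y\<rfloor>) = f x (frac y)"
      by (rule periodic_int) (use f in \<open>simp add: Xi_inf_iff\<close>)
    ultimately show "f x y = 0 x y" by (simp add: frac_def)
  qed
qed

section \<open>Products and translates in the module, and unfolding of torus integrals\<close>

lemma Xi_inf_mult:
  assumes f: "f \<in> Xi_inf" and g: "g \<in> Xi_inf" shows "(\<lambda>x y. f x y * g x y) \<in> Xi_inf"
proof -
  have "tame (\<lambda>i x. True) (\<lambda>i x. (1 + \<bar>x\<bar>) * (1 + \<bar>x\<bar>)) (\<lambda>i x. 1 * 1) (\<lambda>(i::unit) x y. f x y * g x y)"
    using f g by (intro tame_mult weight_1 weight_abs) (simp_all add: Xi_inf_iff schwartz_def)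
  then have "schwartz (\<lambda>x y. f x y * g x y)"
    unfolding schwartz_def
    by (rule tame_weights [where B = 1 and a = 1 and b = 1])
      ((intro weight_mult weight_abs weight_1)+, simp_all add: algebra_simps)
  with f g show ?thesis by (simp add: Xi_inf_iff)
qed

lemma Xi_inf_cnj: "f \<in> Xi_inf \<Longrightarrow> (\<lambda>x y. cnj (f x y)) \<in> Xi_inf"
  using tame_cnj [of _ _ _ "\<lambda>i::unit. f"] by (simp add: Xi_inf_iff schwartz_def)

lemma Xi_inf_shift:
  assumes f: "f \<in> Xi_inf" shows "(\<lambda>x y. f (x + s) (y + r)) \<in> Xi_inf"
proof -
  have "tame (\<lambda>i x. True) (\<lambda>i x. 1 + \<bar>x + s\<bar>) (\<lambda>i x. 1) (\<lambda>(i::unit) x y. f (x + s) (y + r))"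
    using f tame_shift [of "\<lambda>i x. True" "\<lambda>i x. 1 + \<bar>x\<bar>" "\<lambda>i x. 1" "\<lambda>i::unit. f" "\<lambda>i. s" "\<lambda>i. r"]
    by (simp add: Xi_inf_iff schwartz_def)
  then have "schwartz (\<lambda>x y. f (x + s) (y + r))"
    unfolding schwartz_def
  proof (rule tame_weights [where B = "1 + \<bar>s\<bar>" and a = 1 and b = 1])
    fix x :: real
    show "1 + \<bar>x\<bar> \<le> (1 + \<bar>s\<bar>) * (1 + \<bar>x + s\<bar>) ^ 1"
      using peetre [of x s] by (simp add: add.commute)
    show "1 \<le> (1 + \<bar>s\<bar>) * (1 + \<bar>x + s\<bar>) ^ 1 * 1 ^ 1"
      using mult_mono [of 1 "1 + \<bar>s\<bar>" 1 "1 + \<bar>x + s\<bar>"] by simp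
  qed (simp_all add: weight_abs weight_1)
  moreover have "f (x + s) (y + 1 + r) = f (x + s) (y + r)" for x y
    using f by (simp add: Xi_inf_iff add.assoc add.commute [of 1 r]) (simp add: add.assoc [symmetric])
  ultimately show ?thesis by (simp add: Xi_inf_iff)
qed

text \<open>Of four orders of decay of \<open>f\<close>, two cancel the factor (1 + |x + m|)^2 from
  the estimate of \<open>g\<close>, and two remain for the summation over m.\<close>

lemma product_bound:
  assumes f: "f \<in> Xi_inf" and g: "g \<in> Xi_inf" and \<mu>: "\<mu> \<noteq> 0"
  obtains D where "0 \<le> D" "\<And>x y y' m p. norm (f (x + of_int m) y) * norm (g (x + of_int m + 2 * of_int p * \<mu>) y')
      \<le> D * (1 + \<bar>x\<bar>)\<^sup>2 * invsq m * invsq p"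
proof -
  obtain F where F: "0 \<le> F" "\<And>x y. (1 + \<bar>x\<bar>) ^ 4 * norm (f x y) \<le> F"
    using Xi_inf_bound [OF f] by blast
  obtain C where C: "0 \<le> C" "\<And>x y p. norm (g (x + 2 * of_int p * \<mu>) y) \<le> C * (1 + \<bar>x\<bar>)\<^sup>2 * invsq p"
    using Xi_inf_translate_mu [OF g \<mu>] by blast
  have "norm (f (x + of_int m) y) * norm (g (x + of_int m + 2 * of_int p * \<mu>) y')
      \<le> (F * C) * (1 + \<bar>x\<bar>)\<^sup>2 * invsq m * invsq p" for x y y' m p
  proof -
    let ?z = "x + real_of_int m"
    have H: "norm (f ?z y) * (1 + \<bar>?z\<bar>)\<^sup>2 \<le> F * (1 + \<bar>x\<bar>)\<^sup>2 * invsq m"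
    proof (rule le_invsqI)
      have "(1 + \<bar>of_int m\<bar>)\<^sup>2 * (norm (f ?z y) * (1 + \<bar>?z\<bar>)\<^sup>2)
          \<le> ((1 + \<bar>x\<bar>) * (1 + \<bar>?z\<bar>))\<^sup>2 * (norm (f ?z y) * (1 + \<bar>?z\<bar>)\<^sup>2)"
        by (intro mult_right_mono power_mono peetre) auto
      also have "\<dots> = (1 + \<bar>x\<bar>)\<^sup>2 * ((1 + \<bar>?z\<bar>) ^ 4 * norm (f ?z y))"
        by (simp add: power_mult_distrib power2_eq_square power4_eq_xxxx mult_ac)
      also have "\<dots> \<le> (1 + \<bar>x\<bar>)\<^sup>2 * F"
        by (intro mult_left_mono F) simp
      finally show "(1 + \<bar>of_int m\<bar>)\<^sup>2 * (norm (f ?z y) * (1 + \<bar>?z\<bar>)\<^sup>2) \<le> F * (1 + \<bar>x\<bar>)\<^sup>2"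
        by (simp add: mult.commute)
    qed
    have "norm (f ?z y) * norm (g (?z + 2 * of_int p * \<mu>) y') \<le> norm (f ?z y) * (C * (1 + \<bar>?z\<bar>)\<^sup>2 * invsq p)"
      by (intro mult_left_mono C) simp
    also have "\<dots> = (norm (f ?z y) * (1 + \<bar>?z\<bar>)\<^sup>2) * (C * invsq p)"
      by (simp only: mult_ac)
    also have "\<dots> \<le> (F * (1 + \<bar>x\<bar>)\<^sup>2 * invsq m) * (C * invsq p)"
      by (intro mult_right_mono H mult_nonneg_nonneg C) simp
    finally show ?thesis by (simp only: mult_ac)
  qed
  then show ?thesis using that [of "F * C"] F C by simp
qed

text \<open>
  Unfolding: with \<open>W\<close> a partition of unity for translation by \<open>2 * \<mu>\<close> in the first variable, summing
  the translates of \<open>W * G(\<cdot> + 2p\<mu>, \<cdot> + 2p\<nu>)\<close> and moving the translation over to \<open>W\<close> gives the integral of \<open>G\<close>.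
\<close>

lemma torus_integral_unfold:
  assumes W: "W \<in> Xi_inf" and G: "G \<in> Xi_inf" and \<mu>: "\<mu> \<noteq> 0"
    and one: "\<And>x y. (\<Sum>\<^sub>\<infinity>p. W (x + 2 * of_int p * \<mu>) y) = 1"
    and Wy: "\<And>x y y'. W x y = W x y'"
  shows "torus_integral (\<lambda>x y. \<Sum>\<^sub>\<infinity>m. W (x + of_int m) y *
        (\<Sum>\<^sub>\<infinity>p. G (x + of_int m + 2 * of_int p * \<mu>) (y + 2 * of_int p * \<nu>)))
    = torus_integral (\<lambda>x y. \<Sum>\<^sub>\<infinity>m. G (x + of_int m) y)"
proof -
  define A where "A = (\<lambda>p x y. \<Sum>\<^sub>\<infinity>m. W (x + of_int m) y * G (x + of_int m + 2 * of_int p * \<mu>) (y + 2 * of_int p * \<nu>))"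
  define B where "B = (\<lambda>p x y. \<Sum>\<^sub>\<infinity>m. W (x + of_int m - 2 * of_int p * \<mu>) y * G (x + of_int m) y)"
  let ?G = "\<lambda>x y. cnj (G x y)"
  have G': "?G \<in> Xi_inf" by (rule Xi_inf_cnj [OF G])
  \<comment> \<open>Reading these sums as inner products at p = 0, with the parameter
    \<open>c\<close> set to 0, gives their continuity and periodicity without further work.\<close>
  have A: "A p x y = xi_inner 0 \<mu> \<nu> W (\<lambda>x y. ?G (x + 2 * of_int p * \<mu>) (y + 2 * of_int p * \<nu>)) x y 0" for p x y
    by (simp add: A_def xi_inner_0)
  have B: "B p x y = xi_inner 0 \<mu> \<nu> (\<lambda>x y. W (x + (- 2 * of_int p * \<mu>)) (y + 0)) ?G x y 0" for p x y
    by (simp add: B_def xi_inner_0)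
  have cA: "continuous_on UNIV (\<lambda>(x, y). A p x y)" and cB: "continuous_on UNIV (\<lambda>(x, y). B p x y)" for p
    unfolding A B by (rule D_inf_continuous [OF xi_inner_in]; intro Xi_inf_shift W G' \<mu>)+
  \<comment> \<open>Moving the translation to the other factor needs \<open>W\<close> to be
    invariant in y, since the shift by 2p\<nu> acts there as well.\<close>
  have AB: "A p x y = B p (x + 2 * of_int p * \<mu>) (y + 2 * of_int p * \<nu>)" for p x y
    unfolding A_def B_def
  proof (rule infsum_cong)
    fix m
    have e: "x + 2 * of_int p * \<mu> + of_int m = x + of_int m + 2 * of_int p * \<mu>"
      "x + of_int m + 2 * of_int p * \<mu> - 2 * of_int p * \<mu> = x + of_int m" by simp_all
    show "W (x + of_int m) y * G (x + of_int m + 2 * of_int p * \<mu>) (y + 2 * of_int p * \<nu>)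
      = W (x + 2 * of_int p * \<mu> + of_int m - 2 * of_int p * \<mu>) (y + 2 * of_int p * \<nu>)
        * G (x + 2 * of_int p * \<mu> + of_int m) (y + 2 * of_int p * \<nu>)"
      unfolding e by (subst Wy [of _ y "y + 2 * of_int p * \<nu>"]) (rule refl)
  qed
  obtain D where D: "0 \<le> D" "\<And>x y y' m p. norm (W (x + of_int m) y) * norm (G (x + of_int m + 2 * of_int p * \<mu>) y')
      \<le> D * (1 + \<bar>x\<bar>)\<^sup>2 * invsq m * invsq p"
    using product_bound [OF W G \<mu>] by blast
  obtain D' where D': "0 \<le> D'" "\<And>x y y' m p. norm (G (x + of_int m) y) * norm (W (x + of_int m + 2 * of_int p * \<mu>) y')
      \<le> D' * (1 + \<bar>x\<bar>)\<^sup>2 * invsq m * invsq p"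
    using product_bound [OF G W \<mu>] by blast
  have inv: "invsq (- p) = invsq p" for p by (simp add: invsq_def)
  let ?I = "\<Sum>\<^sub>\<infinity>m. invsq m"
  have tA: "norm (W (x + of_int m) y * G (x + of_int m + 2 * of_int p * \<mu>) (y + 2 * of_int p * \<nu>))
      \<le> (D * (1 + \<bar>x\<bar>)\<^sup>2) * invsq m * invsq p" for x y m p
    using D(2) [of x m y p] by (simp add: norm_mult)
  have tB: "norm (W (x + of_int m - 2 * of_int p * \<mu>) y * G (x + of_int m) y)
      \<le> (D' * (1 + \<bar>x\<bar>)\<^sup>2) * invsq m * invsq p" for x y m p
    using D'(2) [of x m y "- p" y] by (simp add: norm_mult inv mult.commute)
  have four: "(1 + \<bar>x\<bar>)\<^sup>2 \<le> 4" if "0 \<le> x" "x \<le> 1" for x :: real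
    using power_mono [of "1 + x" 2 2] that by simp
  have bA: "norm (A p x y) \<le> (D * 4 * ?I) * invsq p" and bB: "norm (B p x y) \<le> (D' * 4 * ?I) * invsq p"
    if x: "0 \<le> x" "x \<le> 1" for p x y
  proof -
    have "norm (A p x y) \<le> (D * 4 * invsq p) * ?I"
      unfolding A_def
    proof (rule norm_infsum_invsq)
      fix m
      have "(D * (1 + \<bar>x\<bar>)\<^sup>2) * invsq m * invsq p \<le> (D * 4) * invsq m * invsq p"
        by (intro mult_right_mono mult_left_mono four x D) auto
      with tA [of x m y p] show "norm (W (x + of_int m) y * G (x + of_int m + 2 * of_int p * \<mu>) (y + 2 * of_int p * \<nu>))
          \<le> D * 4 * invsq p * invsq m"
        by (simp only: mult_ac)
    qed
    then show "norm (A p x y) \<le> (D * 4 * ?I) * invsq p" by (simp only: mult_ac)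
    have "norm (B p x y) \<le> (D' * 4 * invsq p) * ?I"
      unfolding B_def
    proof (rule norm_infsum_invsq)
      fix m
      have "(D' * (1 + \<bar>x\<bar>)\<^sup>2) * invsq m * invsq p \<le> (D' * 4) * invsq m * invsq p"
        by (intro mult_right_mono mult_left_mono four x D') auto
      with tB [of x m p y] show "norm (W (x + of_int m - 2 * of_int p * \<mu>) y * G (x + of_int m) y)
          \<le> D' * 4 * invsq p * invsq m"
        by (simp only: mult_ac)
    qed
    then show "norm (B p x y) \<le> (D' * 4 * ?I) * invsq p" by (simp only: mult_ac)
  qed
  have "(\<Sum>\<^sub>\<infinity>m. W (x + of_int m) y * (\<Sum>\<^sub>\<infinity>p. G (x + of_int m + 2 * of_int p * \<mu>) (y + 2 * of_int p * \<nu>)))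
      = (\<Sum>\<^sub>\<infinity>p. A p x y)" for x y
    unfolding A_def infsum_cmult_right' [symmetric] by (rule infsum_swap_int [OF tA])
  moreover have "(\<Sum>\<^sub>\<infinity>p. B p x y) = (\<Sum>\<^sub>\<infinity>m. G (x + of_int m) y)" for x y
  proof -
    have "(\<Sum>\<^sub>\<infinity>p. B p x y) = (\<Sum>\<^sub>\<infinity>m. \<Sum>\<^sub>\<infinity>p. W (x + of_int m - 2 * of_int p * \<mu>) y * G (x + of_int m) y)"
      unfolding B_def by (rule infsum_swap_int [symmetric]) (rule tB)
    also have "\<dots> = (\<Sum>\<^sub>\<infinity>m. G (x + of_int m) y)"
    proof (rule infsum_cong)
      fix m
      have "(\<Sum>\<^sub>\<infinity>p. W (x + of_int m - 2 * of_int p * \<mu>) y)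
          = (\<Sum>\<^sub>\<infinity>p. W (x + of_int m + 2 * of_int p * \<mu>) y)"
        using infsum_reindex_bij_betw [of uminus UNIV UNIV "\<lambda>p::int. W (x + of_int m + 2 * of_int p * \<mu>) y"]
        by (simp add: bij_uminus)
      then show "(\<Sum>\<^sub>\<infinity>p. W (x + of_int m - 2 * of_int p * \<mu>) y * G (x + of_int m) y) = G (x + of_int m) y"
        using one by (simp add: infsum_cmult_left')
    qed
    finally show ?thesis .
  qed
  moreover have "torus_integral (A p) = torus_integral (B p)" for p
    unfolding AB [abs_def]
  proof (rule torus_integral_shift [OF cB])
    show "B p (x + 1) y = B p x y" "B p x (y + 1) = B p x y" for x y
      unfolding B by (rule xi_inner_periodic; intro Xi_inf_shift W G' \<mu>)+
  qed
  ultimately show ?thesis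
    using torus_integral_infsum [OF cA bA] torus_integral_infsum [OF cB bB] by simp
qed

subsection \<open>A finite frame of bump functions\<close>

fun Ck1 :: "nat \<Rightarrow> (real \<Rightarrow> real) \<Rightarrow> bool" where
  "Ck1 0 h \<longleftrightarrow> continuous_on UNIV h"
| "Ck1 (Suc k) h \<longleftrightarrow> (\<exists>h'. (\<forall>x. (h has_real_derivative h' x) (at x)) \<and> Ck1 k h')"

lemma Ck1_SucI: "(\<And>x. (h has_real_derivative h' x) (at x)) \<Longrightarrow> Ck1 k h' \<Longrightarrow> Ck1 (Suc k) h"
  by auto

lemma derivative_imp_continuous:
  fixes h :: "real \<Rightarrow> real"
  assumes "\<And>x. (h has_real_derivative h' x) (at x)"
  shows "continuous_on UNIV h"
  by (intro continuous_at_imp_continuous_on ballI DERIV_isCont [OF assms])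

lemma Ck1_SucD: "Ck1 (Suc k) h \<Longrightarrow> Ck1 k h"
proof (induction k arbitrary: h)
  case 0
  then obtain h' where "\<And>x. (h has_real_derivative h' x) (at x)" by auto
  from derivative_imp_continuous [OF this] show ?case by simp
next
  case (Suc k)
  then obtain h' where "\<forall>x. (h has_real_derivative h' x) (at x)" "Ck1 (Suc k) h'"
    by auto
  with Suc.IH [of h'] show ?case by auto
qed

lemma Ck1_const: "Ck1 k (\<lambda>x. a)"
proof (induction k arbitrary: a)
  case (Suc k)
  show ?case using Suc [of 0] by (auto intro!: exI [of _ "\<lambda>x. 0"])
qed simp

lemma Ck1_add: "Ck1 k f \<Longrightarrow> Ck1 k g \<Longrightarrow> Ck1 k (\<lambda>x. f x + g x)"
proof (induction k arbitrary: f g)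
  case (Suc k)
  then obtain f' g' where "\<And>x. (f has_real_derivative f' x) (at x)" "Ck1 k f'"
    "\<And>x. (g has_real_derivative g' x) (at x)" "Ck1 k g'" by auto
  with Suc.IH show ?case
    by (auto intro!: exI [of _ "\<lambda>x. f' x + g' x"] derivative_intros)
qed (auto intro: continuous_intros)

lemma Ck1_mult: "Ck1 k f \<Longrightarrow> Ck1 k g \<Longrightarrow> Ck1 k (\<lambda>x. f x * g x)"
proof (induction k arbitrary: f g)
  case (Suc k)
  then obtain f' g' where *: "\<And>x. (f has_real_derivative f' x) (at x)" "Ck1 k f'"
    "\<And>x. (g has_real_derivative g' x) (at x)" "Ck1 k g'" by auto
  have "Ck1 k (\<lambda>x. f' x * g x + g' x * f x)"
    using Suc.IH * Suc.prems Ck1_SucD by (intro Ck1_add) auto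
  with * show ?case
    by (auto intro!: exI [of _ "\<lambda>x. f' x * g x + g' x * f x"] DERIV_mult)
qed (auto intro: continuous_intros)

lemma Ck1_affine: "Ck1 k h \<Longrightarrow> Ck1 k (\<lambda>x. h (a * x + b))"
proof (induction k arbitrary: h)
  case 0
  then show ?case by (auto intro!: continuous_intros continuous_on_compose2 [of UNIV h])
next
  case (Suc k)
  then obtain h' where *: "\<And>x. (h has_real_derivative h' x) (at x)" "Ck1 k h'" by auto
  have "((\<lambda>x. h (a * x + b)) has_real_derivative a * h' (a * x + b)) (at x)" for x
    by (rule DERIV_chain2 [OF *(1), THEN DERIV_cong]) (auto intro!: derivative_eq_intros)
  moreover have "Ck1 k (\<lambda>x. a * h' (a * x + b))"
    by (intro Ck1_mult Ck1_const Suc.IH *)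
  ultimately show ?case by (rule Ck1_SucI)
qed

lemma Ck1_inverse: "Ck1 k h \<Longrightarrow> (\<And>x. h x \<noteq> 0) \<Longrightarrow> Ck1 k (\<lambda>x. inverse (h x))"
proof (induction k arbitrary: h)
  case 0
  then show ?case by (auto intro!: continuous_intros)
next
  case (Suc k)
  then obtain h' where *: "\<And>x. (h has_real_derivative h' x) (at x)" "Ck1 k h'" by auto
  have "((\<lambda>x. inverse (h x)) has_real_derivative (-1) * (inverse (h x) * (h' x * inverse (h x)))) (at x)" for x
    by (rule DERIV_cong [OF DERIV_inverse' [OF *(1)]]) (use Suc.prems in auto)
  moreover have "Ck1 k (\<lambda>x. (-1) * (inverse (h x) * (h' x * inverse (h x))))"
    using Suc.IH [OF Ck1_SucD [OF Suc.prems(1)] Suc.prems(2)] * by (intro Ck1_mult Ck1_const) auto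
  ultimately show ?case by (rule Ck1_SucI)
qed

lemma Ck1_sin_cos: "Ck1 k h \<Longrightarrow> Ck1 k (\<lambda>x. sin (h x)) \<and> Ck1 k (\<lambda>x. cos (h x))"
proof (induction k)
  case 0
  then show ?case by (auto intro!: continuous_intros)
next
  case (Suc k)
  then obtain h' where *: "\<And>x. (h has_real_derivative h' x) (at x)" "Ck1 k h'" by auto
  have d: "((\<lambda>x. sin (h x)) has_real_derivative cos (h x) * h' x) (at x)"
    "((\<lambda>x. cos (h x)) has_real_derivative (-1) * (sin (h x) * h' x)) (at x)" for x
    using *(1) by (auto intro!: derivative_eq_intros)
  have c: "Ck1 k (\<lambda>x. sin (h x))" "Ck1 k (\<lambda>x. cos (h x))"
    using Suc.IH [OF Ck1_SucD [OF Suc.prems]] by auto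
  show ?case
    by (intro conjI Ck1_SucI [OF d(1)] Ck1_SucI [OF d(2)] Ck1_mult c Ck1_const *(2))
qed

text \<open>The classical flat function exp(-1/x), with powers of 1/x included so that the family is
  closed under differentiation up to linear combinations.\<close>

definition flat :: "nat \<Rightarrow> real \<Rightarrow> real" where
  "flat n x = (if x > 0 then inverse x ^ n * exp (- inverse x) else 0)"

text \<open>Only x = 0 needs an argument: with u = 1/h the right difference quotient is
  u^(n+1)/exp(u), which tends to 0.\<close>

lemma flat_derivative:
  "(flat n has_real_derivative (- real n * flat (Suc n) x + flat (Suc (Suc n)) x)) (at x)"
proof -
  consider "x > 0" | "x < 0" | "x = 0" by linarith
  then show ?thesis
  proof cases
    case 1
    have "((\<lambda>x. inverse x ^ n * exp (- inverse x)) has_real_derivative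
        (- real n * flat (Suc n) x + flat (Suc (Suc n)) x)) (at x)"
    proof -
      have i: "(inverse has_real_derivative - (inverse x * inverse x)) (at x)"
        using DERIV_inverse [of x] 1 by simp
      have p: "((\<lambda>x. inverse x ^ n) has_real_derivative
          real n * (- (inverse x * inverse x) * inverse x ^ (n - Suc 0))) (at x)"
        using DERIV_power [OF i, of n] by simp
      show ?thesis
        by (rule DERIV_cong [OF DERIV_mult [OF p DERIV_fun_exp [OF DERIV_minus [OF i]]]])
          (use 1 in \<open>cases n; simp add: flat_def algebra_simps\<close>)
    qed
    then show ?thesis
      by (rule has_field_derivative_transform_within_open [of _ _ _ "{0<..}"]) (use 1 in \<open>auto simp: flat_def\<close>)
  next
    case 2
    have "((\<lambda>x. 0) has_real_derivative (- real n * flat (Suc n) x + flat (Suc (Suc n)) x)) (at x)"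
      using 2 by (simp add: flat_def)
    then show ?thesis
      by (rule has_field_derivative_transform_within_open [of _ _ _ "{..<0}"]) (use 2 in \<open>auto simp: flat_def\<close>)
  next
    case 3
    have "((\<lambda>h. (flat n (0 + h) - flat n 0) / h) \<longlongrightarrow> 0) (at_right 0)"
    proof -
      have "((\<lambda>h. inverse h ^ Suc n / exp (inverse h)) \<longlongrightarrow> (0::real)) (at_right 0)"
        by (rule filterlim_compose [OF tendsto_power_div_exp_0 filterlim_inverse_at_top_right])
      then show ?thesis
        by (rule Lim_transform_eventually)
          (auto simp: eventually_at_filter flat_def exp_minus field_simps intro!: always_eventually)
    qed
    moreover have "((\<lambda>h. (flat n (0 + h) - flat n 0) / h) \<longlongrightarrow> 0) (at_left 0)"
      by (rule tendsto_eventually) (auto simp: eventually_at_filter flat_def intro!: always_eventually)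
    ultimately have "((\<lambda>h. (flat n (0 + h) - flat n 0) / h) \<longlongrightarrow> 0) (at 0)"
      by (simp add: filterlim_split_at)
    then show ?thesis
      using 3 by (simp add: DERIV_def flat_def)
  qed
qed

lemma Ck1_flat: "Ck1 k (flat n)"
proof (induction k arbitrary: n)
  case 0
  show ?case
    using derivative_imp_continuous [OF flat_derivative] by simp
next
  case (Suc k)
  have "Ck1 k (\<lambda>x. - real n * flat (Suc n) x + flat (Suc (Suc n)) x)"
    by (intro Ck1_add Ck1_mult Ck1_const Suc)
  then show ?case by (rule Ck1_SucI [OF flat_derivative])
qed

text \<open>The standard smooth transition from 0 to 1 on the unit interval; the denominator is
  positive because x and 1 - x are never both nonpositive.\<close>

definition step :: "real \<Rightarrow> real" where
  "step x = flat 0 x * inverse (flat 0 x + flat 0 (1 - x))"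

lemma flat_sum_pos: "0 < flat 0 x + flat 0 (1 - x)"
  by (cases "x > 0"; cases "x < 1") (auto simp: flat_def add_pos_pos)

lemma Ck1_step: "Ck1 k step"
proof -
  have "Ck1 k (\<lambda>x. flat 0 (-1 * x + 1))"
    by (rule Ck1_affine [OF Ck1_flat])
  then have "Ck1 k (\<lambda>x. flat 0 (1 - x))" by simp
  then have "Ck1 k (\<lambda>x. flat 0 x * inverse (flat 0 x + flat 0 (1 - x)))"
    using flat_sum_pos by (intro Ck1_mult Ck1_inverse Ck1_add Ck1_flat) (simp_all add: less_imp_neq [symmetric])
  then show ?thesis by (simp add: step_def [abs_def])
qed

lemma step_0: "x \<le> 0 \<Longrightarrow> step x = 0"
  by (simp add: step_def flat_def)

lemma step_1: "1 \<le> x \<Longrightarrow> step x = 1"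
  by (simp add: step_def flat_def)

text \<open>Rising as a sine on [-1, 0] and falling as a cosine on [0, 1]. The squares of integer
  translates then add up to 1 by the Pythagorean identity, without taking a square root of a smooth
  function.\<close>

definition bump :: "real \<Rightarrow> real" where
  "bump x = sin (pi / 2 * step (x + 1)) * cos (pi / 2 * step x)"

lemma Ck1_bump: "Ck1 k bump"
proof -
  have 1: "Ck1 k (\<lambda>x. pi / 2 * step (1 * x + 1))"
    by (intro Ck1_mult Ck1_const Ck1_affine Ck1_step)
  have 2: "Ck1 k (\<lambda>x. pi / 2 * step x)"
    by (intro Ck1_mult Ck1_const Ck1_step)
  show ?thesis
    using Ck1_mult [OF Ck1_sin_cos [OF 1, THEN conjunct1] Ck1_sin_cos [OF 2, THEN conjunct2]]
    by (simp add: bump_def [abs_def])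
qed

lemma bump_support: "1 \<le> \<bar>x\<bar> \<Longrightarrow> bump x = 0"
  by (cases "x \<le> 0") (auto simp: bump_def step_0 step_1)

definition step2 :: "real \<Rightarrow> real" where
  "step2 x = (sin (pi / 2 * step x))\<^sup>2"

lemma step2_0: "x \<le> 0 \<Longrightarrow> step2 x = 0"
  by (simp add: step2_def step_0)

lemma step2_1: "1 \<le> x \<Longrightarrow> step2 x = 1"
  by (simp add: step2_def step_1)

text \<open>The square is \<open>step2 (x + 1) * (1 - step2 x)\<close>, and at every x either
  \<open>step2 x\<close> is 0 or \<open>step2 (x + 1)\<close> is 1; this turns the product into a
  difference, which telescopes.\<close>

lemma bump_square: "(bump x)\<^sup>2 = step2 (x + 1) - step2 x"
proof -
  have "(bump x)\<^sup>2 = step2 (x + 1) * (1 - step2 x)"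
    by (simp add: bump_def step2_def power_mult_distrib cos_squared_eq)
  then show ?thesis
    by (cases "x \<le> 0") (simp_all add: step2_0 step2_1)
qed

lemma has_sum_step2_differences:
  fixes y :: real and n :: nat
  assumes "0 < n"
  shows "((\<lambda>p::int. step2 (y + of_int p * real n) - step2 (y + of_int (p - 1) * real n)) has_sum 1) UNIV"
proof -
  \<comment> \<open>The first index with y + q n > 0. Up to \<open>q - 1\<close> the values of
    \<open>step2\<close> are 0 and from \<open>q + 1\<close> on they are 1, so only the terms at
    \<open>q\<close> and \<open>q + 1\<close> remain.\<close>
  define q where "q = \<lfloor>- y / n\<rfloor> + 1"
  have n: "1 \<le> real n" using assms by simp
  have "- y / n < of_int q" "of_int (q - 1) \<le> - y / n"
    unfolding q_def by linarith+
  then have q: "0 < y + of_int q * real n" "y + of_int (q - 1) * real n \<le> 0"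
    using n by (simp_all add: field_simps)
  let ?t = "\<lambda>p::int. step2 (y + of_int p * real n) - step2 (y + of_int (p - 1) * real n)"
  have lo: "step2 (y + of_int p * real n) = 0" if "p \<le> q - 1" for p
  proof (rule step2_0)
    have "of_int p * real n \<le> of_int (q - 1) * real n"
      using that n by (intro mult_right_mono) auto
    then show "y + of_int p * real n \<le> 0" using q(2) by linarith
  qed
  have hi: "step2 (y + of_int p * real n) = 1" if "q + 1 \<le> p" for p
  proof (rule step2_1)
    have "of_int (q + 1) * real n \<le> of_int p * real n"
      using that n by (intro mult_right_mono) auto
    then have "of_int q * real n + real n \<le> of_int p * real n"
      by (simp add: distrib_right)
    then show "1 \<le> y + of_int p * real n" using q(1) n by linarith
  qed
  have z: "?t p = 0" if "p \<notin> {q, q + 1}" for p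
  proof (cases "p < q")
    case True
    then show ?thesis using lo [of p] lo [of "p - 1"] by simp
  next
    case False
    then have "q + 1 \<le> p - 1" using that by auto
    then show ?thesis using hi [of p] hi [of "p - 1"] by simp
  qed
  have "(?t has_sum (\<Sum>p\<in>{q, q + 1}. ?t p)) {q, q + 1}"
    by (rule has_sum_finite) simp
  moreover have "(\<Sum>p\<in>{q, q + 1}. ?t p) = 1"
    using lo [of "q - 1"] hi [of "q + 1"] by simp
  ultimately show ?thesis
    using has_sum_cong_neutral [of "{q, q + 1}" UNIV ?t ?t 1] z by auto
qed

lemma C_k_of_real: "Ck1 k h \<Longrightarrow> C_k k (\<lambda>x y. of_real (h x))"
proof (induction k arbitrary: h)
  case 0
  then have "continuous_on UNIV h" by simp
  from continuous_on_compose2 [OF this continuous_on_fst [OF continuous_on_id]]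
  have "continuous_on UNIV (\<lambda>z::real \<times> real. complex_of_real (h (fst z)))"
    by (intro continuous_on_of_real) simp
  then show ?case by (simp add: case_prod_unfold)
next
  case (Suc k)
  then obtain h' where h': "\<And>x. (h has_real_derivative h' x) (at x)" "Ck1 k h'" by auto
  have "continuous_on UNIV h" by (rule derivative_imp_continuous [OF h'(1)])
  from continuous_on_compose2 [OF this continuous_on_fst [OF continuous_on_id]]
  have "continuous_on UNIV (\<lambda>z::real \<times> real. complex_of_real (h (fst z)))"
    by (intro continuous_on_of_real) simp
  then have c: "continuous_on UNIV (\<lambda>(x, y::real). complex_of_real (h x))"
    by (simp add: case_prod_unfold)
  note * = diff2I [OF c, of "\<lambda>x y. of_real (h' x)" "\<lambda>x y. 0"]
  have "((\<lambda>t. complex_of_real (h t)) has_vector_derivative of_real (h' x)) (at x)" for x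
    by (rule has_vector_derivative_of_real [OF h'(1)])
  then show ?case
    using * Suc.IH [OF h'(2)] C_k_const [of k 0] by (simp add: C_k_Suc)
qed

text \<open>Independence of y and vanishing for |x| > R pass to all derivatives, so each weighted
  derivative is bounded as a continuous function on a compact interval.\<close>

lemma schwartz_compact_support:
  assumes sm: "smooth f" and y: "\<And>x y. f x y = f x 0" and z: "\<And>x y. R < \<bar>x\<bar> \<Longrightarrow> f x y = 0"
  shows "schwartz f"
proof (rule schwartzI [OF sm])
  fix w j
  have "smooth g \<Longrightarrow> (\<forall>x y. g x y = g x 0) \<Longrightarrow> (\<forall>x y. R < \<bar>x\<bar> \<longrightarrow> g x y = 0) \<Longrightarrow>
      (\<forall>x y. dd w g x y = dd w g x 0) \<and> (\<forall>x y. R < \<bar>x\<bar> \<longrightarrow> dd w g x y = 0)" for g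
  proof (induction w arbitrary: g)
    case (Cons b w)
    have d: "diff2 g" using Cons.prems by (auto intro: smooth_diff2)
    have py: "pdy g = (\<lambda>x y. 0)"
    proof (intro ext)
      fix x y
      have "g x = (\<lambda>t. g x 0)" using Cons.prems by auto
      then show "pdy g x y = 0"
        unfolding pdy_def by (metis vector_derivative_const_at)
    qed
    have px1: "pdx g x y = pdx g x 0" for x y
    proof -
      have "(\<lambda>t. g t y) = (\<lambda>t. g t 0)" using Cons.prems by auto
      then show ?thesis unfolding pdx_def by simp
    qed
    have px2: "pdx g x y = 0" if "R < \<bar>x\<bar>" for x y
    proof -
      have op: "open {t. R < \<bar>t :: real\<bar>}" by (intro open_Collect_less continuous_intros)
      have "((\<lambda>t. g t y) has_vector_derivative 0) (at x)"
        by (rule has_vector_derivative_transform_within_open [OF has_vector_derivative_const op])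
          (use that Cons.prems in auto)
      then show ?thesis unfolding pdx_def by (rule vector_derivative_at)
    qed
    show ?case
    proof (cases b)
      case True
      then show ?thesis using Cons.IH [of "pdx g"] px1 px2 Cons.prems by (simp add: smooth_pdx)
    next
      case False
      then show ?thesis by (simp add: py dd_const)
    qed
  qed simp
  from this [OF sm] have w: "\<And>x y. dd w f x y = dd w f x 0" "\<And>x y. R < \<bar>x\<bar> \<Longrightarrow> dd w f x y = 0"
    using y z by auto
  have "continuous_on {-R..R} (\<lambda>x. (1 + \<bar>x\<bar>) ^ j * norm (dd w f x 0))"
    by (intro continuous_intros continuous_on_slice(2) smooth_continuous smooth_dd sm)
  then have "compact ((\<lambda>x. (1 + \<bar>x\<bar>) ^ j * norm (dd w f x 0)) ` {-R..R})"
    by (intro compact_continuous_image) auto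
  then obtain C where "\<forall>z \<in> (\<lambda>x. (1 + \<bar>x\<bar>) ^ j * norm (dd w f x 0)) ` {-R..R}. norm z \<le> C"
    using compact_imp_bounded bounded_iff by blast
  then have C: "(1 + \<bar>x\<bar>) ^ j * norm (dd w f x 0) \<le> C" if "x \<in> {-R..R}" for x
    using that by auto
  have "(1 + \<bar>x\<bar>) ^ j * norm (dd w f x y) \<le> max C 0" for x y
  proof (cases "R < \<bar>x\<bar>")
    case True
    then show ?thesis by (simp add: w(2))
  next
    case False
    then have "x \<in> {-R..R}" by (simp add: not_less abs_le_iff minus_le_iff)
    then show ?thesis using C [of x] w(1) [of x y] by simp
  qed
  then show "\<exists>C. \<forall>x y. (1 + \<bar>x\<bar>) ^ j * norm (dd w f x y) \<le> C" by blast
qed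

text \<open>\<open>e_disjoint\<close> encodes supports of length less than 1 in the only form in
  which it is used: it removes the terms k \<noteq> 0. \<open>e_one\<close> normalises the frame,
  and independence of y makes it insensitive to the translations by 2p\<nu>.\<close>

locale frame =
  fixes c :: nat and \<mu> \<nu> :: real and n :: nat and e :: "nat \<Rightarrow> xi"
  assumes \<mu>: "\<mu> \<noteq> 0" and e_in: "\<And>i. e i \<in> Xi_inf" and e_y: "\<And>i x y y'. e i x y = e i x y'"
    and e_real: "\<And>i x y. cnj (e i x y) = e i x y"
    and e_disjoint: "\<And>i x y k. k \<noteq> 0 \<Longrightarrow> e i x y * e i (x + of_int k) y = 0"
    and e_one: "\<And>x y. (\<Sum>\<^sub>\<infinity>p. \<Sum>i<n. e i (x + 2 * of_int p * \<mu>) y * e i (x + 2 * of_int p * \<mu>) y) = 1"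

lemma frame_exists:
  assumes \<mu>: "\<mu> \<noteq> 0"
  shows "\<exists>n e. frame \<mu> n e"
proof -
  \<comment> \<open>With n > 4|\<mu>| the spacing h = 2|\<mu>|/n satisfies 2h < 1. Each bump is
    supported on an interval of length 2h, and n of them, h apart, make up one period
    2|\<mu>|.\<close>
  obtain n :: nat where n: "4 * \<bar>\<mu>\<bar> < n" using reals_Archimedean2 by blast
  then have n0: "0 < real n" by (rule order_le_less_trans [rotated]) simp
  define h where "h = 2 * \<bar>\<mu>\<bar> / n"
  have h: "0 < h" "2 * h < 1" using n n0 \<mu> by (auto simp: h_def field_simps)
  define e :: "nat \<Rightarrow> xi" where "e = (\<lambda>i x y. of_real (bump (inverse h * x + - real i)))"
  have "e i \<in> Xi_inf" for i
  proof -
    have "smooth (e i)"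
      unfolding e_def smooth_def by (intro allI C_k_of_real Ck1_affine Ck1_bump)
    then have "schwartz (e i)"
    proof (rule schwartz_compact_support [where R = "h * (1 + real i)"])
      fix x y
      assume "h * (1 + real i) < \<bar>x\<bar>"
      then have "1 + real i < \<bar>inverse h * x\<bar>"
        using h by (simp add: abs_mult field_simps)
      then have "1 \<le> \<bar>inverse h * x + - real i\<bar>" by linarith
      then show "e i x y = 0" unfolding e_def by (simp only: bump_support of_real_0)
    qed (simp add: e_def)
    then show ?thesis by (simp add: Xi_inf_iff e_def)
  qed
  moreover have "e i x y * e i (x + of_int k) y = 0" if "k \<noteq> 0" for i x y k
  proof -
    let ?u = "inverse h * x + - real i"
    have "1 \<le> \<bar>real_of_int k\<bar>" using that by linarith
    then have "2 * h < \<bar>real_of_int k\<bar>" using h(2) by linarith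
    then have "2 < \<bar>inverse h * of_int k\<bar>"
      using h(1) by (simp add: abs_mult field_simps)
    then have "1 \<le> \<bar>?u\<bar> \<or> 1 \<le> \<bar>?u + inverse h * of_int k\<bar>" by linarith
    moreover have "inverse h * (x + of_int k) + - real i = ?u + inverse h * of_int k"
      by (simp add: algebra_simps)
    ultimately show ?thesis
      unfolding e_def by (metis bump_support mult_zero_left mult_zero_right of_real_0)
  qed
  moreover have "(\<Sum>\<^sub>\<infinity>p. \<Sum>i<n. e i (x + 2 * of_int p * \<mu>) y * e i (x + 2 * of_int p * \<mu>) y) = 1" for x y
  proof -
    \<comment> \<open>The sign of \<mu>: summing over \<open>s * p\<close> instead of p, the
      translation by 2p\<mu> becomes a shift by multiples of +n in the rescaled variable.\<close>
    define s :: int where "s = (if \<mu> > 0 then 1 else -1)"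
    define t where "t = (\<lambda>p::int. step2 (inverse h * x + 1 + of_int p * real n) - step2 (inverse h * x + 1 + of_int (p - 1) * real n))"
    have "(\<Sum>i<n. e i (x + 2 * of_int p * \<mu>) y * e i (x + 2 * of_int p * \<mu>) y) = of_real (t (s * p))" for p
    proof -
      let ?v = "inverse h * x + of_int (s * p) * real n"
      have v: "inverse h * (x + 2 * of_int p * \<mu>) = ?v"
        using n0 \<mu> by (simp add: h_def s_def field_simps abs_if)
      have "(\<Sum>i<n. (bump (?v + - real i))\<^sup>2) = (\<Sum>i<n. step2 (?v + 1 - real i) - step2 (?v + 1 - real (Suc i)))"
        by (intro sum.cong refl) (simp add: bump_square algebra_simps)
      also have "\<dots> = step2 (?v + 1) - step2 (?v + 1 - real n)"
        using sum_lessThan_telescope' [of "\<lambda>i. step2 (?v + 1 - real i)" n] by simp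
      also have "\<dots> = t (s * p)"
        by (simp add: t_def algebra_simps)
      finally show ?thesis
        unfolding e_def v of_real_mult [symmetric] of_real_sum [symmetric]
        by (simp add: power2_eq_square)
    qed
    then have "(\<Sum>\<^sub>\<infinity>p. \<Sum>i<n. e i (x + 2 * of_int p * \<mu>) y * e i (x + 2 * of_int p * \<mu>) y)
        = (\<Sum>\<^sub>\<infinity>p. complex_of_real (t (s * p)))" by simp
    also have "\<dots> = (\<Sum>\<^sub>\<infinity>p. complex_of_real (t p))"
      by (rule infsum_reindex_bij_betw)
        (rule bij_betw_byWitness [where f' = "\<lambda>p. s * p"]; auto simp: s_def)
    also have "\<dots> = 1"
      using has_sum_of_real [OF has_sum_step2_differences [of n "inverse h * x + 1"], where 'a = complex] n0
      by (simp add: infsumI t_def)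
    finally show ?thesis .
  qed
  moreover have "e i x y = e i x y'" "cnj (e i x y) = e i x y" for i x y y'
    by (simp_all add: e_def)
  ultimately have "frame \<mu> n e"
    using \<mu> by unfold_locales
  then show ?thesis by blast
qed

subsection \<open>The trace on the endomorphism algebra\<close>

lemma sum_fun_apply: "(\<Sum>i<n. F i) x = (\<Sum>i<n. F i x)" for F :: "nat \<Rightarrow> 'a \<Rightarrow> 'b::comm_monoid_add"
  by (induction n) simp_all

lemma infsum_eq_single:
  fixes f :: "int \<Rightarrow> complex"
  assumes "\<And>k. k \<noteq> i \<Longrightarrow> f k = 0"
  shows "(\<Sum>\<^sub>\<infinity>k. f k) = f i"
  using infsum_cong_neutral [of "{i}" UNIV f f] assms by simp

lemma sum_infsum:
  fixes f :: "nat \<Rightarrow> 'a \<Rightarrow> complex"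
  assumes "\<And>i. f i summable_on UNIV"
  shows "(\<Sum>i<n. \<Sum>\<^sub>\<infinity>p. f i p) = (\<Sum>\<^sub>\<infinity>p. \<Sum>i<n. f i p)"
proof (induction n)
  case (Suc n)
  have "(\<lambda>p. \<Sum>i<n. f i p) summable_on UNIV"
    by (induction n) (auto intro: summable_on_add assms)
  then show ?case using Suc by (simp add: infsum_add assms)
qed simp

lemma Xi_inf_zero: "0 \<in> Xi_inf"
proof -
  have "smooth (\<lambda>x y. 0)" by (rule smooth_const)
  then have "schwartz (\<lambda>x y. 0)"
    by (rule schwartzI) (auto simp: dd_const)
  then show ?thesis by (simp add: Xi_inf_iff zero_fun_def)
qed

lemma Xi_inf_sum:
  fixes F :: "nat \<Rightarrow> xi"
  shows "(\<And>i. F i \<in> Xi_inf) \<Longrightarrow> (\<Sum>i<n. F i) \<in> Xi_inf"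
  by (induction n) (auto simp: Xi_inf_zero Xi_inf_plus)

section \<open>Operations on the endomorphism algebra, and finite sums of rank-one operators\<close>

lemma E_algD:
  assumes "T \<in> E_alg c \<mu> \<nu>"
  shows "\<xi> \<in> Xi_inf \<Longrightarrow> T \<xi> \<in> Xi_inf"
    and "\<xi> \<in> Xi_inf \<Longrightarrow> \<eta> \<in> Xi_inf \<Longrightarrow> T (\<xi> + \<eta>) = T \<xi> + T \<eta>"
    and "\<xi> \<in> Xi_inf \<Longrightarrow> T (xi_scale l \<xi>) = xi_scale l (T \<xi>)"
    and "\<xi> \<in> Xi_inf \<Longrightarrow> a \<in> D_inf c \<nu> \<Longrightarrow> T (xi_act \<mu> \<nu> \<xi> a) = xi_act \<mu> \<nu> (T \<xi>) a"
    and "T \<in> extensional Xi_inf"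
  using assms unfolding E_alg_def PiE_def by (blast | fastforce)+

lemma E_algI:
  assumes "\<And>\<xi>. \<xi> \<in> Xi_inf \<Longrightarrow> T \<xi> \<in> Xi_inf"
    and "\<And>\<xi> \<eta>. \<xi> \<in> Xi_inf \<Longrightarrow> \<eta> \<in> Xi_inf \<Longrightarrow> T (\<xi> + \<eta>) = T \<xi> + T \<eta>"
    and "\<And>\<xi> l. \<xi> \<in> Xi_inf \<Longrightarrow> T (xi_scale l \<xi>) = xi_scale l (T \<xi>)"
    and "\<And>\<xi> a. \<xi> \<in> Xi_inf \<Longrightarrow> a \<in> D_inf c \<nu> \<Longrightarrow> T (xi_act \<mu> \<nu> \<xi> a) = xi_act \<mu> \<nu> (T \<xi>) a"
  shows "restrict T Xi_inf \<in> E_alg c \<mu> \<nu>"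
  using assms by (simp add: E_alg_def Xi_inf_plus Xi_inf_scale xi_act_in)

lemma E_alg_eqI:
  assumes "S \<in> E_alg c \<mu> \<nu>" "T \<in> E_alg c \<mu> \<nu>" "\<And>\<xi>. \<xi> \<in> Xi_inf \<Longrightarrow> S \<xi> = T \<xi>"
  shows "S = T"
  using extensionalityI [OF E_algD(5) [OF assms(1)] E_algD(5) [OF assms(2)]] assms(3) by blast

lemma xi_scale_plus: "xi_scale l (f + g) = xi_scale l f + xi_scale l g"
  by (simp add: xi_scale_def plus_fun_def fun_eq_iff algebra_simps)

lemma xi_scale_scale: "xi_scale l (xi_scale m f) = xi_scale (l * m) f"
  by (simp add: xi_scale_def fun_eq_iff)

lemma xi_scale_zero: "xi_scale l 0 = 0"
  by (simp add: xi_scale_def zero_fun_def)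

lemma xi_act_zero: "xi_act \<mu> \<nu> 0 a = 0"
  by (simp add: xi_act_def zero_fun_def)

lemma E_add_in: "S \<in> E_alg c \<mu> \<nu> \<Longrightarrow> T \<in> E_alg c \<mu> \<nu> \<Longrightarrow> E_add S T \<in> E_alg c \<mu> \<nu>"
  unfolding E_add_def
  by (rule E_algI) (simp_all add: E_algD Xi_inf_plus xi_scale_plus add_ac xi_act_plus_left,
      simp add: fun_eq_iff add_ac)

lemma E_scale_in: "T \<in> E_alg c \<mu> \<nu> \<Longrightarrow> E_scale l T \<in> E_alg c \<mu> \<nu>"
  unfolding E_scale_def
  by (rule E_algI) (simp_all add: E_algD Xi_inf_scale xi_scale_plus xi_scale_scale mult.commute xi_act_scale_left,
      simp add: fun_eq_iff xi_scale_def algebra_simps)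

lemma E_zero_in: "E_zero \<in> E_alg c \<mu> \<nu>"
  unfolding E_zero_def
  by (rule E_algI) (simp_all add: Xi_inf_zero xi_scale_zero xi_act_zero)

lemma compose_in:
  assumes S: "S \<in> E_alg c \<mu> \<nu>" and T: "T \<in> E_alg c \<mu> \<nu>"
  shows "compose Xi_inf S T \<in> E_alg c \<mu> \<nu>"
  unfolding compose_def by (rule E_algI) (simp_all only: E_algD [OF S] E_algD [OF T])

lemma E_alg_zero: "T \<in> E_alg c \<mu> \<nu> \<Longrightarrow> T 0 = 0"
  using E_algD(2) [of T c \<mu> \<nu> 0 0] Xi_inf_zero by simp

lemma E_alg_sum:
  fixes F :: "nat \<Rightarrow> xi"
  assumes "T \<in> E_alg c \<mu> \<nu>" "\<And>i. F i \<in> Xi_inf"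
  shows "T (\<Sum>i<n. F i) = (\<Sum>i<n. T (F i))"
  by (induction n) (simp_all only: lessThan_0 sum.empty sum.lessThan_Suc E_alg_zero [OF assms(1)]
      E_algD(2) [OF assms(1)] Xi_inf_sum assms(2))

definition E_inner_sum :: "nat \<Rightarrow> real \<Rightarrow> real \<Rightarrow> (nat \<Rightarrow> xi) \<Rightarrow> (nat \<Rightarrow> xi) \<Rightarrow> nat \<Rightarrow> xop" where
  "E_inner_sum c \<mu> \<nu> a b n = (\<lambda>\<zeta>\<in>Xi_inf. \<Sum>j<n. E_inner c \<mu> \<nu> (a j) (b j) \<zeta>)"

lemma E_inner_sum_0: "E_inner_sum c \<mu> \<nu> a b 0 = E_zero"
  by (simp add: E_inner_sum_def E_zero_def)

lemma E_inner_sum_Suc: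
  "E_inner_sum c \<mu> \<nu> a b (Suc n) = E_add (E_inner_sum c \<mu> \<nu> a b n) (E_inner c \<mu> \<nu> (a n) (b n))"
  by (simp add: E_inner_sum_def E_add_def fun_eq_iff)

lemma E_inner_sum_in:
  assumes "\<And>j. a j \<in> Xi_inf" "\<And>j. b j \<in> Xi_inf" "\<mu> \<noteq> 0"
  shows "E_inner_sum c \<mu> \<nu> a b n \<in> E_alg c \<mu> \<nu>"
  by (induction n)
    (simp_all add: E_inner_sum_0 E_zero_in E_inner_sum_Suc E_add_in E_inner_in assms)

lemma faithful_trace_zero:
  assumes t: "faithful_trace_E c \<mu> \<nu> t"
  shows "t E_zero = 0"
proof -
  have "E_scale 0 E_zero = E_zero"
    by (simp add: E_scale_def E_zero_def xi_scale_zero fun_eq_iff restrict_def)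
  moreover have "t (E_scale 0 E_zero) = 0 * t E_zero"
    using t E_zero_in unfolding faithful_trace_E_def by blast
  ultimately show ?thesis by simp
qed

lemma faithful_trace_sum:
  assumes t: "faithful_trace_E c \<mu> \<nu> t"
    and ab: "\<And>j. a j \<in> Xi_inf" "\<And>j. b j \<in> Xi_inf" and \<mu>: "\<mu> \<noteq> 0"
  shows "t (E_inner_sum c \<mu> \<nu> a b n) = (\<Sum>j<n. t (E_inner c \<mu> \<nu> (a j) (b j)))"
proof (induction n)
  case 0
  show ?case by (simp add: E_inner_sum_0 faithful_trace_zero [OF t])
next
  case (Suc n)
  have "\<forall>S\<in>E_alg c \<mu> \<nu>. \<forall>T\<in>E_alg c \<mu> \<nu>. t (E_add S T) = t S + t T"
    using t unfolding faithful_trace_E_def by blast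
  moreover have "E_inner_sum c \<mu> \<nu> a b n \<in> E_alg c \<mu> \<nu>" by (rule E_inner_sum_in [OF ab \<mu>])
  moreover have "E_inner c \<mu> \<nu> (a n) (b n) \<in> E_alg c \<mu> \<nu>" by (rule E_inner_in [OF ab \<mu>])
  ultimately have "t (E_add (E_inner_sum c \<mu> \<nu> a b n) (E_inner c \<mu> \<nu> (a n) (b n)))
      = t (E_inner_sum c \<mu> \<nu> a b n) + t (E_inner c \<mu> \<nu> (a n) (b n))"
    by blast
  then show ?case by (simp add: E_inner_sum_Suc Suc)
qed

lemma trace_D_inner_plus_right:
  assumes "f \<in> Xi_inf" "g \<in> Xi_inf" "h \<in> Xi_inf" "\<mu> \<noteq> 0"
  shows "trace_D (xi_inner c \<mu> \<nu> h (f + g)) = trace_D (xi_inner c \<mu> \<nu> h f) + trace_D (xi_inner c \<mu> \<nu> h g)"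
  using trace_D_plus [OF xi_inner_in [OF assms(3,1,4)] xi_inner_in [OF assms(3,2,4)]]
    xi_inner_in [OF assms(3) Xi_inf_plus [OF assms(1,2)] assms(4)]
  by (simp only: xi_inner_plus_right assms not_False_eq_True)

lemma trace_D_inner_scale_right:
  "trace_D (xi_inner c \<mu> \<nu> f (xi_scale l g)) = l * trace_D (xi_inner c \<mu> \<nu> f g)"
  by (simp add: xi_inner_scale_right trace_D_cmult)

lemma xi_inner_zero: "xi_inner c \<mu> \<nu> h 0 = 0" "xi_inner c \<mu> \<nu> 0 h = 0"
  by (simp_all add: xi_inner_def fun_eq_iff)

lemma xi_inner_sum_right:
  fixes F :: "nat \<Rightarrow> xi"
  assumes "\<And>i. F i \<in> Xi_inf" "h \<in> Xi_inf" "\<mu> \<noteq> 0"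
  shows "xi_inner c \<mu> \<nu> h (\<Sum>i<n. F i) = (\<Sum>i<n. xi_inner c \<mu> \<nu> h (F i))"
  by (induction n) (simp_all only: lessThan_0 sum.empty sum.lessThan_Suc xi_inner_zero
      xi_inner_plus_right Xi_inf_sum assms not_False_eq_True)

lemma xi_inner_sum_left:
  fixes F :: "nat \<Rightarrow> xi"
  assumes "\<And>i. F i \<in> Xi_inf" "h \<in> Xi_inf" "\<mu> \<noteq> 0"
  shows "xi_inner c \<mu> \<nu> (\<Sum>i<n. F i) h = (\<Sum>i<n. xi_inner c \<mu> \<nu> (F i) h)"
  by (induction n) (simp_all only: lessThan_0 sum.empty sum.lessThan_Suc xi_inner_zero
      xi_inner_plus_left Xi_inf_sum assms not_False_eq_True)

context frame
begin

text \<open>By \<open>e_disjoint\<close> the kernels of these operators are concentrated at k = 0,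
  where their sum is 1 by \<open>e_one\<close>.\<close>

lemma reconstruction:
  assumes \<zeta>: "\<zeta> \<in> Xi_inf"
  shows "(\<Sum>i<n. E_inner c \<mu> \<nu> (e i) (e i) \<zeta>) = \<zeta>"
proof (intro ext)
  fix x y
  have k0: "kern c \<mu> \<nu> (e i) (e i) x y k = 0" if "k \<noteq> 0" for i k
  proof -
    have "kern_term c \<mu> \<nu> (e i) (e i) x y k p = 0" for p
      using e_disjoint [OF that, of i "x + 2 * of_int p * \<mu>" "y + 2 * of_int p * \<nu>"]
      by (auto simp: kern_term_def e_real)
    then show ?thesis by (simp add: kern_def)
  qed
  have t: "kern_term c \<mu> \<nu> (e i) (e i) x y 0 p = e i (x + 2 * of_int p * \<mu>) y * e i (x + 2 * of_int p * \<mu>) y" for i p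
    by (simp add: kern_term_def e_real e_y [of i _ "y + 2 * of_int p * \<nu>" y])
  have "E_inner c \<mu> \<nu> (e i) (e i) \<zeta> x y = kern c \<mu> \<nu> (e i) (e i) x y 0 * \<zeta> x y" for i
    unfolding E_inner_kern [OF e_in e_in \<zeta> \<mu>]
    by (subst infsum_eq_single [where i = 0]) (auto simp: k0)
  then have "(\<Sum>i<n. E_inner c \<mu> \<nu> (e i) (e i) \<zeta>) x y = (\<Sum>i<n. kern c \<mu> \<nu> (e i) (e i) x y 0) * \<zeta> x y"
    by (simp add: sum_fun_apply sum_distrib_right)
  also have "(\<Sum>i<n. kern c \<mu> \<nu> (e i) (e i) x y 0) = (\<Sum>\<^sub>\<infinity>p. \<Sum>i<n. kern_term c \<mu> \<nu> (e i) (e i) x y 0 p)"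
    unfolding kern_def by (rule sum_infsum) (rule kern_term_summable [OF e_in e_in \<mu>])
  also have "\<dots> = 1" unfolding t by (rule e_one)
  finally show "(\<Sum>i<n. E_inner c \<mu> \<nu> (e i) (e i) \<zeta>) x y = \<zeta> x y" by simp
qed

text \<open>Apply T to the reconstruction formula; linearity over the algebra moves T onto the left
  vector of each rank-one operator.\<close>

lemma expansion:
  assumes T: "T \<in> E_alg c \<mu> \<nu>"
  shows "T = E_inner_sum c \<mu> \<nu> (\<lambda>i. T (e i)) e n"
proof (rule E_alg_eqI [OF T])
  have Te: "T (e i) \<in> Xi_inf" for i by (intro E_algD [OF T] e_in)
  show "E_inner_sum c \<mu> \<nu> (\<lambda>i. T (e i)) e n \<in> E_alg c \<mu> \<nu>"
    by (intro E_inner_sum_in Te e_in \<mu>)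
  fix \<zeta> assume \<zeta>: "\<zeta> \<in> Xi_inf"
  have "T \<zeta> = T (\<Sum>i<n. E_inner c \<mu> \<nu> (e i) (e i) \<zeta>)"
    by (simp add: reconstruction [OF \<zeta>])
  also have "\<dots> = (\<Sum>i<n. T (E_inner c \<mu> \<nu> (e i) (e i) \<zeta>))"
    by (rule E_alg_sum [OF T]) (intro E_algD [OF E_inner_in] e_in \<zeta> \<mu>)
  also have "\<dots> = (\<Sum>i<n. E_inner c \<mu> \<nu> (T (e i)) (e i) \<zeta>)"
    using E_algD(4) [OF T e_in xi_inner_in [OF e_in \<zeta> \<mu>]] \<zeta> by (simp add: E_inner_def)
  finally show "T \<zeta> = E_inner_sum c \<mu> \<nu> (\<lambda>i. T (e i)) e n \<zeta>"
    using \<zeta> by (simp add: E_inner_sum_def)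
qed

text \<open>Exchanging the two vectors in every term of the expansion gives an adjoint, by
  \<open>E_inner_adjoint\<close>.\<close>

lemma adjoint_exists:
  assumes T: "T \<in> E_alg c \<mu> \<nu>"
  obtains S where "S \<in> E_alg c \<mu> \<nu>"
    "\<And>f g. f \<in> Xi_inf \<Longrightarrow> g \<in> Xi_inf \<Longrightarrow> xi_inner c \<mu> \<nu> (S f) g = xi_inner c \<mu> \<nu> f (T g)"
proof -
  have Te: "T (e i) \<in> Xi_inf" for i by (intro E_algD [OF T] e_in)
  let ?S = "E_inner_sum c \<mu> \<nu> e (\<lambda>i. T (e i)) n"
  have "xi_inner c \<mu> \<nu> (?S f) g = xi_inner c \<mu> \<nu> f (T g)" if f: "f \<in> Xi_inf" and g: "g \<in> Xi_inf" for f g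
  proof -
    have "T g = (\<Sum>i<n. E_inner c \<mu> \<nu> (T (e i)) (e i) g)"
      using g by (subst expansion [OF T]) (simp add: E_inner_sum_def)
    moreover have "?S f = (\<Sum>i<n. E_inner c \<mu> \<nu> (e i) (T (e i)) f)"
      using f by (simp add: E_inner_sum_def)
    moreover have "E_inner c \<mu> \<nu> (e i) (T (e i)) f \<in> Xi_inf" "E_inner c \<mu> \<nu> (T (e i)) (e i) g \<in> Xi_inf" for i
      by (intro E_algD [OF E_inner_in] e_in Te f g \<mu>)+
    ultimately show ?thesis
      using E_inner_adjoint [OF e_in Te f g \<mu>] by (simp add: xi_inner_sum_left xi_inner_sum_right f g \<mu>)
  qed
  from that [OF E_inner_sum_in [OF e_in Te \<mu>] this] show ?thesis .
qed

definition tr :: "xop \<Rightarrow> complex" where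
  "tr T = (\<Sum>i<n. trace_D (xi_inner c \<mu> \<nu> (e i) (T (e i))))"

text \<open>Against \<open>e i\<close> only the diagonal of the kernel survives, so the sum over i
  is the partition of unity \<open>W\<close> times \<open>P\<close>, the sum of the translates of
  \<open>G\<close> by (2p\<mu>, 2p\<nu>). Unfolding then replaces this by the integral of
  \<open>G\<close> over the strip, which is the prescribed value.\<close>

lemma tr_E_inner:
  assumes \<xi>: "\<xi> \<in> Xi_inf" and \<eta>: "\<eta> \<in> Xi_inf"
  shows "tr (E_inner c \<mu> \<nu> \<xi> \<eta>) = trace_D (xi_inner c \<mu> \<nu> \<eta> \<xi>)"
proof -
  let ?T = "E_inner c \<mu> \<nu> \<xi> \<eta>"
  define G where "G = (\<lambda>x y. \<eta> x y * cnj (\<xi> x y))"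
  define W where "W = (\<lambda>x y. \<Sum>i<n. e i x y * e i x y)"
  define P where "P = (\<lambda>x y. \<Sum>\<^sub>\<infinity>p. G (x + 2 * of_int p * \<mu>) (y + 2 * of_int p * \<nu>))"
  have G_in: "G \<in> Xi_inf" unfolding G_def by (intro Xi_inf_mult Xi_inf_cnj \<xi> \<eta>)
  have "W = (\<Sum>i<n. (\<lambda>x y. e i x y * e i x y))"
    by (simp add: W_def fun_eq_iff sum_fun_apply)
  then have W_in: "W \<in> Xi_inf" by (simp add: Xi_inf_sum Xi_inf_mult e_in)
  have Te: "?T (e i) \<in> Xi_inf" for i
    by (intro E_algD [OF E_inner_in] \<xi> \<eta> e_in \<mu>)
  have pt: "e i z y * cnj (?T (e i) z y) = e i z y * e i z y * P z y" for i z y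
  proof -
    have "cnj (?T (e i) z y) = (\<Sum>\<^sub>\<infinity>k. cnj (kern c \<mu> \<nu> \<xi> \<eta> z y k * e i (z + of_int k) y))"
      unfolding E_inner_kern [OF \<xi> \<eta> e_in \<mu>] by (rule infsum_cnj [symmetric])
    then have "e i z y * cnj (?T (e i) z y)
        = (\<Sum>\<^sub>\<infinity>k. (e i z y * e i (z + of_int k) y) * cnj (kern c \<mu> \<nu> \<xi> \<eta> z y k))"
      by (simp add: infsum_cmult_right' [symmetric] e_real mult_ac)
    also have "\<dots> = e i z y * e i z y * cnj (kern c \<mu> \<nu> \<xi> \<eta> z y 0)"
      by (subst infsum_eq_single [where i = 0]) (simp_all add: e_disjoint)
    also have "cnj (kern c \<mu> \<nu> \<xi> \<eta> z y 0) = P z y"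
      by (simp add: kern_def kern_term_def P_def G_def infsum_cnj [symmetric] del: infsum_cnj)
    finally show ?thesis .
  qed
  have s: "(\<lambda>m. e i (x + of_int m) y * e i (x + of_int m) y * P (x + of_int m) y) summable_on UNIV" for i x y
    using summable_inner_term [OF e_in [of i] Te [of i] \<mu>, where c = c and \<nu> = \<nu> and p = 0 and x = x and y = y]
    by (simp add: inner_term_def pt)
  have in_D: "xi_inner c \<mu> \<nu> (e i) (?T (e i)) \<in> D_inf c \<nu>" for i
    by (intro xi_inner_in e_in Te \<mu>)
  have "tr ?T = (\<Sum>i<n. torus_integral (\<lambda>x y. xi_inner c \<mu> \<nu> (e i) (?T (e i)) x y 0))"
    unfolding tr_def by (simp add: trace_D_eq [OF in_D])
  also have "\<dots> = torus_integral (\<lambda>x y. \<Sum>i<n. xi_inner c \<mu> \<nu> (e i) (?T (e i)) x y 0)"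
  proof -
    have c: "continuous_on UNIV (\<lambda>(x, y). \<Sum>i<k. xi_inner c \<mu> \<nu> (e i) (?T (e i)) x y 0)" for k
      using continuous_on_sum [of "{..<k}" UNIV "\<lambda>i (x, y). xi_inner c \<mu> \<nu> (e i) (?T (e i)) x y 0"]
        D_inf_continuous [OF in_D] by (simp add: case_prod_unfold)
    have "(\<Sum>i<k. torus_integral (\<lambda>x y. xi_inner c \<mu> \<nu> (e i) (?T (e i)) x y 0))
        = torus_integral (\<lambda>x y. \<Sum>i<k. xi_inner c \<mu> \<nu> (e i) (?T (e i)) x y 0)" for k
    proof (induction k)
      case 0
      show ?case using torus_integral_cmult [of 0 "\<lambda>x y. 0"] by simp
    next
      case (Suc k)
      then show ?case
        using torus_integral_add [OF c [of k] D_inf_continuous [OF in_D [of k]]] by simp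
    qed
    then show ?thesis .
  qed
  also have "\<dots> = torus_integral (\<lambda>x y. \<Sum>\<^sub>\<infinity>m. W (x + of_int m) y * P (x + of_int m) y)"
    by (simp add: xi_inner_0 pt sum_infsum [OF s] W_def sum_distrib_right)
  also have "\<dots> = torus_integral (\<lambda>x y. \<Sum>\<^sub>\<infinity>m. G (x + of_int m) y)"
    unfolding P_def
  proof (rule torus_integral_unfold [OF W_in G_in \<mu>])
    show "(\<Sum>\<^sub>\<infinity>p. W (x + 2 * of_int p * \<mu>) y) = 1" for x y
      unfolding W_def by (rule e_one)
    show "W x y = W x y'" for x y y'
      unfolding W_def by (simp add: e_y [of _ x y y'])
  qed
  also have "\<dots> = trace_D (xi_inner c \<mu> \<nu> \<eta> \<xi>)"
    by (simp add: trace_D_eq [OF xi_inner_in [OF \<eta> \<xi> \<mu>]] xi_inner_0 G_def)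
  finally show ?thesis .
qed

lemma tr_add: "S \<in> E_alg c \<mu> \<nu> \<Longrightarrow> T \<in> E_alg c \<mu> \<nu> \<Longrightarrow> tr (E_add S T) = tr S + tr T"
  by (simp add: tr_def E_add_def e_in trace_D_inner_plus_right E_algD \<mu> sum.distrib)

lemma tr_scale: "tr (E_scale l T) = l * tr T"
  by (simp add: tr_def E_scale_def e_in trace_D_inner_scale_right sum_distrib_left)

lemma tr_sum:
  assumes "\<And>j. a j \<in> Xi_inf" "\<And>j. b j \<in> Xi_inf"
  shows "tr (E_inner_sum c \<mu> \<nu> a b k) = (\<Sum>j<k. trace_D (xi_inner c \<mu> \<nu> (b j) (a j)))"
proof (induction k)
  case 0
  have "E_scale 0 E_zero = E_zero"
    by (simp add: E_scale_def E_zero_def xi_scale_zero fun_eq_iff restrict_def)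
  then show ?case using tr_scale [of 0 E_zero] by (simp add: E_inner_sum_0)
next
  case (Suc k)
  then show ?case
    by (simp add: E_inner_sum_Suc tr_add E_inner_sum_in E_inner_in tr_E_inner assms \<mu>)
qed

text \<open>With T' adjoint to T, the product S T is the sum of the rank-one operators of
  \<open>S (e i)\<close> and \<open>T' (e i)\<close>. The formula for these gives the trace as a sum
  of \<tau>\<langle>T' e_i, S e_i\<rangle> = \<tau>\<langle>e_i, T S e_i\<rangle>, which is the
  trace of T S by definition.\<close>

lemma tr_commute:
  assumes S: "S \<in> E_alg c \<mu> \<nu>" and T: "T \<in> E_alg c \<mu> \<nu>"
  shows "tr (compose Xi_inf S T) = tr (compose Xi_inf T S)"
proof -
  obtain T' where T': "T' \<in> E_alg c \<mu> \<nu>"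
    "\<And>f g. f \<in> Xi_inf \<Longrightarrow> g \<in> Xi_inf \<Longrightarrow> xi_inner c \<mu> \<nu> (T' f) g = xi_inner c \<mu> \<nu> f (T g)"
    using adjoint_exists [OF T] by blast
  have Se: "S (e i) \<in> Xi_inf" and T'e: "T' (e i) \<in> Xi_inf" for i
    by (intro E_algD [OF S] E_algD [OF T'(1)] e_in)+
  have "compose Xi_inf S T = E_inner_sum c \<mu> \<nu> (\<lambda>i. S (e i)) (\<lambda>i. T' (e i)) n"
  proof (rule E_alg_eqI [OF compose_in [OF S T] E_inner_sum_in [OF Se T'e \<mu>]])
    fix \<zeta> assume \<zeta>: "\<zeta> \<in> Xi_inf"
    then have T\<zeta>: "T \<zeta> \<in> Xi_inf" by (rule E_algD [OF T])
    have "S (T \<zeta>) = (\<Sum>i<n. E_inner c \<mu> \<nu> (S (e i)) (e i) (T \<zeta>))"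
      using T\<zeta> by (subst expansion [OF S]) (simp add: E_inner_sum_def)
    also have "\<dots> = (\<Sum>i<n. E_inner c \<mu> \<nu> (S (e i)) (T' (e i)) \<zeta>)"
      using \<zeta> T\<zeta> by (simp add: E_inner_def T'(2) e_in)
    finally show "compose Xi_inf S T \<zeta> = E_inner_sum c \<mu> \<nu> (\<lambda>i. S (e i)) (\<lambda>i. T' (e i)) n \<zeta>"
      using \<zeta> by (simp add: compose_eq E_inner_sum_def)
  qed
  then have "tr (compose Xi_inf S T) = (\<Sum>i<n. trace_D (xi_inner c \<mu> \<nu> (T' (e i)) (S (e i))))"
    by (simp add: tr_sum Se T'e)
  then show ?thesis
    by (simp add: tr_def compose_eq e_in T'(2) Se)
qed

text \<open>The trace is the sum of the nonnegative numbers \<tau>\<langle>T e_i, T e_i\<rangle>. If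
  it is zero then T kills every frame vector, hence vanishes by \<open>expansion\<close>.\<close>

lemma tr_faithful:
  assumes S: "S \<in> E_alg c \<mu> \<nu>" and T: "T \<in> E_alg c \<mu> \<nu>" and adj: "E_is_adjoint c \<mu> \<nu> S T"
  shows "tr (compose Xi_inf S T) \<in> \<real>\<^sub>\<ge>\<^sub>0" and "tr (compose Xi_inf S T) = 0 \<Longrightarrow> T = E_zero"
proof -
  have Te: "T (e i) \<in> Xi_inf" for i by (intro E_algD [OF T] e_in)
  define r where "r = (\<lambda>i. Re (trace_D (xi_inner c \<mu> \<nu> (T (e i)) (T (e i)))))"
  have r: "trace_D (xi_inner c \<mu> \<nu> (T (e i)) (T (e i))) = of_real (r i)" "0 \<le> r i" for i
    using trace_D_inner_pos(1) [OF Te [of i] \<mu>, of c \<nu>] by (auto simp: r_def elim!: nonneg_Reals_cases)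
  have "xi_inner c \<mu> \<nu> (e i) (S (T (e i))) = xi_inner c \<mu> \<nu> (T (e i)) (T (e i))" for i
    using adj Te e_in by (simp add: E_is_adjoint_def)
  then have tr: "tr (compose Xi_inf S T) = of_real (\<Sum>i<n. r i)"
    by (simp add: tr_def compose_eq e_in r)
  then show "tr (compose Xi_inf S T) \<in> \<real>\<^sub>\<ge>\<^sub>0"
    by (simp add: sum_nonneg r(2) del: of_real_sum)
  assume "tr (compose Xi_inf S T) = 0"
  then have "(\<Sum>i<n. r i) = 0" unfolding tr by (simp del: of_real_sum)
  then have "r i = 0" if "i < n" for i
    using that r(2) by (simp add: sum_nonneg_eq_0_iff)
  then have z: "T (e i) = 0" if "i < n" for i
    using trace_D_inner_pos(2) [OF Te [of i] \<mu>, of c \<nu>] r(1) [of i] that by simp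
  show "T = E_zero"
  proof (rule E_alg_eqI [OF T E_zero_in])
    fix \<zeta> assume \<zeta>: "\<zeta> \<in> Xi_inf"
    have "T \<zeta> = (\<Sum>i<n. E_inner c \<mu> \<nu> (T (e i)) (e i) \<zeta>)"
      using \<zeta> by (subst expansion [OF T]) (simp add: E_inner_sum_def)
    then show "T \<zeta> = E_zero \<zeta>"
      using \<zeta> z by (simp add: E_inner_def E_zero_def xi_act_zero)
  qed
qed

text \<open>This discharges the definite description. Uniqueness holds because an additive
  functional with prescribed values on rank-one operators is determined on their finite sums, that
  is on everything by \<open>expansion\<close>.\<close>

lemma trace_E_eq: "trace_E c \<mu> \<nu> = restrict tr (E_alg c \<mu> \<nu>)"
  unfolding trace_E_def
proof (rule the_equality)
  show "restrict tr (E_alg c \<mu> \<nu>) \<in> extensional (E_alg c \<mu> \<nu>) \<and>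
      faithful_trace_E c \<mu> \<nu> (restrict tr (E_alg c \<mu> \<nu>)) \<and>
      (\<forall>\<xi>\<in>Xi_inf. \<forall>\<eta>\<in>Xi_inf. restrict tr (E_alg c \<mu> \<nu>) (E_inner c \<mu> \<nu> \<xi> \<eta>) = trace_D (xi_inner c \<mu> \<nu> \<eta> \<xi>))"
    using tr_add tr_scale tr_commute tr_faithful tr_E_inner E_inner_in [OF _ _ \<mu>]
    by (simp add: faithful_trace_E_def E_add_in E_scale_in compose_in)
next
  fix t
  assume t: "t \<in> extensional (E_alg c \<mu> \<nu>) \<and> faithful_trace_E c \<mu> \<nu> t \<and>
      (\<forall>\<xi>\<in>Xi_inf. \<forall>\<eta>\<in>Xi_inf. t (E_inner c \<mu> \<nu> \<xi> \<eta>) = trace_D (xi_inner c \<mu> \<nu> \<eta> \<xi>))"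
  show "t = restrict tr (E_alg c \<mu> \<nu>)"
  proof (rule extensionalityI)
    fix T assume T: "T \<in> E_alg c \<mu> \<nu>"
    have Te: "T (e i) \<in> Xi_inf" for i by (intro E_algD [OF T] e_in)
    have "t T = t (E_inner_sum c \<mu> \<nu> (\<lambda>i. T (e i)) e n)"
      using expansion [OF T] by simp
    also have "\<dots> = (\<Sum>i<n. t (E_inner c \<mu> \<nu> (T (e i)) (e i)))"
      using t Te e_in \<mu> by (intro faithful_trace_sum) auto
    also have "\<dots> = tr T"
      using t Te e_in by (simp add: tr_def)
    finally show "t T = restrict tr (E_alg c \<mu> \<nu>) T" using T by simp
  qed (use t in auto)
qed

lemma trace_E_tr: "T \<in> E_alg c \<mu> \<nu> \<Longrightarrow> trace_E c \<mu> \<nu> T = tr T"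
  by (simp add: trace_E_eq)

end

subsection \<open>Curvature\<close>

lemma heis_entries:
  "X_heis $ 2 $ 3 = 1" "X_heis $ 1 $ 2 = 0" "X_heis $ 1 $ 3 = 0"
  "Y_heis $ 2 $ 3 = 0" "Y_heis $ 1 $ 2 = 1" "Y_heis $ 1 $ 3 = 0"
  "Z_heis c $ 2 $ 3 = 0" "Z_heis c $ 1 $ 2 = 0" "Z_heis c $ 1 $ 3 = 1 / of_nat c"
  by (simp_all add: X_heis_def Y_heis_def Z_heis_def mat_unit_def)

lemma heis_in: "X_heis \<in> heis c" "Y_heis \<in> heis c" "Z_heis c \<in> heis c"
  unfolding heis_def by (simp_all add: span_base)

lemma bracket_XY: "c > 0 \<Longrightarrow> lie_bracket X_heis Y_heis = (- of_nat c) *\<^sub>R Z_heis c"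
  by (simp add: vec_eq_iff forall_3 lie_bracket_def matrix_matrix_mult_def sum_3 X_heis_def Y_heis_def
      Z_heis_def mat_unit_def)

lemma bracket_XZ: "lie_bracket X_heis (Z_heis c) = 0 *\<^sub>R Z_heis c"
  by (simp add: vec_eq_iff forall_3 lie_bracket_def matrix_matrix_mult_def sum_3 X_heis_def
      Z_heis_def mat_unit_def)

lemma bracket_YZ: "lie_bracket Y_heis (Z_heis c) = 0 *\<^sub>R Z_heis c"
  by (simp add: vec_eq_iff forall_3 lie_bracket_def matrix_matrix_mult_def sum_3 Y_heis_def
      Z_heis_def mat_unit_def)

text \<open>Collects what the curvature arguments need from a pair of basis elements: membership in
  the Lie algebra and the coordinates of the bracket, which is central. The three pairs can then be
  treated uniformly.\<close>

definition bracket_triple :: "nat \<Rightarrow> mat3 \<Rightarrow> mat3 \<Rightarrow> bool" where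
  "bracket_triple c V W \<longleftrightarrow> V \<in> heis c \<and> W \<in> heis c \<and> lie_bracket V W \<in> heis c \<and>
     lie_bracket V W $ 2 $ 3 = 0 \<and> lie_bracket V W $ 1 $ 2 = 0 \<and>
     lie_bracket V W $ 1 $ 3 = V $ 1 $ 2 * W $ 2 $ 3 - W $ 1 $ 2 * V $ 2 $ 3"

lemma heis_scale: "r *\<^sub>R Z_heis c \<in> heis c"
  using heis_in(3) unfolding heis_def by (rule span_mul)

lemma bracket_triples:
  assumes "c > 0"
  shows "bracket_triple c X_heis Y_heis" "bracket_triple c X_heis (Z_heis c)"
    "bracket_triple c Y_heis (Z_heis c)"
  unfolding bracket_triple_def bracket_XY [OF assms] bracket_XZ bracket_YZ
  using assms by (intro conjI heis_in heis_scale; simp add: heis_entries)+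

lemma diff2_of_x:
  assumes "\<And>x. (\<gamma> has_vector_derivative \<gamma>' x) (at x)"
  shows "diff2 (\<lambda>x y. \<gamma> x)" "pdx (\<lambda>x y. \<gamma> x) = (\<lambda>x y. \<gamma>' x)" "pdy (\<lambda>x y. \<gamma> x) = (\<lambda>x y. 0)"
proof -
  have "continuous_on UNIV \<gamma>"
    by (rule continuous_at_imp_continuous_on) (use assms has_vector_derivative_continuous in blast)
  from continuous_on_compose2 [OF this continuous_on_fst [OF continuous_on_id]]
  have c: "continuous_on UNIV (\<lambda>(x, y::real). \<gamma> x)" by (simp add: case_prod_unfold)
  note * = diff2I [OF c, of "\<lambda>x y. \<gamma>' x" "\<lambda>x y. 0"]
  show "diff2 (\<lambda>x y. \<gamma> x)" "pdx (\<lambda>x y. \<gamma> x) = (\<lambda>x y. \<gamma>' x)" "pdy (\<lambda>x y. \<gamma> x) = (\<lambda>x y. 0)"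
    by (rule *; simp add: assms)+
qed

text \<open>Constant-coefficient parts commute by the symmetry of mixed partials, and potentials
  commute with each other. Since these depend on x only, what remains is their x-derivatives times
  the coefficients of \<open>pdx\<close>.\<close>

lemma fop_commutator:
  assumes f: "smooth f"
    and \<gamma>: "\<And>x. (\<gamma>1 has_vector_derivative \<gamma>1' x) (at x)" "\<And>x. (\<gamma>2 has_vector_derivative \<gamma>2' x) (at x)"
  shows "fop \<alpha>1 \<beta>1 \<gamma>1 (fop \<alpha>2 \<beta>2 \<gamma>2 f) x y
    = fop \<alpha>2 \<beta>2 \<gamma>2 (fop \<alpha>1 \<beta>1 \<gamma>1 f) x y + (of_real \<alpha>1 * \<gamma>2' x - of_real \<alpha>2 * \<gamma>1' x) * f x y"
proof -
  have d: "diff2 f" "diff2 (pdx f)" "diff2 (pdy f)"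
    using f by (auto intro: smooth_diff2 smooth_pdx smooth_pdy)
  have fop: "pdx (fop \<alpha> \<beta> \<gamma> f) = (\<lambda>x y. of_real \<alpha> * pdx (pdx f) x y + of_real \<beta> * pdx (pdy f) x y
        + (\<gamma>' x * f x y + \<gamma> x * pdx f x y))"
    "pdy (fop \<alpha> \<beta> \<gamma> f) = (\<lambda>x y. of_real \<alpha> * pdy (pdx f) x y + of_real \<beta> * pdy (pdy f) x y + \<gamma> x * pdy f x y)"
    if "\<And>x. (\<gamma> has_vector_derivative \<gamma>' x) (at x)" for \<alpha> \<beta> \<gamma> \<gamma>'
  proof -
    note g = diff2_of_x [of \<gamma> \<gamma>', OF that]
    note m = diff2_mult [OF g(1) d(1)]
    note a = diff2_mult [OF diff2_const(1) [of "of_real \<alpha>"] d(2)]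
    note b = diff2_mult [OF diff2_const(1) [of "of_real \<beta>"] d(3)]
    note ab = diff2_add [OF a(1) b(1)]
    note s = diff2_add [OF ab(1) m(1)]
    show "pdx (fop \<alpha> \<beta> \<gamma> f) = (\<lambda>x y. of_real \<alpha> * pdx (pdx f) x y + of_real \<beta> * pdx (pdy f) x y
        + (\<gamma>' x * f x y + \<gamma> x * pdx f x y))"
      unfolding fop_def s(2) ab(2) a(2) b(2) m(2) g(2) diff2_const(2) by simp
    show "pdy (fop \<alpha> \<beta> \<gamma> f) = (\<lambda>x y. of_real \<alpha> * pdy (pdx f) x y + of_real \<beta> * pdy (pdy f) x y + \<gamma> x * pdy f x y)"
      unfolding fop_def s(3) ab(3) a(3) b(3) m(3) g(3) diff2_const(3) by simp
  qed
  show ?thesis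
    unfolding fop_def [of _ _ _ "fop _ _ _ f"] fop [OF \<gamma>(1)] fop [OF \<gamma>(2)] pdx_pdy_commute [OF f]
    unfolding fop_def by (simp add: algebra_simps)
qed

lemma quadratic_derivative:
  fixes a b d :: complex
  shows "((\<lambda>x. a * of_real x ^ 2 + b * of_real x + d) has_vector_derivative (2 * a * of_real x + b)) (at x)"
proof -
  have "((\<lambda>z. a * z ^ 2 + b * z + d) has_field_derivative 2 * a * of_real x + b) (at (of_real x))"
    by (auto intro!: derivative_eq_intros)
  from has_vector_derivative_real_field [OF this] show ?thesis by simp
qed

lemma delta_pot_derivative:
  "(delta_pot c \<mu> W p has_vector_derivative of_real (W $ 1 $ 2) * (2 * of_real pi * \<i> * of_nat c * of_int p)) (at x)"
proof -
  let ?b = "of_real (W $ 1 $ 2) * (2 * of_real pi * \<i> * of_nat c * of_int p)"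
  have "delta_pot c \<mu> W p = (\<lambda>x. 0 * of_real x ^ 2 + ?b * of_real x
      + (of_real (of_nat c * W $ 1 $ 3) * (2 * of_real pi * \<i> * of_int p) - ?b * of_real (of_int p * \<mu>)))"
    by (simp add: delta_pot_def fun_eq_iff algebra_simps)
  then show ?thesis using quadratic_derivative [of 0 ?b] by simp
qed

lemma nabla0_pot_derivative:
  "(nabla0_pot c \<mu> W has_vector_derivative of_real (W $ 1 $ 2) * (of_real pi * of_nat c * \<i> / of_real \<mu>) * of_real x
      + of_real (of_nat c * W $ 1 $ 3) * (of_real pi * \<i> / of_real \<mu>)) (at x)"
proof -
  let ?a = "of_real (W $ 1 $ 2) * (of_real pi * of_nat c * \<i> / (2 * of_real \<mu>))"
  let ?b = "of_real (of_nat c * W $ 1 $ 3) * (of_real pi * \<i> / of_real \<mu>)"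
  have eq: "nabla0_pot c \<mu> W = (\<lambda>x. ?a * of_real x ^ 2 + ?b * of_real x + 0)"
    by (simp add: nabla0_pot_def fun_eq_iff algebra_simps)
  have "2 * ?a * of_real x + ?b = of_real (W $ 1 $ 2) * (of_real pi * of_nat c * \<i> / of_real \<mu>) * of_real x + ?b"
    by simp
  with quadratic_derivative [of ?a ?b 0 x] show ?thesis
    unfolding eq by simp
qed

text \<open>By \<open>fop_commutator\<close> the difference is a constant multiple of p, and that
  constant is the (1, 3) entry of the bracket in the normalisation of \<open>delta\<close>.\<close>

lemma delta_commutator:
  assumes a: "a \<in> D_inf c \<nu>" and VW: "bracket_triple c V W"
  shows "delta c \<mu> V (delta c \<mu> W a) = delta c \<mu> W (delta c \<mu> V a) + delta c \<mu> (lie_bracket V W) a"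
proof (intro ext)
  fix x y p
  have d: "(\<lambda>x y. delta c \<mu> W a x y p) = fop (- W $ 2 $ 3) (- W $ 1 $ 2) (delta_pot c \<mu> W p) (\<lambda>x y. a x y p)" for W
    by (simp add: delta_eq fun_eq_iff)
  have u: "lie_bracket V W $ 2 $ 3 = 0" "lie_bracket V W $ 1 $ 2 = 0"
    "lie_bracket V W $ 1 $ 3 = V $ 1 $ 2 * W $ 2 $ 3 - W $ 1 $ 2 * V $ 2 $ 3"
    using VW by (simp_all add: bracket_triple_def)
  have "delta c \<mu> V (delta c \<mu> W a) x y p = delta c \<mu> W (delta c \<mu> V a) x y p
      + (of_real (- V $ 2 $ 3) * (of_real (W $ 1 $ 2) * (2 * of_real pi * \<i> * of_nat c * of_int p))
       - of_real (- W $ 2 $ 3) * (of_real (V $ 1 $ 2) * (2 * of_real pi * \<i> * of_nat c * of_int p))) * a x y p"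
    unfolding delta_eq [of c \<mu> V "delta c \<mu> W a"] delta_eq [of c \<mu> W "delta c \<mu> V a"] d
    by (rule fop_commutator [OF D_inf_smooth [OF a] delta_pot_derivative delta_pot_derivative])
  also have "\<dots> = delta c \<mu> W (delta c \<mu> V a) x y p + delta c \<mu> (lie_bracket V W) a x y p"
    unfolding delta_def [of c \<mu> "lie_bracket V W"] u by (simp add: algebra_simps)
  finally show "delta c \<mu> V (delta c \<mu> W a) x y p
      = (delta c \<mu> W (delta c \<mu> V a) + delta c \<mu> (lie_bracket V W) a) x y p" by simp
qed

section \<open>Connections and their curvature\<close>

lemma delta_plus:
  assumes "a \<in> D_inf c \<nu>" "b \<in> D_inf c \<nu>"
  shows "delta c \<mu> W (a + b) = delta c \<mu> W a + delta c \<mu> W b"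
proof (intro ext)
  fix x y p
  have "diff2 (\<lambda>x y. a x y p)" "diff2 (\<lambda>x y. b x y p)"
    using assms by (auto intro: smooth_diff2 D_inf_smooth)
  from diff2_add [OF this] show "delta c \<mu> W (a + b) x y p = (delta c \<mu> W a + delta c \<mu> W b) x y p"
    by (simp add: delta_def algebra_simps)
qed

lemma connectionD:
  assumes "connection c \<mu> \<nu> nabla" "W \<in> heis c"
  shows "\<xi> \<in> Xi_inf \<Longrightarrow> nabla W \<xi> \<in> Xi_inf"
    and "\<xi> \<in> Xi_inf \<Longrightarrow> \<eta> \<in> Xi_inf \<Longrightarrow> nabla W (\<xi> + \<eta>) = nabla W \<xi> + nabla W \<eta>"
    and "\<xi> \<in> Xi_inf \<Longrightarrow> nabla W (xi_scale l \<xi>) = xi_scale l (nabla W \<xi>)"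
    and "\<xi> \<in> Xi_inf \<Longrightarrow> nabla (r *\<^sub>R W) \<xi> = xi_scale (of_real r) (nabla W \<xi>)"
    and "\<xi> \<in> Xi_inf \<Longrightarrow> a \<in> D_inf c \<nu> \<Longrightarrow>
        nabla W (xi_act \<mu> \<nu> \<xi> a) = xi_act \<mu> \<nu> (nabla W \<xi>) a + xi_act \<mu> \<nu> \<xi> (delta c \<mu> W a)"
  using assms unfolding connection_def by blast+

lemma xi_scale_m1: "xi_scale (-1) f = - f"
  by (simp add: xi_scale_def fun_eq_iff)

lemma xi_act_uminus: "xi_act \<mu> \<nu> (- f) a = - xi_act \<mu> \<nu> f a"
  using xi_act_scale_left [of \<mu> \<nu> "-1" f a] by (simp only: xi_scale_m1)

lemma xi_act_minus_left:
  assumes "f \<in> Xi_inf" "g \<in> Xi_inf" "a \<in> D_inf c \<nu>"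
  shows "xi_act \<mu> \<nu> (f - g) a = xi_act \<mu> \<nu> f a - xi_act \<mu> \<nu> g a"
  using xi_act_plus_left [OF assms(1) Xi_inf_uminus [OF assms(2)] assms(3)]
  by (simp only: xi_act_uminus diff_conv_add_uminus)

lemma xi_inner_uminus: 
  "xi_inner c \<mu> \<nu> (- f) g = - xi_inner c \<mu> \<nu> f g" "xi_inner c \<mu> \<nu> f (- g) = - xi_inner c \<mu> \<nu> f g"
  using xi_inner_scale_left [of c \<mu> \<nu> "-1" f g] xi_inner_scale_right [of c \<mu> \<nu> f "-1" g]
  by (simp_all add: xi_scale_m1 fun_eq_iff)

lemma xi_inner_minus_left:
  assumes "f \<in> Xi_inf" "g \<in> Xi_inf" "h \<in> Xi_inf" "\<mu> \<noteq> 0"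
  shows "xi_inner c \<mu> \<nu> (f - g) h = xi_inner c \<mu> \<nu> f h - xi_inner c \<mu> \<nu> g h"
  using xi_inner_plus_left [OF assms(1) Xi_inf_uminus [OF assms(2)] assms(3,4)]
  by (simp only: xi_inner_uminus diff_conv_add_uminus)

lemma xi_inner_minus_right:
  assumes "f \<in> Xi_inf" "g \<in> Xi_inf" "h \<in> Xi_inf" "\<mu> \<noteq> 0"
  shows "xi_inner c \<mu> \<nu> h (f - g) = xi_inner c \<mu> \<nu> h f - xi_inner c \<mu> \<nu> h g"
  using xi_inner_plus_right [OF assms(1) Xi_inf_uminus [OF assms(2)] assms(3,4)]
  by (simp only: xi_inner_uminus diff_conv_add_uminus)

lemma xi_scale_minus: "xi_scale l (f - g) = xi_scale l f - xi_scale l g"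
  by (simp add: xi_scale_def fun_eq_iff algebra_simps)

lemma connection_minus:
  assumes "connection c \<mu> \<nu> nabla" "W \<in> heis c" "\<xi> \<in> Xi_inf" "\<eta> \<in> Xi_inf"
  shows "nabla W (\<xi> - \<eta>) = nabla W \<xi> - nabla W \<eta>"
  using connectionD(2) [OF assms(1,2,3) Xi_inf_uminus [OF assms(4)]]
    connectionD(3) [OF assms(1,2,4), of "-1"]
  by (simp only: xi_scale_m1 diff_conv_add_uminus)

lemma connection_sum:
  fixes F :: "nat \<Rightarrow> xi"
  assumes "connection c \<mu> \<nu> nabla" "W \<in> heis c" "\<And>i. F i \<in> Xi_inf"
  shows "nabla W (\<Sum>i<n. F i) = (\<Sum>i<n. nabla W (F i))"
proof (induction n)
  case 0
  have "nabla W (0 - 0) = nabla W 0 - nabla W 0"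
    by (rule connection_minus [OF assms(1,2) Xi_inf_zero Xi_inf_zero])
  then show ?case by (simp only: lessThan_0 sum.empty diff_self)
next
  case (Suc n)
  then show ?case
    by (simp only: sum.lessThan_Suc connectionD(2) [OF assms(1,2) Xi_inf_sum [OF assms(3)] assms(3)])
qed

text \<open>In the Leibniz rule for two successive derivatives the mixed terms are symmetric in V
  and W and cancel. The remaining second derivatives of \<open>a\<close> are matched by the bracket
  term, by \<open>delta_commutator\<close>.\<close>

lemma curvature_in:
  assumes conn: "connection c \<mu> \<nu> nabla" and VW: "bracket_triple c V W"
  shows "curvature nabla V W \<in> E_alg c \<mu> \<nu>"
proof -
  define U where "U = lie_bracket V W"
  have V: "V \<in> heis c" and W: "W \<in> heis c" and U: "U \<in> heis c"
    using VW by (simp_all add: bracket_triple_def U_def)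
  note DV = connectionD [OF conn V] and DW = connectionD [OF conn W] and DU = connectionD [OF conn U]
  show ?thesis
    unfolding curvature_def U_def [symmetric]
  proof (rule E_algI)
    fix \<xi> assume \<xi>: "\<xi> \<in> Xi_inf"
    show "nabla V (nabla W \<xi>) - nabla W (nabla V \<xi>) - nabla U \<xi> \<in> Xi_inf"
      by (intro Xi_inf_minus DV(1) DW(1) DU(1) \<xi>)
    show "nabla V (nabla W (xi_scale l \<xi>)) - nabla W (nabla V (xi_scale l \<xi>)) - nabla U (xi_scale l \<xi>)
        = xi_scale l (nabla V (nabla W \<xi>) - nabla W (nabla V \<xi>) - nabla U \<xi>)" for l
      by (simp only: \<xi> DV(1,3) DW(1,3) DU(3) xi_scale_minus)
    fix a assume a: "a \<in> D_inf c \<nu>"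
    have d: "delta c \<mu> W a \<in> D_inf c \<nu>" for W by (rule delta_in [OF a])
    have dd: "delta c \<mu> V (delta c \<mu> W a) \<in> D_inf c \<nu>" for V W by (rule delta_in [OF d])
    have e: "xi_act \<mu> \<nu> \<xi> (delta c \<mu> V (delta c \<mu> W a))
        = xi_act \<mu> \<nu> \<xi> (delta c \<mu> W (delta c \<mu> V a)) + xi_act \<mu> \<nu> \<xi> (delta c \<mu> U a)"
      unfolding delta_commutator [OF a VW] U_def [symmetric] by (rule xi_act_plus_right [OF \<xi> dd d])
    have n: "nabla V' (nabla W' (xi_act \<mu> \<nu> \<xi> a)) = xi_act \<mu> \<nu> (nabla V' (nabla W' \<xi>)) a
        + xi_act \<mu> \<nu> (nabla W' \<xi>) (delta c \<mu> V' a)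
        + (xi_act \<mu> \<nu> (nabla V' \<xi>) (delta c \<mu> W' a) + xi_act \<mu> \<nu> \<xi> (delta c \<mu> V' (delta c \<mu> W' a)))"
      if V': "V' \<in> heis c" and W': "W' \<in> heis c" for V' W'
    proof -
      note DV = connectionD [OF conn V'] and DW = connectionD [OF conn W']
      show ?thesis
        unfolding DW(5) [OF \<xi> a]
          DV(2) [OF xi_act_in [OF DW(1) [OF \<xi>] a] xi_act_in [OF \<xi> d]]
          DV(5) [OF DW(1) [OF \<xi>] a] DV(5) [OF \<xi> d] ..
    qed
    show "nabla V (nabla W (xi_act \<mu> \<nu> \<xi> a)) - nabla W (nabla V (xi_act \<mu> \<nu> \<xi> a)) - nabla U (xi_act \<mu> \<nu> \<xi> a)
        = xi_act \<mu> \<nu> (nabla V (nabla W \<xi>) - nabla W (nabla V \<xi>) - nabla U \<xi>) a"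
      unfolding n [OF V W] n [OF W V] DU(5) [OF \<xi> a] e
        xi_act_minus_left [OF Xi_inf_minus [OF DV(1) [OF DW(1) [OF \<xi>]] DW(1) [OF DV(1) [OF \<xi>]]] DU(1) [OF \<xi>] a]
        xi_act_minus_left [OF DV(1) [OF DW(1) [OF \<xi>]] DW(1) [OF DV(1) [OF \<xi>]] a]
      by (simp only: algebra_simps)
  next
    fix \<xi> \<eta> assume \<xi>: "\<xi> \<in> Xi_inf" and \<eta>: "\<eta> \<in> Xi_inf"
    have p: "nabla V (nabla W (\<xi> + \<eta>)) = nabla V (nabla W \<xi>) + nabla V (nabla W \<eta>)"
      by (simp only: DW(2) [OF \<xi> \<eta>] DV(2) [OF DW(1) [OF \<xi>] DW(1) [OF \<eta>]])
    have q: "nabla W (nabla V (\<xi> + \<eta>)) = nabla W (nabla V \<xi>) + nabla W (nabla V \<eta>)"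
      by (simp only: DV(2) [OF \<xi> \<eta>] DW(2) [OF DV(1) [OF \<xi>] DV(1) [OF \<eta>]])
    show "nabla V (nabla W (\<xi> + \<eta>)) - nabla W (nabla V (\<xi> + \<eta>)) - nabla U (\<xi> + \<eta>)
        = nabla V (nabla W \<xi>) - nabla W (nabla V \<xi>) - nabla U \<xi>
          + (nabla V (nabla W \<eta>) - nabla W (nabla V \<eta>) - nabla U \<eta>)"
      unfolding p q DU(2) [OF \<xi> \<eta>] by (simp only: algebra_simps)
  qed
qed

definition skew :: "nat \<Rightarrow> real \<Rightarrow> real \<Rightarrow> xop \<Rightarrow> bool" where
  "skew c \<mu> \<nu> T \<longleftrightarrow> (\<forall>\<xi>\<in>Xi_inf. \<forall>\<eta>\<in>Xi_inf. xi_inner c \<mu> \<nu> (T \<xi>) \<eta> = - xi_inner c \<mu> \<nu> \<xi> (T \<eta>))"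

lemma compatibleD:
  assumes "compatible_connection c \<mu> \<nu> nabla" "W \<in> heis c" "\<xi> \<in> Xi_inf" "\<eta> \<in> Xi_inf"
  shows "xi_inner c \<mu> \<nu> (nabla W \<xi>) \<eta> + xi_inner c \<mu> \<nu> \<xi> (nabla W \<eta>) = delta c \<mu> W (xi_inner c \<mu> \<nu> \<xi> \<eta>)"
  using assms unfolding compatible_connection_def by blast

text \<open>The cancellation behind \<open>curvature_skew\<close>, stated for an arbitrary abelian
  group so that the large terms stay opaque; \<open>b\<close> and \<open>k\<close> are the mixed
  inner products common to both sides.\<close>

lemma group_rearrange:
  fixes a :: "'a::ab_group_add"
  assumes "a + b + (k + d) = e + k + (b + f) + (g + h)"
  shows "a - e - g = - (d - f - h)"
proof -
  have "a - e - g + (d - f - h) = (a + b + (k + d)) - (e + k + (b + f) + (g + h))"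
    by (simp add: algebra_simps)
  then have "a - e - g + (d - f - h) = 0" using assms by simp
  then show ?thesis by (simp only: eq_neg_iff_add_eq_0)
qed

text \<open>Compatibility is differentiated twice, in both orders. The mixed terms agree, and
  \<open>delta_commutator\<close> together with compatibility for the bracket accounts for the
  difference.\<close>

lemma curvature_skew:
  assumes comp: "compatible_connection c \<mu> \<nu> nabla" and VW: "bracket_triple c V W" and \<mu>: "\<mu> \<noteq> 0"
  shows "skew c \<mu> \<nu> (curvature nabla V W)"
  unfolding skew_def
proof (intro ballI)
  fix \<xi> \<eta> assume \<xi>: "\<xi> \<in> Xi_inf" and \<eta>: "\<eta> \<in> Xi_inf"
  let ?i = "xi_inner c \<mu> \<nu>"
  define U where "U = lie_bracket V W"
  have V: "V \<in> heis c" and W: "W \<in> heis c" and U: "U \<in> heis c"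
    using VW by (simp_all add: bracket_triple_def U_def)
  have conn: "connection c \<mu> \<nu> nabla" using comp by (simp add: compatible_connection_def)
  note inV = connectionD(1) [OF conn V] and inW = connectionD(1) [OF conn W] and inU = connectionD(1) [OF conn U]
  have two: "?i (nabla V' (nabla W' \<xi>)) \<eta> + ?i (nabla W' \<xi>) (nabla V' \<eta>)
      + (?i (nabla V' \<xi>) (nabla W' \<eta>) + ?i \<xi> (nabla V' (nabla W' \<eta>)))
      = delta c \<mu> V' (delta c \<mu> W' (?i \<xi> \<eta>))" if V': "V' \<in> heis c" and W': "W' \<in> heis c" for V' W'
  proof -
    note inW = connectionD(1) [OF conn W']
    show ?thesis
      unfolding compatibleD [OF comp V' inW [OF \<xi>] \<eta>] compatibleD [OF comp V' \<xi> inW [OF \<eta>]]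
        delta_plus [OF xi_inner_in [OF inW [OF \<xi>] \<eta> \<mu>] xi_inner_in [OF \<xi> inW [OF \<eta>] \<mu>], symmetric]
        compatibleD [OF comp W' \<xi> \<eta>] ..
  qed
  have "?i (nabla V (nabla W \<xi>)) \<eta> + ?i (nabla W \<xi>) (nabla V \<eta>)
      + (?i (nabla V \<xi>) (nabla W \<eta>) + ?i \<xi> (nabla V (nabla W \<eta>)))
      = ?i (nabla W (nabla V \<xi>)) \<eta> + ?i (nabla V \<xi>) (nabla W \<eta>)
      + (?i (nabla W \<xi>) (nabla V \<eta>) + ?i \<xi> (nabla W (nabla V \<eta>)))
      + (?i (nabla U \<xi>) \<eta> + ?i \<xi> (nabla U \<eta>))"
    unfolding two [OF V W] two [OF W V] compatibleD [OF comp U \<xi> \<eta>]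
      delta_commutator [OF xi_inner_in [OF \<xi> \<eta> \<mu>] VW] U_def [symmetric] ..
  from group_rearrange [OF this]
  have *: "?i (nabla V (nabla W \<xi>)) \<eta> - ?i (nabla W (nabla V \<xi>)) \<eta> - ?i (nabla U \<xi>) \<eta>
      = - (?i \<xi> (nabla V (nabla W \<eta>)) - ?i \<xi> (nabla W (nabla V \<eta>)) - ?i \<xi> (nabla U \<eta>))" .
  have c\<xi>: "curvature nabla V W \<xi> = nabla V (nabla W \<xi>) - nabla W (nabla V \<xi>) - nabla U \<xi>"
    and c\<eta>: "curvature nabla V W \<eta> = nabla V (nabla W \<eta>) - nabla W (nabla V \<eta>) - nabla U \<eta>"
    using \<xi> \<eta> by (simp_all only: curvature_def U_def restrict_apply if_True)
  have m\<xi>: "nabla V (nabla W \<xi>) \<in> Xi_inf" "nabla W (nabla V \<xi>) \<in> Xi_inf" "nabla U \<xi> \<in> Xi_inf"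
    and m\<eta>: "nabla V (nabla W \<eta>) \<in> Xi_inf" "nabla W (nabla V \<eta>) \<in> Xi_inf" "nabla U \<eta> \<in> Xi_inf"
    by (intro inV inW inU \<xi> \<eta>)+
  show "?i (curvature nabla V W \<xi>) \<eta> = - ?i \<xi> (curvature nabla V W \<eta>)"
    unfolding c\<xi> c\<eta> xi_inner_minus_left [OF Xi_inf_minus [OF m\<xi>(1,2)] m\<xi>(3) \<eta> \<mu>]
      xi_inner_minus_left [OF m\<xi>(1,2) \<eta> \<mu>]
      xi_inner_minus_right [OF Xi_inf_minus [OF m\<eta>(1,2)] m\<eta>(3) \<xi> \<mu>]
      xi_inner_minus_right [OF m\<eta>(1,2) \<xi> \<mu>] by (rule *)
qed

lemma nabla0_commutator:
  assumes "f \<in> Xi_inf"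
  shows "nabla0 c \<mu> V (nabla0 c \<mu> W f) x y = nabla0 c \<mu> W (nabla0 c \<mu> V f) x y
     + (of_real (- V $ 2 $ 3) * (of_real (W $ 1 $ 2) * (of_real pi * of_nat c * \<i> / of_real \<mu>) * of_real x
      + of_real (of_nat c * W $ 1 $ 3) * (of_real pi * \<i> / of_real \<mu>))
      - of_real (- W $ 2 $ 3) * (of_real (V $ 1 $ 2) * (of_real pi * of_nat c * \<i> / of_real \<mu>) * of_real x
      + of_real (of_nat c * V $ 1 $ 3) * (of_real pi * \<i> / of_real \<mu>))) * f x y"
  unfolding nabla0_eq
  by (rule fop_commutator [OF Xi_inf_smooth [OF assms] nabla0_pot_derivative nabla0_pot_derivative])

text \<open>For (X, Y) the commutator is multiplication by -\<pi>ci x/\<mu>, which is -c times the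
  Z-component and so cancels against [X, Y] = -cZ. For (X, Z) it is multiplication by -\<pi>i/\<mu>;
  as a scalar this reads \<pi>i/\<mu>, because \<open>xi_scale\<close> conjugates.\<close>

lemma curvature_nabla0:
  assumes f: "f \<in> Xi_inf" and c: "c > 0"
  shows "curvature (nabla0 c \<mu>) X_heis Y_heis f = 0"
    and "curvature (nabla0 c \<mu>) X_heis (Z_heis c) f = xi_scale (of_real pi * \<i> / of_real \<mu>) f"
    and "curvature (nabla0 c \<mu>) Y_heis (Z_heis c) f = 0"
proof -
  have cv: "curvature (nabla0 c \<mu>) V W f x y = nabla0 c \<mu> V (nabla0 c \<mu> W f) x y
      - nabla0 c \<mu> W (nabla0 c \<mu> V f) x y - nabla0 c \<mu> (lie_bracket V W) f x y" for V W x y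
    using f by (simp add: curvature_def)
  show "curvature (nabla0 c \<mu>) X_heis Y_heis f = 0"
    by (intro ext) (use c in \<open>simp add: cv nabla0_commutator [OF f, of c \<mu> X_heis Y_heis] bracket_XY heis_entries
        nabla0_def [of c \<mu> "- (real c *\<^sub>R Z_heis c)"]\<close>)
  show "curvature (nabla0 c \<mu>) X_heis (Z_heis c) f = xi_scale (of_real pi * \<i> / of_real \<mu>) f"
    by (intro ext) (use c in \<open>simp add: cv nabla0_commutator [OF f, of c \<mu> X_heis "Z_heis c"] bracket_XZ heis_entries
        nabla0_def [of c \<mu> 0] xi_scale_def\<close>)
  show "curvature (nabla0 c \<mu>) Y_heis (Z_heis c) f = 0"
    by (intro ext) (use c in \<open>simp add: cv nabla0_commutator [OF f, of c \<mu> Y_heis "Z_heis c"] bracket_YZ heis_entries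
        nabla0_def [of c \<mu> 0]\<close>)
qed

subsection \<open>Minimality\<close>

definition E_id :: xop where
  "E_id = (\<lambda>\<xi>\<in>Xi_inf. \<xi>)"

lemma E_id_in: "E_id \<in> E_alg c \<mu> \<nu>"
  unfolding E_id_def by (rule E_algI) auto

lemma curvature_0:
  assumes "connection c \<mu> \<nu> nabla" "\<xi> \<in> Xi_inf"
  shows "curvature nabla X_heis (Z_heis c) \<xi> = nabla X_heis (nabla (Z_heis c) \<xi>) - nabla (Z_heis c) (nabla X_heis \<xi>)"
proof -
  have "nabla (0 *\<^sub>R Z_heis c) \<xi> = xi_scale (of_real 0) (nabla (Z_heis c) \<xi>)"
    by (rule connectionD(4) [OF assms(1) heis_in(3) assms(2)])
  also have "\<dots> = 0" by (simp add: xi_scale_def fun_eq_iff)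
  finally have "nabla (0 *\<^sub>R Z_heis c) \<xi> = 0" .
  then show ?thesis
    using assms(2) by (simp only: curvature_def restrict_apply if_True bracket_XZ diff_zero)
qed

text \<open>The derivation terms of the two Leibniz rules are equal and cancel, which leaves a
  module map.\<close>

lemma connection_difference:
  assumes "connection c \<mu> \<nu> nabla" "connection c \<mu> \<nu> nabla'" "W \<in> heis c"
  shows "(\<lambda>\<xi>\<in>Xi_inf. nabla W \<xi> - nabla' W \<xi>) \<in> E_alg c \<mu> \<nu>"
proof (rule E_algI)
  note D = connectionD [OF assms(1,3)] and D' = connectionD [OF assms(2,3)]
  fix \<xi> assume \<xi>: "\<xi> \<in> Xi_inf"
  show "nabla W \<xi> - nabla' W \<xi> \<in> Xi_inf"
    by (intro Xi_inf_minus D(1) D'(1) \<xi>)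
  show "nabla W (xi_scale l \<xi>) - nabla' W (xi_scale l \<xi>) = xi_scale l (nabla W \<xi> - nabla' W \<xi>)" for l
    by (simp only: D(3) [OF \<xi>] D'(3) [OF \<xi>] xi_scale_minus)
  show "nabla W (xi_act \<mu> \<nu> \<xi> a) - nabla' W (xi_act \<mu> \<nu> \<xi> a) = xi_act \<mu> \<nu> (nabla W \<xi> - nabla' W \<xi>) a"
    if a: "a \<in> D_inf c \<nu>" for a
    unfolding D(5) [OF \<xi> a] D'(5) [OF \<xi> a] xi_act_minus_left [OF D(1) [OF \<xi>] D'(1) [OF \<xi>] a] by simp
  show "nabla W (\<xi> + \<eta>) - nabla' W (\<xi> + \<eta>) = nabla W \<xi> - nabla' W \<xi> + (nabla W \<eta> - nabla' W \<eta>)"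
    if \<eta>: "\<eta> \<in> Xi_inf" for \<eta>
    unfolding D(2) [OF \<xi> \<eta>] D'(2) [OF \<xi> \<eta>] by (simp only: algebra_simps)
qed

context frame
begin

text \<open>On a rank-one operator the commutator with a compatible connection is
  \<open>\<langle>\<nabla>\<xi>, \<eta>\<rangle> + \<langle>\<xi>, \<nabla>\<eta>\<rangle>\<close>, whose trace is that of a derivative.\<close>

lemma tr_connection_commutator:
  assumes comp: "compatible_connection c \<mu> \<nu> nabla" and W: "W \<in> heis c"
    and inv: "\<And>a. a \<in> D_inf c \<nu> \<Longrightarrow> trace_D (delta c \<mu> W a) = 0" and A: "A \<in> E_alg c \<mu> \<nu>"
  shows "(\<lambda>\<zeta>\<in>Xi_inf. nabla W (A \<zeta>) - A (nabla W \<zeta>)) \<in> E_alg c \<mu> \<nu>"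
    and "tr (\<lambda>\<zeta>\<in>Xi_inf. nabla W (A \<zeta>) - A (nabla W \<zeta>)) = 0"
proof -
  let ?i = "xi_inner c \<mu> \<nu>"
  have conn: "connection c \<mu> \<nu> nabla" using comp by (simp add: compatible_connection_def)
  note D = connectionD [OF conn W]
  have Ae: "A (e i) \<in> Xi_inf" for i by (intro E_algD [OF A] e_in)
  note nAe = D(1) [OF Ae] and ne = D(1) [OF e_in]
  let ?S = "E_inner_sum c \<mu> \<nu> (\<lambda>i. nabla W (A (e i))) e n"
  let ?T = "E_inner_sum c \<mu> \<nu> (\<lambda>i. A (e i)) (\<lambda>i. nabla W (e i)) n"
  have S: "?S \<in> E_alg c \<mu> \<nu>" by (rule E_inner_sum_in [OF nAe e_in \<mu>])
  have T: "?T \<in> E_alg c \<mu> \<nu>" by (rule E_inner_sum_in [OF Ae ne \<mu>])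
  have AE: "A \<zeta> = (\<Sum>i<n. E_inner c \<mu> \<nu> (A (e i)) (e i) \<zeta>)" if "\<zeta> \<in> Xi_inf" for \<zeta>
    using that by (subst expansion [OF A]) (simp add: E_inner_sum_def)
  have "nabla W (A \<zeta>) - A (nabla W \<zeta>) = ?S \<zeta> + ?T \<zeta>" if \<zeta>: "\<zeta> \<in> Xi_inf" for \<zeta>
  proof -
    have in_Xi: "E_inner c \<mu> \<nu> (A (e i)) (e i) \<zeta> \<in> Xi_inf" for i
      by (rule E_algD(1) [OF E_inner_in [OF Ae e_in \<mu>] \<zeta>])
    have one: "nabla W (E_inner c \<mu> \<nu> (A (e i)) (e i) \<zeta>) = E_inner c \<mu> \<nu> (nabla W (A (e i))) (e i) \<zeta>
        + (E_inner c \<mu> \<nu> (A (e i)) (nabla W (e i)) \<zeta> + E_inner c \<mu> \<nu> (A (e i)) (e i) (nabla W \<zeta>))" for i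
    proof -
      have E: "E_inner c \<mu> \<nu> a b z = xi_act \<mu> \<nu> a (?i b z)" if "z \<in> Xi_inf" for a b z
        using that by (simp add: E_inner_def)
      show ?thesis
        unfolding E [OF \<zeta>] E [OF D(1) [OF \<zeta>]] D(5) [OF Ae xi_inner_in [OF e_in \<zeta> \<mu>]]
          compatibleD [OF comp W e_in \<zeta>, symmetric]
          xi_act_plus_right [OF Ae xi_inner_in [OF ne \<zeta> \<mu>] xi_inner_in [OF e_in D(1) [OF \<zeta>] \<mu>]] ..
    qed
    have "nabla W (A \<zeta>) = ?S \<zeta> + (?T \<zeta> + A (nabla W \<zeta>))"
      unfolding AE [OF \<zeta>] connection_sum [OF conn W in_Xi] one AE [OF D(1) [OF \<zeta>]]
      using \<zeta> by (simp only: sum.distrib E_inner_sum_def restrict_apply if_True)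
    then show ?thesis by (simp only: algebra_simps)
  qed
  then have eq: "(\<lambda>\<zeta>\<in>Xi_inf. nabla W (A \<zeta>) - A (nabla W \<zeta>)) = E_add ?S ?T"
    unfolding E_add_def by (rule restrict_ext)
  show "(\<lambda>\<zeta>\<in>Xi_inf. nabla W (A \<zeta>) - A (nabla W \<zeta>)) \<in> E_alg c \<mu> \<nu>"
    unfolding eq by (rule E_add_in [OF S T])
  have "trace_D (?i (e i) (nabla W (A (e i)))) + trace_D (?i (nabla W (e i)) (A (e i))) = 0" for i
  proof -
    have "trace_D (?i (nabla W (e i)) (A (e i))) + trace_D (?i (e i) (nabla W (A (e i))))
        = trace_D (delta c \<mu> W (?i (e i) (A (e i))))"
      unfolding compatibleD [OF comp W e_in Ae, symmetric]
      by (rule trace_D_plus [symmetric, OF xi_inner_in [OF ne Ae \<mu>] xi_inner_in [OF e_in nAe \<mu>]])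
        (unfold compatibleD [OF comp W e_in Ae], rule delta_in [OF xi_inner_in [OF e_in Ae \<mu>]])
    also have "\<dots> = 0" by (rule inv [OF xi_inner_in [OF e_in Ae \<mu>]])
    finally show ?thesis by (simp only: add.commute)
  qed
  then show "tr (\<lambda>\<zeta>\<in>Xi_inf. nabla W (A \<zeta>) - A (nabla W \<zeta>)) = 0"
    unfolding eq tr_add [OF S T] tr_sum [OF nAe e_in] tr_sum [OF Ae ne] sum.distrib [symmetric] by simp
qed

text \<open>A skew operator has -T as its adjoint, so the number in question is the trace of the
  adjoint of T times T.\<close>

lemma tr_skew_square:
  assumes T: "T \<in> E_alg c \<mu> \<nu>" and sk: "skew c \<mu> \<nu> T"
  shows "- tr (compose Xi_inf T T) \<in> \<real>\<^sub>\<ge>\<^sub>0"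
proof -
  have adj: "E_is_adjoint c \<mu> \<nu> (E_scale (-1) T) T"
    using sk by (simp add: E_is_adjoint_def skew_def E_scale_def xi_scale_m1 xi_inner_uminus)
  have "compose Xi_inf (E_scale (-1) T) T = E_scale (-1) (compose Xi_inf T T)"
    using E_algD(1) [OF T] by (simp add: compose_def E_scale_def fun_eq_iff)
  then have "tr (compose Xi_inf (E_scale (-1) T) T) = - tr (compose Xi_inf T T)"
    by (simp add: tr_scale)
  then show ?thesis
    using tr_faithful(1) [OF E_scale_in [OF T] T adj] by simp
qed

lemma tr_E_id: "tr E_id \<in> \<real>\<^sub>\<ge>\<^sub>0"
proof -
  have "E_is_adjoint c \<mu> \<nu> E_id E_id" by (simp add: E_is_adjoint_def E_id_def)
  from tr_faithful(1) [OF E_id_in E_id_in this] have "tr (compose Xi_inf E_id E_id) \<in> \<real>\<^sub>\<ge>\<^sub>0" .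
  moreover have "compose Xi_inf E_id E_id = E_id" by (simp add: compose_def E_id_def fun_eq_iff)
  ultimately show ?thesis by simp
qed

lemma YM_eq:
  assumes conn: "connection c \<mu> \<nu> nabla" and c: "c > 0"
  shows "YM c \<mu> \<nu> nabla
    = - tr (compose Xi_inf (curvature nabla X_heis Y_heis) (curvature nabla X_heis Y_heis))
      + - tr (compose Xi_inf (curvature nabla X_heis (Z_heis c)) (curvature nabla X_heis (Z_heis c)))
      + - tr (compose Xi_inf (curvature nabla Y_heis (Z_heis c)) (curvature nabla Y_heis (Z_heis c)))"
proof -
  note cc = compose_in [OF curvature_in [OF conn] curvature_in [OF conn]]
  note p = cc [OF bracket_triples(1) [OF c] bracket_triples(1) [OF c]]
    cc [OF bracket_triples(2) [OF c] bracket_triples(2) [OF c]]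
    cc [OF bracket_triples(3) [OF c] bracket_triples(3) [OF c]]
  show ?thesis
    unfolding YM_def form_pairing_def Let_def
      trace_E_tr [OF E_add_in [OF E_add_in [OF p(1,2)] p(3)]] tr_add [OF E_add_in [OF p(1,2)] p(3)]
      tr_add [OF p(1,2)] by simp
qed

text \<open>With A the difference of the two connections, \<open>B\<close> equals [nabla0_X, A_Z] -
  [nabla0_Z, A_X] + [A_X, A_Z]. The first two brackets are traceless by
  \<open>tr_connection_commutator\<close>, the last by \<open>tr_commute\<close>.\<close>

lemma tr_curvature_XZ:
  assumes comp: "compatible_connection c \<mu> \<nu> nabla" and c: "c > 0"
  defines "l \<equiv> of_real pi * \<i> / of_real \<mu>"
  defines "B \<equiv> E_add (curvature nabla X_heis (Z_heis c)) (E_scale (- l) E_id)"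
  shows "B \<in> E_alg c \<mu> \<nu>" "skew c \<mu> \<nu> B" "tr B = 0"
proof -
  let ?n0 = "nabla0 c \<mu>"
  let ?Z = "Z_heis c"
  have comp0: "compatible_connection c \<mu> \<nu> ?n0" by (rule nabla0_compatible [OF \<mu>])
  have conn: "connection c \<mu> \<nu> nabla" and conn0: "connection c \<mu> \<nu> ?n0"
    using comp comp0 by (simp_all add: compatible_connection_def)
  let ?\<Theta> = "curvature nabla X_heis ?Z"
  have \<Theta>: "?\<Theta> \<in> E_alg c \<mu> \<nu>" by (rule curvature_in [OF conn bracket_triples(2) [OF c]])
  show B: "B \<in> E_alg c \<mu> \<nu>" unfolding B_def by (intro E_add_in E_scale_in E_id_in \<Theta>)
  have B_app: "B \<zeta> = ?\<Theta> \<zeta> - xi_scale l \<zeta>" if "\<zeta> \<in> Xi_inf" for \<zeta>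
    using that by (simp add: B_def E_add_def E_scale_def E_id_def xi_scale_def fun_eq_iff)
  \<comment> \<open>Being imaginary, the scalar \<open>l\<close> acts as a skew operator, so
    subtracting it from the curvature preserves skewness.\<close>
  have cl: "cnj l = - l" by (simp add: l_def)
  have sk\<Theta>: "skew c \<mu> \<nu> ?\<Theta>" by (rule curvature_skew [OF comp bracket_triples(2) [OF c] \<mu>])
  show "skew c \<mu> \<nu> B"
    unfolding skew_def
  proof (intro ballI)
    fix \<xi> \<eta> assume \<xi>: "\<xi> \<in> Xi_inf" and \<eta>: "\<eta> \<in> Xi_inf"
    have "xi_inner c \<mu> \<nu> (?\<Theta> \<xi>) \<eta> = - xi_inner c \<mu> \<nu> \<xi> (?\<Theta> \<eta>)"
      using sk\<Theta> \<xi> \<eta> by (simp add: skew_def)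
    moreover have "xi_inner c \<mu> \<nu> (xi_scale l \<xi>) \<eta> = - xi_inner c \<mu> \<nu> \<xi> (xi_scale l \<eta>)"
      by (simp add: xi_inner_scale_left xi_inner_scale_right cl fun_eq_iff)
    ultimately show "xi_inner c \<mu> \<nu> (B \<xi>) \<eta> = - xi_inner c \<mu> \<nu> \<xi> (B \<eta>)"
      unfolding B_app [OF \<xi>] B_app [OF \<eta>]
        xi_inner_minus_left [OF E_algD(1) [OF \<Theta> \<xi>] Xi_inf_scale [OF \<xi>] \<eta> \<mu>]
        xi_inner_minus_right [OF E_algD(1) [OF \<Theta> \<eta>] Xi_inf_scale [OF \<eta>] \<xi> \<mu>]
      by simp
  qed
  define AX where "AX = (\<lambda>\<xi>\<in>Xi_inf. nabla X_heis \<xi> - ?n0 X_heis \<xi>)"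
  define AZ where "AZ = (\<lambda>\<xi>\<in>Xi_inf. nabla ?Z \<xi> - ?n0 ?Z \<xi>)"
  have AX: "AX \<in> E_alg c \<mu> \<nu>" and AZ: "AZ \<in> E_alg c \<mu> \<nu>"
    unfolding AX_def AZ_def by (rule connection_difference [OF conn conn0]; rule heis_in)+
  define CX where "CX = (\<lambda>\<zeta>\<in>Xi_inf. ?n0 X_heis (AZ \<zeta>) - AZ (?n0 X_heis \<zeta>))"
  define CZ where "CZ = (\<lambda>\<zeta>\<in>Xi_inf. ?n0 ?Z (AX \<zeta>) - AX (?n0 ?Z \<zeta>))"
  have CX: "CX \<in> E_alg c \<mu> \<nu>" "tr CX = 0"
    unfolding CX_def by (rule tr_connection_commutator [OF comp0 heis_in(1) trace_D_delta_X AZ]; assumption)+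
  have CZ: "CZ \<in> E_alg c \<mu> \<nu>" "tr CZ = 0"
    unfolding CZ_def by (rule tr_connection_commutator [OF comp0 heis_in(3) trace_D_delta_Z AX])+
  have P: "compose Xi_inf AX AZ \<in> E_alg c \<mu> \<nu>" "compose Xi_inf AZ AX \<in> E_alg c \<mu> \<nu>"
    by (intro compose_in AX AZ)+
  let ?R = "E_add (E_add CX (E_scale (-1) CZ)) (E_add (compose Xi_inf AX AZ) (E_scale (-1) (compose Xi_inf AZ AX)))"
  have R1: "E_add CX (E_scale (-1) CZ) \<in> E_alg c \<mu> \<nu>"
    and R2: "E_add (compose Xi_inf AX AZ) (E_scale (-1) (compose Xi_inf AZ AX)) \<in> E_alg c \<mu> \<nu>"
    by (intro E_add_in E_scale_in CX CZ P)+
  have "B = ?R"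
  proof (rule E_alg_eqI [OF B E_add_in [OF R1 R2]])
    fix \<zeta> assume \<zeta>: "\<zeta> \<in> Xi_inf"
    have nX: "nabla X_heis \<xi> = ?n0 X_heis \<xi> + AX \<xi>" and nZ: "nabla ?Z \<xi> = ?n0 ?Z \<xi> + AZ \<xi>"
      if "\<xi> \<in> Xi_inf" for \<xi>
      using that by (simp_all add: AX_def AZ_def)
    have in0: "?n0 W \<zeta> \<in> Xi_inf" for W by (rule nabla0_in [OF \<zeta>])
    have inA: "AX \<zeta> \<in> Xi_inf" "AZ \<zeta> \<in> Xi_inf"
      by (rule E_algD(1) [OF AX \<zeta>], rule E_algD(1) [OF AZ \<zeta>])
    have "nabla X_heis (nabla ?Z \<zeta>)
        = ?n0 X_heis (?n0 ?Z \<zeta>) + ?n0 X_heis (AZ \<zeta>) + (AX (?n0 ?Z \<zeta>) + AX (AZ \<zeta>))"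
      unfolding nZ [OF \<zeta>] nX [OF Xi_inf_plus [OF in0 inA(2)]] nabla0_plus [OF in0 inA(2)]
        E_algD(2) [OF AX in0 inA(2)] ..
    moreover have "nabla ?Z (nabla X_heis \<zeta>)
        = ?n0 ?Z (?n0 X_heis \<zeta>) + ?n0 ?Z (AX \<zeta>) + (AZ (?n0 X_heis \<zeta>) + AZ (AX \<zeta>))"
      unfolding nX [OF \<zeta>] nZ [OF Xi_inf_plus [OF in0 inA(1)]] nabla0_plus [OF in0 inA(1)]
        E_algD(2) [OF AZ in0 inA(1)] ..
    moreover have "?n0 X_heis (?n0 ?Z \<zeta>) - ?n0 ?Z (?n0 X_heis \<zeta>) = xi_scale l \<zeta>"
      using curvature_nabla0(2) [OF \<zeta> c, of \<mu>] curvature_0 [OF conn0 \<zeta>] by (simp only: l_def)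
    ultimately have "B \<zeta> = ?n0 X_heis (AZ \<zeta>) - AZ (?n0 X_heis \<zeta>) - (?n0 ?Z (AX \<zeta>) - AX (?n0 ?Z \<zeta>))
        + (AX (AZ \<zeta>) - AZ (AX \<zeta>))"
      unfolding B_app [OF \<zeta>] curvature_0 [OF conn \<zeta>] by (simp only: algebra_simps)
    then show "B \<zeta> = ?R \<zeta>"
      using \<zeta> by (simp only: E_add_def E_scale_def CX_def CZ_def compose_def restrict_apply if_True xi_scale_m1
          diff_conv_add_uminus)
  qed
  then show "tr B = 0"
    unfolding tr_add [OF R1 R2] tr_add [OF CX(1) E_scale_in [OF CZ(1)]] tr_add [OF P(1) E_scale_in [OF P(2)]]
    by (simp add: tr_add [OF R1 R2] tr_add [OF CX(1) E_scale_in [OF CZ(1)]] tr_add [OF P(1) E_scale_in [OF P(2)]]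
        tr_scale CX(2) CZ(2) tr_commute [OF AX AZ])
qed

text \<open>Expanding the square of \<open>B\<close> plus the scalar \<open>l\<close>, the cross
  term is 2l times the trace of \<open>B\<close> and vanishes, while l^2 = -(\<pi>/\<mu>)^2. What
  remains is minus the trace of the square of a skew operator.\<close>

lemma tr_curvature_XZ_square:
  assumes comp: "compatible_connection c \<mu> \<nu> nabla" and c: "c > 0"
  defines "\<Theta> \<equiv> curvature nabla X_heis (Z_heis c)"
  shows "- tr (compose Xi_inf \<Theta> \<Theta>) - of_real ((pi / \<mu>)\<^sup>2) * tr E_id \<in> \<real>\<^sub>\<ge>\<^sub>0"
proof -
  define l where "l = of_real pi * \<i> / complex_of_real \<mu>"
  define B where "B = E_add \<Theta> (E_scale (- l) E_id)"
  note B = tr_curvature_XZ [OF comp c, folded \<Theta>_def l_def, folded B_def]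
  have conn: "connection c \<mu> \<nu> nabla" using comp by (simp add: compatible_connection_def)
  have \<Theta>: "\<Theta> \<in> E_alg c \<mu> \<nu>" unfolding \<Theta>_def by (rule curvature_in [OF conn bracket_triples(2) [OF c]])
  have \<Theta>_app: "\<Theta> \<zeta> = B \<zeta> + xi_scale l \<zeta>" if "\<zeta> \<in> Xi_inf" for \<zeta>
    using that by (simp add: B_def E_add_def E_scale_def E_id_def xi_scale_def fun_eq_iff)
  have BB: "compose Xi_inf B B \<in> E_alg c \<mu> \<nu>" by (rule compose_in [OF B(1) B(1)])
  have s: "E_scale (2 * l) B \<in> E_alg c \<mu> \<nu>" "E_scale (l * l) E_id \<in> E_alg c \<mu> \<nu>"
    by (intro E_scale_in B(1) E_id_in)+
  have eq: "compose Xi_inf \<Theta> \<Theta> = E_add (compose Xi_inf B B) (E_add (E_scale (2 * l) B) (E_scale (l * l) E_id))"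
  proof (rule E_alg_eqI [OF compose_in [OF \<Theta> \<Theta>] E_add_in [OF BB E_add_in [OF s]]])
    fix \<zeta> assume \<zeta>: "\<zeta> \<in> Xi_inf"
    have B\<zeta>: "B \<zeta> \<in> Xi_inf" by (rule E_algD(1) [OF B(1) \<zeta>])
    have "\<Theta> (\<Theta> \<zeta>) = B (B \<zeta>) + xi_scale l (B \<zeta>) + (xi_scale l (B \<zeta>) + xi_scale l (xi_scale l \<zeta>))"
      unfolding \<Theta>_app [OF E_algD(1) [OF \<Theta> \<zeta>]] unfolding \<Theta>_app [OF \<zeta>]
        E_algD(2) [OF B(1) B\<zeta> Xi_inf_scale [OF \<zeta>]] E_algD(3) [OF B(1) \<zeta>] xi_scale_plus ..
    also have "\<dots> = B (B \<zeta>) + (xi_scale (2 * l) (B \<zeta>) + xi_scale (l * l) \<zeta>)"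
      by (simp add: xi_scale_def fun_eq_iff algebra_simps)
    finally show "compose Xi_inf \<Theta> \<Theta> \<zeta>
        = E_add (compose Xi_inf B B) (E_add (E_scale (2 * l) B) (E_scale (l * l) E_id)) \<zeta>"
      using \<zeta> by (simp only: E_add_def E_scale_def E_id_def compose_def restrict_apply if_True)
  qed
  have "l * l = - of_real ((pi / \<mu>)\<^sup>2)"
    by (simp add: l_def power2_eq_square mult_ac)
  then have "- tr (compose Xi_inf \<Theta> \<Theta>) - of_real ((pi / \<mu>)\<^sup>2) * tr E_id = - tr (compose Xi_inf B B)"
    unfolding eq tr_add [OF BB E_add_in [OF s]] tr_add [OF s] by (simp add: tr_scale B(3))
  then show ?thesis using tr_skew_square [OF B(1,2)] by simp
qed

lemma YM_nabla0:
  assumes c: "c > 0"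
  shows "YM c \<mu> \<nu> (nabla0 c \<mu>) = of_real ((pi / \<mu>)\<^sup>2) * tr E_id"
proof -
  let ?n0 = "nabla0 c \<mu>"
  define l where "l = of_real pi * \<i> / complex_of_real \<mu>"
  have conn: "connection c \<mu> \<nu> ?n0"
    using nabla0_compatible [OF \<mu>] by (simp add: compatible_connection_def)
  have z: "tr E_zero = 0" by (simp add: tr_def E_zero_def e_in xi_inner_zero trace_D_def case_prod_unfold)
  have zz: "compose Xi_inf E_zero E_zero = E_zero" by (simp add: compose_def E_zero_def Xi_inf_zero fun_eq_iff)
  have 1: "curvature ?n0 X_heis Y_heis = E_zero"
    and 3: "curvature ?n0 Y_heis (Z_heis c) = E_zero"
    and 2: "curvature ?n0 X_heis (Z_heis c) = E_scale l E_id"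
    by (rule E_alg_eqI [OF curvature_in [OF conn bracket_triples(1) [OF c]] E_zero_in],
        simp only: curvature_nabla0(1) [OF _ c] E_zero_def restrict_apply if_True,
        rule E_alg_eqI [OF curvature_in [OF conn bracket_triples(3) [OF c]] E_zero_in],
        simp only: curvature_nabla0(3) [OF _ c] E_zero_def restrict_apply if_True,
        rule E_alg_eqI [OF curvature_in [OF conn bracket_triples(2) [OF c]] E_scale_in [OF E_id_in]],
        simp only: curvature_nabla0(2) [OF _ c] E_scale_def E_id_def l_def restrict_apply if_True)
  have "compose Xi_inf (E_scale l E_id) (E_scale l E_id) = E_scale (l * l) E_id"
    by (simp add: compose_def E_scale_def E_id_def fun_eq_iff Xi_inf_scale xi_scale_scale)
  moreover have "l * l = - of_real ((pi / \<mu>)\<^sup>2)"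
    by (simp add: l_def power2_eq_square mult_ac)
  ultimately show ?thesis
    unfolding YM_eq [OF conn c] 1 2 3 zz z by (simp add: tr_scale)
qed

text \<open>By \<open>YM_nabla0\<close> the subtracted value is exactly the constant in
  \<open>tr_curvature_XZ_square\<close>, so the difference is a sum of three nonnegative
  contributions, one for each component of the curvature.\<close>

theorem YM_minimum:
  assumes comp: "compatible_connection c \<mu> \<nu> nabla" and c: "c > 0"
  shows "YM c \<mu> \<nu> nabla - YM c \<mu> \<nu> (nabla0 c \<mu>) \<in> \<real>\<^sub>\<ge>\<^sub>0"
proof -
  have conn: "connection c \<mu> \<nu> nabla" using comp by (simp add: compatible_connection_def)
  have p: "- tr (compose Xi_inf (curvature nabla V W) (curvature nabla V W)) \<in> \<real>\<^sub>\<ge>\<^sub>0"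
    if "bracket_triple c V W" for V W
    by (intro tr_skew_square curvature_in [OF conn] curvature_skew [OF comp] that \<mu>)
  show ?thesis
    using nonneg_Reals_add_I [OF nonneg_Reals_add_I [OF p [OF bracket_triples(1) [OF c]]
        tr_curvature_XZ_square [OF comp c]] p [OF bracket_triples(3) [OF c]]]
    unfolding YM_eq [OF conn c] YM_nabla0 [OF c] by (simp add: algebra_simps)
qed

lemma YM_nabla0_nonneg: "c > 0 \<Longrightarrow> YM c \<mu> \<nu> (nabla0 c \<mu>) \<in> \<real>\<^sub>\<ge>\<^sub>0"
  unfolding YM_nabla0 by (intro nonneg_Reals_mult_I tr_E_id, subst nonneg_Reals_of_real_iff) simp

end

theorem theorem2p13:
  fixes c :: nat and \<mu> \<nu> :: real
  assumes "c > 0" and "\<mu> \<noteq> 0" and "\<nu> \<noteq> 0"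
  shows "compatible_connection c \<mu> \<nu> (nabla0 c \<mu>) \<and>
    YM c \<mu> \<nu> (nabla0 c \<mu>) \<in> \<real> \<and>
    (\<forall>nabla. compatible_connection c \<mu> \<nu> nabla \<longrightarrow>
       YM c \<mu> \<nu> nabla \<in> \<real> \<and> Re (YM c \<mu> \<nu> nabla) \<ge> Re (YM c \<mu> \<nu> (nabla0 c \<mu>)))"
proof -
  \<comment> \<open>The frame is an auxiliary choice: \<open>trace_E\<close>, and with it
    \<open>YM\<close>, is independent of it by \<open>trace_E_eq\<close>.\<close>
  obtain n e where "frame \<mu> n e"
    using frame_exists [OF assms(2)] by blast
  then interpret frame c \<mu> \<nu> n e .
  have 0: "YM c \<mu> \<nu> (nabla0 c \<mu>) \<in> \<real>\<^sub>\<ge>\<^sub>0"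
    by (rule YM_nabla0_nonneg [OF assms(1)])
  have "YM c \<mu> \<nu> nabla \<in> \<real> \<and> Re (YM c \<mu> \<nu> nabla) \<ge> Re (YM c \<mu> \<nu> (nabla0 c \<mu>))"
    if "compatible_connection c \<mu> \<nu> nabla" for nabla
    \<comment> \<open>A nonnegative difference from a real number gives both the reality of the
      value and the inequality of real parts.\<close>
    using YM_minimum [OF that assms(1)] 0
    by (auto simp: complex_nonneg_Reals_iff complex_is_Real_iff)
  then show ?thesis
    using nabla0_compatible [OF assms(2)] 0 by (auto simp: complex_nonneg_Reals_iff complex_is_Real_iff)
qed

end
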